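(* For any interval $I\subseteq [0,\frac{\pi}{4}]$ and any $r,\delta>0$, one has $$\varepsilon^r \int_I \tilde{\tau}_\varepsilon^r(\omega)\, d\omega = c_r |I| + \begin{cases} O_{r,\delta}(\varepsilon^{\frac18-\delta}) & \text{if } r\neq 2,\\ O_{r,\delta}(\varepsilon^{\frac14-\delta}) & \text{if } r=2,\end{cases}\qquad \text{as } \varepsilon\to 0^+,$$ where $$c_r=\frac{12}{\pi^2}\int_0^{1/2}\left( x\big(x^{r-1}+(1-x)^{r-1}\big)+\frac{1-(1-x)^r}{rx(1-x)}-\frac{1-(1-x)^{r+1}}{(r+1)x(1-x)}\right)dx .$$
   Context: For $0<\varepsilon<\frac12$ and a direction (angle) $\omega$, the first exit time (free path length) of a unit-speed particle that starts at the origin $O=(0,0)$ and moves along the ray of direction $\omega$, with circular scatterers of radius $\varepsilon$ centered at all nonzero integer lattice points, is $$\tilde{\tau}_\varepsilon(\omega)=\inf\{\tau>0 : (\tau\cos\omega,\tau\sin\omega)\in D_\varepsilon+(\mathbb{Z}^2\setminus\{(0,0)\})\},\qquad D_\varepsilon=\{(x,y)\in\mathbb{R}^2: x^2+y^2=\varepsilon^2\}.$$ $\tilde\tau_\varepsilon^r(\omega)$ means $(\tilde\tau_\varepsilon(\omega))^r$, and $|I|$ is the length of $I$. The notation $F=O_{r,\delta}(G)$ as $\varepsilon\to0^+$ means $|F|\le C\,G$ for all sufficiently small $\varepsilon>0$, where the constant $C$ depends only on $r$ and $\delta$. *)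

theory Defs
  imports "HOL-Analysis.Analysis"
begin

definition scatterer :: "real \<Rightarrow> (real \<times> real) set"
  where "scatterer \<epsilon> = {(x, y). x\<^sup>2 + y\<^sup>2 = \<epsilon>\<^sup>2}"

text \<open>
  The sum of sets below is the Minkowski sum. For \<open>0 < \<epsilon> < 1/2\<close> the set of hitting times is
  nonempty (Dirichlet approximation) and bounded below by \<open>1/2\<close>, so the infimum is the
  honest one and the first exit time is a positive real; it is moreover at most a constant
  times \<open>1 / \<epsilon>\<close>, so that its real powers are integrable over bounded intervals.
\<close>

definition free_path_length :: "real \<Rightarrow> real \<Rightarrow> real"
  where "free_path_length \<epsilon> \<omega> =
    Inf {\<tau>. \<tau> > 0 \<and> (\<tau> * cos \<omega>, \<tau> * sin \<omega>) \<in> scatterer \<epsilon> + (\<int> \<times> \<int> - {(0, 0)})}"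

text \<open>
  The integrand is bounded on \<open>(0, 1/2]\<close>; its value at \<open>x = 0\<close>, where the fractions are
  undefined on paper, does not affect the integral.
\<close>

definition moment_const :: "real \<Rightarrow> real"
  where "moment_const r = 12 / pi\<^sup>2 *
    (LINT x:{0..1/2}|lborel.
        x * (x powr (r - 1) + (1 - x) powr (r - 1))
      + (1 - (1 - x) powr r) / (r * x * (1 - x))
      - (1 - (1 - x) powr (r + 1)) / ((r + 1) * x * (1 - x)))"

end

theory Submission
  imports Defs "HOL-Number_Theory.Totient" "HOL-Computational_Algebra.Squarefree" "HOL-Real_Asymp.Real_Asymp"
begin

text \<open>
  A ray of direction \<open>\<omega>\<close> meets the scatterer around \<open>(q, a)\<close> iff
  \<open>\<bar>q sin \<omega> - a cos \<omega>\<bar> \<le> \<epsilon>\<close>, and in the sector considered the scatterer met first is the one with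
  the smallest \<open>q\<close>. Let \<open>n\<close> be the length of \<open>(q, a)\<close>. The directions whose first scatterer is
  \<open>(q, a)\<close> form an interval near \<open>arctan (a / q)\<close>: the disc subtends an arc of length about
  \<open>2 \<epsilon> / n\<close>, and the discs around the two Farey parents \<open>(b, k)\<close> and \<open>(q - b, a - k)\<close>, where
  \<open>a b = 1 + q k\<close>, cut off a shadow on each side (\<open>first_hit_iff\<close>, \<open>measure_first_hit\<close>). On that
  interval the free path is \<open>n\<close> up to \<open>2 \<epsilon>\<close>. Up to an error of size \<open>\<epsilon>\<close> times a logarithm the
  moment over an interval of directions is therefore a sum over coprime pairs \<open>(q, a)\<close> of terms
  that depend on \<open>\<epsilon> n\<close> and on the inverse \<open>b\<close> of \<open>a\<close> modulo \<open>q\<close> (\<open>lattice_term\<close>).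

  The joint distribution of \<open>a / q\<close> and \<open>b / q\<close> is what has to be known. Completing the count of
  inverse pairs in a box leads to Kloosterman sums. Their fourth moment counts solutions of
  \<open>x + y = z + w\<close>, \<open>1/x + 1/y = 1/z + 1/w\<close> modulo \<open>q\<close>, of which there are \<open>O(q^(2 + \<delta>))\<close>, and every
  single sum occurs \<open>\<phi>(q)\<close> times in this moment, up to a multiplicity bounded by the gcd of a frequency
  with \<open>q\<close>, because units twist the pair of frequencies.
  This gives Kloosterman's bound with exponent \<open>3/4\<close> (\<open>norm_kloosterman_le\<close>) and the discrepancy
  \<open>O(q^(3/4 + \<delta>))\<close> (\<open>inverse_pairs_discrepancy\<close>). When the terms of the sum are decomposed into
  layers in \<open>b\<close>, the coefficients are products and differences of functions monotone in the direction,
  so summation by parts in both variables loses only a logarithm (\<open>weighted_equidistribution\<close>). Summed over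
  \<open>q \<le> 1/\<epsilon> + 1\<close> with weight \<open>\<epsilon> / q\<close>, the discrepancy contributes \<open>O(\<epsilon>^(1/4 - \<delta>))\<close>, uniformly in the
  interval. Since \<open>\<epsilon> < 1\<close>, this implies the bounds for \<open>r = 2\<close> and for \<open>r \<noteq> 2\<close> alike.

  In the main term the sums over \<open>b\<close> and \<open>a\<close> are Riemann sums, and \<open>\<phi>(q) / q\<close> has mean \<open>6 / \<pi>\<^sup>2\<close>
  (\<open>sum_totient_over\<close>), so that the sum over \<open>q\<close> becomes the integral \<open>free_path_moment r\<close> in the
  variable \<open>x = \<epsilon> n\<close> (\<open>lattice_sum_asymptotics\<close>). One integration by parts turns it into the constant
  of the theorem (\<open>moment_const_eq_free_path_moment\<close>).
\<close>

section \<open>Divisors, the Moebius function and the mean of the totient ratio\<close>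

lemma abs_diff_triangle:
  fixes a b c x y :: real
  shows "\<bar>a - b\<bar> \<le> x \<Longrightarrow> \<bar>b - c\<bar> \<le> y \<Longrightarrow> \<bar>a - c\<bar> \<le> x + y"
  by linarith

lemma sum_le_harm_ln:
  assumes "N \<ge> 1"
  shows "(\<Sum>k=1..N. 1 / real k) \<le> 1 + ln (real N)"
proof -
  have "harm N - ln (real N) \<le> harm 1 - ln (real 1)"
    using euler_mascheroni_sequence_decreasing[of 1 N] assms by simp
  then show ?thesis by (simp add: harm_def field_simps)
qed

text \<open>
  A divisor of \<open>p ^ a * m\<close> splits into a divisor of each factor.
\<close>

lemma divisors_prime_power_mult_le:
  fixes n p a m :: nat
  assumes p: "prime p" and n: "n = p ^ a * m" "n > 0"
  shows "card {d. d dvd n} \<le> (a + 1) * card {d. d dvd m}"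
proof -
  have fin: "finite {d. d dvd m}" using n by (auto intro!: finite_divisors_nat Nat.gr0I)
  have "{d. d dvd n} \<subseteq> (\<lambda>(i, e). p ^ i * e) ` ({..a} \<times> {d. d dvd m})"
  proof
    fix d assume "d \<in> {d. d dvd n}"
    then have "d dvd p ^ a * m" using n by simp
    then obtain x y where d: "d = x * y" "x dvd p ^ a" "y dvd m" by (metis division_decomp)
    then obtain i where "i \<le> a" "x = p ^ i" using p by (metis divides_primepow_nat)
    then show "d \<in> (\<lambda>(i, e). p ^ i * e) ` ({..a} \<times> {d. d dvd m})" using d by force
  qed
  then have "card {d. d dvd n} \<le> card ({..a} \<times> {d. d dvd m})"
    by (rule surj_card_le[rotated]) (use fin in auto)
  also have "\<dots> = (a + 1) * card {d. d dvd m}" by (simp add: card_cartesian_product)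
  finally show ?thesis .
qed

text \<open>
  The ratio of the divisor function to \<open>n powr \<delta>\<close> is bounded by a product over primes. A prime
  \<open>p \<ge> 2 powr (1/\<delta>)\<close> contributes a factor at most \<open>1\<close>, since \<open>a + 1 \<le> 2 ^ a\<close>; each of the
  boundedly many smaller primes contributes at most a fixed constant, since \<open>2 powr (a \<delta>)\<close> grows
  faster than \<open>a\<close>.
\<close>

lemma card_divisors_le_powr:
  fixes \<delta> :: real
  assumes "\<delta> > 0"
  obtains C where "C > 0" "\<And>n::nat. n > 0 \<Longrightarrow> real (card {d. d dvd n}) \<le> C * real n powr \<delta>"
proof -
  define P where "P = 2 powr (1/\<delta>)"
  define c where "c = max 1 (1 / (\<delta> * ln 2))"
  have c1: "c \<ge> 1" by (simp add: c_def)
  have c2: "c * (\<delta> * ln 2) \<ge> 1"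
  proof -
    have "c \<ge> 1 / (\<delta> * ln 2)" by (simp add: c_def)
    then show ?thesis using assms by (simp add: field_simps)
  qed
  have small: "real (a + 1) \<le> c * (real p ^ a) powr \<delta>" if "prime p" for p a :: nat
  proof -
    have "real a * 1 \<le> real a * (c * (\<delta> * ln 2))" by (intro mult_left_mono c2) auto
    then have "real (a + 1) \<le> c * (1 + real a * \<delta> * ln 2)" using c1 by (simp add: algebra_simps)
    also have "\<dots> \<le> c * exp (real a * \<delta> * ln 2)"
      using c1 exp_ge_add_one_self[of "real a * \<delta> * ln 2"] by (intro mult_left_mono) auto
    also have "exp (real a * \<delta> * ln 2) = (2 ^ a) powr \<delta>"
      by (simp add: powr_def ln_realpow mult_ac)
    also have "((2::real) ^ a) powr \<delta> \<le> (real p ^ a) powr \<delta>"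
      using prime_ge_2_nat[OF that] assms by (intro powr_mono2 power_mono) auto
    finally show ?thesis using c1 by simp
  qed
  have large: "real (a + 1) \<le> (real p ^ a) powr \<delta>" if "prime p" "real p \<ge> P" for p a :: nat
  proof -
    have "real (a + 1) \<le> 2 ^ a"
    proof -
      have "a + 1 \<le> 2 ^ a" by (induct a) auto
      then show ?thesis by (metis of_nat_le_iff of_nat_numeral of_nat_power)
    qed
    also have "\<dots> = (P powr \<delta>) ^ a"
      using assms by (simp add: P_def powr_powr)
    also have "\<dots> = (P ^ a) powr \<delta>"
      by (simp add: P_def powr_powr powr_power mult.commute)
    also have "\<dots> \<le> (real p ^ a) powr \<delta>"
      using that assms by (intro powr_mono2 power_mono) (auto simp: P_def)
    finally show ?thesis .
  qed
  define S where "S n = {p::nat. prime p \<and> p dvd n \<and> real p < P}" for n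
  have finP: "finite {p::nat. real p < P}"
    by (rule finite_subset[of _ "{..nat \<lceil>P\<rceil>}"]) (auto, linarith)
  have finS: "finite (S n)" for n by (rule finite_subset[OF _ finP]) (auto simp: S_def)
  have main: "n > 0 \<Longrightarrow> real (card {d. d dvd n}) \<le> c ^ card (S n) * real n powr \<delta>" for n
  proof (induction n rule: less_induct)
    case (less n)
    show ?case
    proof (cases "n = 1")
      case True
      then have "S n = {}" by (auto simp: S_def)
      with True show ?thesis by simp
    next
      case False
      then obtain p where p: "prime p" "p dvd n" using prime_factor_nat by blast
      obtain a m where am: "n = p ^ a * m" "\<not> p dvd m"
        using multiplicity_decompose'[of n p] p less.prems by (metis gr0_implies_Suc nat.distinct(1) not_prime_unit)
      have "a > 0" using am p by (cases a) auto
      have m0: "m > 0" using less.prems am by (cases m) auto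
      have "p ^ a > 1" using p(1) \<open>a > 0\<close> by (intro one_less_power prime_gt_1_nat)
      then have "m < n" using am m0 by simp
      have IH: "real (card {d. d dvd m}) \<le> c ^ card (S m) * real m powr \<delta>"
        using less.IH \<open>m < n\<close> m0 by blast
      have Ssub: "S m \<subseteq> S n" using am by (auto simp: S_def)
      have step: "real (a + 1) * c ^ card (S m) \<le> c ^ card (S n) * (real p ^ a) powr \<delta>"
      proof (cases "real p < P")
        case True
        have "p \<notin> S m" "p \<in> S n" using am p True by (auto simp: S_def)
        then have "insert p (S m) \<subseteq> S n" using Ssub by auto
        then have "card (S m) + 1 \<le> card (S n)"
          using card_mono[OF finS, of "insert p (S m)" n] \<open>p \<notin> S m\<close> finS by simp
        then have "c ^ card (S m) * c \<le> c ^ card (S n)"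
          using c1 power_increasing[of "Suc (card (S m))" "card (S n)" c] by (simp add: mult.commute)
        then have "(c * (real p ^ a) powr \<delta>) * c ^ card (S m) \<le> c ^ card (S n) * (real p ^ a) powr \<delta>"
          by (metis mult.assoc mult.commute mult_right_mono powr_ge_zero)
        moreover have "real (a + 1) * c ^ card (S m) \<le> (c * (real p ^ a) powr \<delta>) * c ^ card (S m)"
          by (intro mult_right_mono small p) (use c1 in auto)
        ultimately show ?thesis by linarith
      next
        case False
        have "c ^ card (S m) \<le> c ^ card (S n)" using c1 by (intro power_increasing card_mono finS Ssub)
        then have "real (a + 1) * c ^ card (S m) \<le> (real p ^ a) powr \<delta> * c ^ card (S n)"
          by (intro mult_mono large p) (use c1 False in auto)
        then show ?thesis by (simp add: mult.commute)
      qed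
      have "real (card {d. d dvd n}) \<le> real (a + 1) * real (card {d. d dvd m})"
        using divisors_prime_power_mult_le[OF p(1) am(1) less.prems] by (metis of_nat_le_iff of_nat_mult)
      also have "\<dots> \<le> real (a + 1) * (c ^ card (S m) * real m powr \<delta>)"
        by (intro mult_left_mono IH) auto
      also have "\<dots> = (real (a + 1) * c ^ card (S m)) * real m powr \<delta>" by simp
      also have "\<dots> \<le> (c ^ card (S n) * (real p ^ a) powr \<delta>) * real m powr \<delta>"
        by (intro mult_right_mono step) auto
      also have "\<dots> = c ^ card (S n) * real n powr \<delta>"
        using am by (simp add: powr_mult)
      finally show ?thesis .
    qed
  qed
  define k where "k = card {p::nat. real p < P}"
  show ?thesis
  proof
    show "c ^ k > 0" using c1 by simp
    fix n :: nat assume n: "n > 0"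
    have "card (S n) \<le> k" unfolding k_def by (intro card_mono finP) (auto simp: S_def)
    then have "c ^ card (S n) \<le> c ^ k" using c1 by (intro power_increasing)
    then have "c ^ card (S n) * real n powr \<delta> \<le> c ^ k * real n powr \<delta>" by (intro mult_right_mono) auto
    then show "real (card {d. d dvd n}) \<le> c ^ k * real n powr \<delta>" using main[OF n] by linarith
  qed
qed

text \<open>
  In \<open>n = (\<Sum>d | d dvd n. totient d)\<close> every summand is at most \<open>totient n\<close>.
\<close>

lemma le_totient_mult_card_divisors:
  fixes n :: nat assumes "n > 0"
  shows "n \<le> totient n * card {d. d dvd n}"
proof -
  have "n = (\<Sum>d | d dvd n. totient d)" by (simp add: totient_divisor_sum)
  also have "\<dots> \<le> (\<Sum>d | d dvd n. totient n)"
    by (intro sum_mono) (use assms in \<open>auto intro!: dvd_imp_le totient_dvd_mono\<close>)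
  finally show ?thesis by (simp add: mult.commute)
qed

definition moebius_mu :: "nat \<Rightarrow> real" where
  "moebius_mu n = (if squarefree n then (-1) ^ card (prime_factors n) else 0)"

lemma abs_moebius_mu_le: "\<bar>moebius_mu n\<bar> \<le> 1" by (simp add: moebius_mu_def)

lemma moebius_mult_prime:
  assumes "prime p" "\<not> p dvd d"
  shows "moebius_mu (p * d) = - moebius_mu d"
proof -
  have d0: "d \<noteq> 0" using assms by (metis dvd_0_right)
  have "coprime p d" using assms by (simp add: prime_imp_coprime)
  then have sq: "squarefree (p * d) \<longleftrightarrow> squarefree d"
    using assms by (metis squarefree_mult_coprime squarefree_multD(2) squarefree_prime)
  have "prime_factors (p * d) = insert p (prime_factors d)"
    using d0 assms by (simp add: prime_factors_product prime_prime_factors prime_gt_0_nat)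
  moreover have "p \<notin> prime_factors d" using assms by auto
  ultimately show ?thesis using sq by (simp add: moebius_mu_def)
qed

lemma moebius_mult_prime_square:
  assumes "prime p" "p dvd d"
  shows "moebius_mu (p * d) = 0"
proof -
  have "p\<^sup>2 dvd p * d" using assms by (simp add: power2_eq_square)
  then have "\<not> squarefree (p * d)" using assms by (metis not_prime_unit squarefreeD)
  then show ?thesis by (simp add: moebius_mu_def)
qed

text \<open>
  For a prime \<open>p\<close> dividing \<open>n\<close>, the divisors \<open>d\<close> prime to \<open>p\<close> cancel against \<open>p d\<close>, and all other
  divisors are divisible by \<open>p\<^sup>2\<close>.
\<close>

lemma sum_divisors_moebius_mu:
  fixes n :: nat assumes "n > 0"
  shows "(\<Sum>d | d dvd n. moebius_mu d) = (if n = 1 then 1 else 0)"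
proof (cases "n = 1")
  case True
  then show ?thesis by (simp add: moebius_mu_def)
next
  case False
  then obtain p where p: "prime p" "p dvd n" using prime_factor_nat by blast
  obtain m where m: "n = p * m" using p by blast
  have fin: "finite {d. d dvd n}" using assms by simp
  define A where "A = {d. d dvd n \<and> \<not> p dvd d}"
  define B where "B = {d. d dvd n \<and> p dvd d}"
  have Am: "d dvd m" if "d \<in> A" for d
  proof -
    have "coprime d p" using that p by (metis A_def coprime_commute mem_Collect_eq prime_imp_coprime)
    then show ?thesis using that m by (simp add: A_def coprime_dvd_mult_right_iff)
  qed
  have "(\<Sum>d\<in>B. moebius_mu d) = (\<Sum>e | e dvd m. moebius_mu (p * e))"
    by (rule sum.reindex_bij_witness[of _ "\<lambda>e. p * e" "\<lambda>d. d div p"])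
       (use p m prime_gt_0_nat[OF p(1)] in \<open>auto simp: B_def\<close>)
  also have "\<dots> = (\<Sum>e\<in>A. moebius_mu (p * e))"
  proof (rule sum.mono_neutral_right)
    show "finite {e. e dvd m}" using assms m by (intro finite_divisors_nat) (auto intro: Nat.gr0I)
    show "A \<subseteq> {e. e dvd m}" using Am by auto
    show "\<forall>i\<in>{e. e dvd m} - A. moebius_mu (p * i) = 0"
      using m p by (auto simp: A_def intro!: moebius_mult_prime_square)
  qed
  also have "\<dots> = (\<Sum>e\<in>A. - moebius_mu e)"
    by (intro sum.cong refl moebius_mult_prime) (use p in \<open>auto simp: A_def\<close>)
  finally have "(\<Sum>d\<in>B. moebius_mu d) = - (\<Sum>e\<in>A. moebius_mu e)" by (simp add: sum_negf)
  moreover have "(\<Sum>d | d dvd n. moebius_mu d) = (\<Sum>d\<in>A. moebius_mu d) + (\<Sum>d\<in>B. moebius_mu d)"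
    by (subst sum.union_disjoint[symmetric]) (auto simp: A_def B_def fin intro!: sum.cong)
  ultimately show ?thesis using False by simp
qed

lemma totient_eq_sum_moebius_mu:
  fixes n :: nat assumes n: "n > 0"
  shows "real (totient n) = (\<Sum>d | d dvd n. moebius_mu d * real (n div d))"
proof -
  have fin: "finite {d. d dvd n}" using n by simp
  have "totatives n = {k\<in>{0<..n}. gcd k n = 1}"
    by (auto simp: totatives_def coprime_iff_gcd_eq_1)
  then have "real (totient n) = (\<Sum>k\<in>{0<..n}. if gcd k n = 1 then 1 else 0)"
    by (simp add: totient_def sum.inter_filter[symmetric])
  also have "\<dots> = (\<Sum>k\<in>{0<..n}. \<Sum>d | d dvd gcd k n. moebius_mu d)"
    by (intro sum.cong refl, subst sum_divisors_moebius_mu) auto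
  also have "\<dots> = (\<Sum>k\<in>{0<..n}. \<Sum>d | d dvd n. if d dvd k then moebius_mu d else 0)"
  proof (rule sum.cong[OF refl])
    fix k
    have "{d. d dvd gcd k n} = {d \<in> {d. d dvd n}. d dvd k}" by auto
    then show "(\<Sum>d | d dvd gcd k n. moebius_mu d) = (\<Sum>d | d dvd n. if d dvd k then moebius_mu d else 0)"
      using fin by (simp only: sum.inter_filter)
  qed
  also have "\<dots> = (\<Sum>d | d dvd n. \<Sum>k\<in>{0<..n}. if d dvd k then moebius_mu d else 0)"
    by (rule sum.swap)
  also have "\<dots> = (\<Sum>d | d dvd n. moebius_mu d * real (n div d))"
  proof (intro sum.cong refl)
    fix d assume "d \<in> {d. d dvd n}"
    then have d: "d dvd n" "d > 0" using n by (auto intro: Nat.gr0I)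
    have "{k\<in>{0<..n}. d dvd k} = (\<lambda>i. d * i) ` {0<..n div d}"
      using d by (auto simp: image_iff less_eq_div_iff_mult_less_eq mult.commute elim!: dvdE)
    then have "card {k\<in>{0<..n}. d dvd k} = n div d"
      using d by (simp add: card_image inj_on_def)
    then show "(\<Sum>k\<in>{0<..n}. if d dvd k then moebius_mu d else 0) = moebius_mu d * real (n div d)"
      by (simp add: sum.inter_filter[symmetric] mult.commute)
  qed
  finally show ?thesis .
qed

text \<open>
  The exchange of summation over the pairs \<open>(d, k)\<close> with \<open>d k \<le> N\<close>.
\<close>

lemma sum_sum_divisors:
  fixes f :: "nat \<Rightarrow> nat \<Rightarrow> real"
  shows "(\<Sum>n=1..N. \<Sum>d | d dvd n. f d (n div d)) = (\<Sum>d=1..N. \<Sum>k=1..N div d. f d k)"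
proof -
  have "(\<Sum>n=1..N. \<Sum>d | d dvd n. f d (n div d)) = (\<Sum>(n, d)\<in>(SIGMA n:{1..N}. {d. d dvd n}). f d (n div d))"
    by (rule sum.Sigma) auto
  also have "\<dots> = (\<Sum>(d, k)\<in>(SIGMA d:{1..N}. {1..N div d}). f d k)"
  proof (rule sum.reindex_bij_witness[of _ "\<lambda>(d, k). (d * k, d)" "\<lambda>(n, d). (d, n div d)"])
    fix x assume "x \<in> (SIGMA n:{1..N}. {d. d dvd n})"
    then obtain n d where x: "x = (n, d)" "1 \<le> n" "n \<le> N" "d dvd n" by auto
    then have "d \<ge> 1" "d \<le> n" using dvd_imp_le[of d n] by (auto intro: Nat.gr0I simp: Suc_le_eq)
    then show "(case x of (n, d) \<Rightarrow> (d, n div d)) \<in> (SIGMA d:{1..N}. {1..N div d})"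
      using x by (auto intro: div_le_mono simp: Suc_le_eq div_greater_zero_iff)
  next
    fix y assume "y \<in> (SIGMA d:{1..N}. {1..N div d})"
    then obtain d k where y: "y = (d, k)" "1 \<le> d" "d \<le> N" "1 \<le> k" "k \<le> N div d" by auto
    then have "d * k \<le> N" by (simp add: less_eq_div_iff_mult_less_eq mult.commute)
    then show "(case y of (d, k) \<Rightarrow> (d * k, d)) \<in> (SIGMA n:{1..N}. {d. d dvd n})" using y by auto
  qed auto
  also have "\<dots> = (\<Sum>d=1..N. \<Sum>k=1..N div d. f d k)"
    by (rule sum.Sigma[symmetric]) auto
  finally show ?thesis .
qed

lemma abs_zeta2_partial:
  assumes "m \<ge> 1"
  shows "\<bar>(\<Sum>k=1..m. 1 / real k ^ 2) - pi\<^sup>2 / 6\<bar> \<le> 1 / real m"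
proof -
  have s: "(\<lambda>n. 1 / real (n + 1) ^ 2) sums (pi\<^sup>2 / 6)"
    using inverse_squares_sums by (simp add: add.commute)
  have tele: "(\<lambda>n. 1 / real (n + m) - 1 / real (Suc n + m)) sums (1 / real (0 + m) - 0)"
    by (rule telescope_sums') (real_asymp | auto)+
  have sum_eq: "(\<Sum>k=1..m. 1 / real k ^ 2) = (\<Sum>n<m. 1 / real (n + 1) ^ 2)"
    by (rule sum.reindex_bij_witness[of _ Suc "\<lambda>k. k - 1"]) auto
  have tail: "(\<lambda>n. 1 / real (n + m + 1) ^ 2) sums (pi\<^sup>2 / 6 - (\<Sum>n<m. 1 / real (n + 1) ^ 2))"
    using sums_split_initial_segment[OF s, of m] by (simp add: add_ac)
  have tele': "(\<lambda>n. 1 / (real n + real m) - 1 / (1 + real n + real m)) sums (1 / real m)"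
    using tele by (simp add: add_ac)
  have "pi\<^sup>2 / 6 - (\<Sum>n<m. 1 / real (n + 1) ^ 2) \<le> 1 / real m"
  proof (rule sums_le[OF _ tail tele'])
    fix n
    have "1 / real (n + m + 1) ^ 2 \<le> 1 / (real (n + m) * real (n + m + 1))"
      using assms by (intro divide_left_mono) (auto simp: power2_eq_square intro!: mult_right_mono)
    also have "\<dots> = 1 / real (n + m) - 1 / real (Suc n + m)" using assms by (simp add: field_simps)
    finally show "1 / real (n + m + 1) ^ 2 \<le> 1 / (real n + real m) - 1 / (1 + real n + real m)" by (simp add: add_ac)
  qed
  moreover have "0 \<le> pi\<^sup>2 / 6 - (\<Sum>n<m. 1 / real (n + 1) ^ 2)"
    by (rule sums_le[OF _ sums_zero tail]) auto
  ultimately show ?thesis unfolding sum_eq by auto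
qed

lemma six_over_pi_squared_le: "6 / pi\<^sup>2 \<le> 1"
proof -
  have "pi\<^sup>2 \<ge> 3\<^sup>2" using pi_gt3 by (intro power_mono) auto
  then show ?thesis by simp
qed

text \<open>
  Summing \<open>moebius_mu d / n\<^sup>2\<close> over \<open>d dvd n\<close> and \<open>n \<le> N\<close> gives \<open>1\<close>; written as a sum over \<open>(d, k)\<close>,
  \<open>n = d k\<close>, it is the partial sum of the left-hand side with each term multiplied by a partial sum
  of \<open>\<zeta>(2) = \<pi>\<^sup>2/6\<close>.
\<close>

lemma sum_moebius_mu_squares:
  assumes N: "N \<ge> 1"
  shows "\<bar>(\<Sum>d=1..N. moebius_mu d / real d ^ 2) - 6 / pi\<^sup>2\<bar> \<le> 2 * (1 + ln (real N)) / real N"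
proof -
  define H where "H m = (\<Sum>k=1..m. 1 / real k ^ 2)" for m :: nat
  define M where "M = (\<Sum>d=1..N. moebius_mu d / real d ^ 2)"
  have "(\<Sum>n=1..N. \<Sum>d | d dvd n. moebius_mu d / real d ^ 2 * (1 / real (n div d) ^ 2))
      = (\<Sum>n=1..N. (1 / real n ^ 2) * (\<Sum>d | d dvd n. moebius_mu d))"
    unfolding sum_distrib_left
  proof (intro sum.cong refl)
    fix n d assume "n \<in> {1..N}" "d \<in> {d. d dvd n}"
    then have "real n = real d * real (n div d)" by (metis dvd_mult_div_cancel mem_Collect_eq of_nat_mult)
    then show "moebius_mu d / (real d)\<^sup>2 * (1 / (real (n div d))\<^sup>2) = 1 / (real n)\<^sup>2 * moebius_mu d"
      by (simp add: power_mult_distrib)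
  qed
  also have "\<dots> = (\<Sum>n=1..N. if n = 1 then 1 else 0)"
    by (intro sum.cong refl) (subst sum_divisors_moebius_mu, auto)
  also have "\<dots> = 1" using N by simp
  finally have "(\<Sum>d=1..N. moebius_mu d / real d ^ 2 * H (N div d)) = 1"
    unfolding H_def sum_distrib_left by (subst sum_sum_divisors[symmetric])
  then have "\<bar>M * (pi\<^sup>2 / 6) - 1\<bar> = \<bar>\<Sum>d=1..N. moebius_mu d / real d ^ 2 * (pi\<^sup>2 / 6 - H (N div d))\<bar>"
    unfolding right_diff_distrib sum_subtractf M_def sum_distrib_right by simp
  also have "\<dots> \<le> (\<Sum>d=1..N. (1 / real d ^ 2) * (2 * real d / real N))"
  proof (rule order_trans[OF sum_abs], rule sum_mono)
    fix d assume d: "d \<in> {1..N}"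
    then have q: "N div d \<ge> 1" by (simp add: Suc_le_eq div_greater_zero_iff)
    have "real N \<le> 2 * real d * real (N div d)"
    proof -
      have "N = d * (N div d) + N mod d" by simp
      moreover have "N mod d < d" using d by simp
      moreover have "d \<le> d * (N div d)" using q by simp
      ultimately have "N \<le> 2 * d * (N div d)" by linarith
      then show ?thesis by (metis of_nat_le_iff of_nat_mult of_nat_numeral)
    qed
    then have "1 / real (N div d) \<le> 2 * real d / real N" using N q by (simp add: field_simps)
    then have "\<bar>pi\<^sup>2 / 6 - H (N div d)\<bar> \<le> 2 * real d / real N"
      using abs_zeta2_partial[OF q] by (simp add: H_def abs_minus_commute)
    moreover have "\<bar>moebius_mu d / real d ^ 2\<bar> \<le> 1 / real d ^ 2"
      using abs_moebius_mu_le[of d] d by (simp add: abs_divide divide_right_mono)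
    ultimately show "\<bar>moebius_mu d / real d ^ 2 * (pi\<^sup>2 / 6 - H (N div d))\<bar> \<le> (1 / real d ^ 2) * (2 * real d / real N)"
      unfolding abs_mult by (intro mult_mono) auto
  qed
  also have "\<dots> = 2 / real N * (\<Sum>d=1..N. 1 / real d)"
    unfolding sum_distrib_left by (intro sum.cong refl) (auto simp: power2_eq_square)
  also have "\<dots> \<le> 2 / real N * (1 + ln (real N))"
    by (intro mult_left_mono sum_le_harm_ln N) auto
  finally have *: "\<bar>M * (pi\<^sup>2 / 6) - 1\<bar> \<le> 2 * (1 + ln (real N)) / real N" by simp
  have "\<bar>M - 6 / pi\<^sup>2\<bar> = (6 / pi\<^sup>2) * \<bar>M * (pi\<^sup>2 / 6) - 1\<bar>"
    by (simp add: abs_mult[symmetric] field_simps)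
  also have "\<dots> \<le> 1 * (2 * (1 + ln (real N)) / real N)"
    by (intro mult_mono six_over_pi_squared_le *) auto
  finally show ?thesis by (simp add: M_def)
qed

text \<open>
  Write \<open>\<phi>(q) / q\<close> as the sum of \<open>moebius_mu d / d\<close> over \<open>d dvd q\<close> and count multiples of \<open>d\<close>;
  replacing \<open>N div d\<close> by \<open>N / d\<close> costs a harmonic sum.
\<close>

lemma sum_totient_over:
  assumes N: "N \<ge> 1"
  shows "\<bar>(\<Sum>q=1..N. real (totient q) / real q) - 6 / pi\<^sup>2 * real N\<bar> \<le> 3 * (1 + ln (real N))"
proof -
  have "(\<Sum>q=1..N. real (totient q) / real q) = (\<Sum>q=1..N. \<Sum>d | d dvd q. moebius_mu d / real d)"
  proof (intro sum.cong refl)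
    fix q assume q: "q \<in> {1..N}"
    then show "real (totient q) / real q = (\<Sum>d | d dvd q. moebius_mu d / real d)"
      by (subst totient_eq_sum_moebius_mu)
         (auto simp: sum_divide_distrib real_of_nat_div field_simps intro!: sum.cong)
  qed
  also have "\<dots> = (\<Sum>d=1..N. moebius_mu d / real d * real (N div d))"
    using sum_sum_divisors[of "\<lambda>d _. moebius_mu d / real d" N] by (simp add: mult.commute)
  finally have eq: "(\<Sum>q=1..N. real (totient q) / real q) = (\<Sum>d=1..N. moebius_mu d / real d * real (N div d))" .
  have "\<bar>(\<Sum>d=1..N. moebius_mu d / real d * real (N div d)) - real N * (\<Sum>d=1..N. moebius_mu d / real d ^ 2)\<bar>
      = \<bar>\<Sum>d=1..N. moebius_mu d / real d * (real (N div d) - real N / real d)\<bar>"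
    unfolding right_diff_distrib sum_subtractf sum_distrib_left
    by (simp add: power2_eq_square mult_ac)
  also have "\<dots> \<le> (\<Sum>d=1..N. 1 / real d * 1)"
  proof (rule order_trans[OF sum_abs], rule sum_mono)
    fix d assume d: "d \<in> {1..N}"
    have "\<bar>moebius_mu d / real d\<bar> \<le> 1 / real d"
      using abs_moebius_mu_le[of d] d by (simp add: abs_divide divide_right_mono)
    moreover have "\<bar>real (N div d) - real N / real d\<bar> \<le> 1"
    proof -
      have "real_of_int \<lfloor>real N / real d\<rfloor> = real (N div d)" by (simp add: floor_divide_of_nat_eq)
      then show ?thesis by linarith
    qed
    ultimately show "\<bar>moebius_mu d / real d * (real (N div d) - real N / real d)\<bar> \<le> 1 / real d * 1"
      unfolding abs_mult by (intro mult_mono) auto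
  qed
  also have "\<dots> \<le> 1 + ln (real N)" using sum_le_harm_ln[OF N] by simp
  finally have 1: "\<bar>(\<Sum>d=1..N. moebius_mu d / real d * real (N div d)) - real N * (\<Sum>d=1..N. moebius_mu d / real d ^ 2)\<bar> \<le> 1 + ln (real N)" .
  have "\<bar>real N * (\<Sum>d=1..N. moebius_mu d / real d ^ 2) - 6 / pi\<^sup>2 * real N\<bar>
      = real N * \<bar>(\<Sum>d=1..N. moebius_mu d / real d ^ 2) - 6 / pi\<^sup>2\<bar>"
  proof -
    have "real N * (\<Sum>d=1..N. moebius_mu d / real d ^ 2) - 6 / pi\<^sup>2 * real N
        = real N * ((\<Sum>d=1..N. moebius_mu d / real d ^ 2) - 6 / pi\<^sup>2)"
      by (simp only: right_diff_distrib mult.commute)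
    then show ?thesis by (simp only: abs_mult abs_of_nat)
  qed
  also have "\<dots> \<le> real N * (2 * (1 + ln (real N)) / real N)"
    by (intro mult_left_mono sum_moebius_mu_squares N) auto
  also have "\<dots> = 2 * (1 + ln (real N))" using N by simp
  finally show ?thesis using abs_diff_triangle[OF 1] unfolding eq by fastforce
qed

section \<open>Kloosterman sums and modular inverses in boxes\<close>

definition inverse_pairs :: "nat \<Rightarrow> (int \<times> int) set" where
  "inverse_pairs q = {(x, y). x \<in> {0..<int q} \<and> y \<in> {0..<int q} \<and> [x * y = 1] (mod int q)}"

definition add_char :: "nat \<Rightarrow> int \<Rightarrow> complex" where
  "add_char q k = cis (2 * pi * of_int k / of_nat q)"

definition kloosterman :: "nat \<Rightarrow> int \<Rightarrow> int \<Rightarrow> complex" where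
  "kloosterman q m n = (\<Sum>(x, y)\<in>inverse_pairs q. add_char q (m * x + n * y))"

lemma finite_inverse_pairs [simp]: "finite (inverse_pairs q)"
  by (rule finite_subset[of _ "{0..<int q} \<times> {0..<int q}"]) (auto simp: inverse_pairs_def)

lemma inverse_pairs_swap: "(x, y) \<in> inverse_pairs q \<longleftrightarrow> (y, x) \<in> inverse_pairs q"
  by (auto simp: inverse_pairs_def mult.commute)

lemma inverse_pairs_unique:
  assumes "(x, y) \<in> inverse_pairs q" "(x, y') \<in> inverse_pairs q"
  shows "y = y'"
proof -
  have a: "[x * y = 1] (mod int q)" "[x * y' = 1] (mod int q)" using assms by (auto simp: inverse_pairs_def)
  have "[y * (x * y') = y * 1] (mod int q)" by (intro cong_mult cong_refl a)
  moreover have "[y' * (x * y) = y' * 1] (mod int q)" by (intro cong_mult cong_refl a)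
  ultimately have "[y = y'] (mod int q)" by (simp add: mult_ac cong_def)
  then show ?thesis using assms by (auto simp: inverse_pairs_def cong_def)
qed

lemma inverse_pairs_coprime: "(x, y) \<in> inverse_pairs q \<Longrightarrow> coprime x (int q)"
  by (auto simp: inverse_pairs_def coprime_iff_invertible_int)

lemma inverse_pairs_exists:
  assumes "x \<in> {0..<int q}" "coprime x (int q)"
  obtains y where "(x, y) \<in> inverse_pairs q"
proof -
  have q: "q > 0" using assms by auto
  obtain y where y: "[x * y = 1] (mod int q)" using assms(2) coprime_iff_invertible_int by blast
  then have "[x * (y mod int q) = 1] (mod int q)" by (simp add: cong_def mod_mult_right_eq)
  then have "(x, y mod int q) \<in> inverse_pairs q" using assms q by (auto simp: inverse_pairs_def)
  then show ?thesis by (rule that)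
qed

lemma card_inverse_pairs:
  assumes "q \<ge> 2"
  shows "card (inverse_pairs q) = totient q"
proof -
  have inj: "inj_on (\<lambda>p. nat (fst p)) (inverse_pairs q)"
  proof (rule inj_onI)
    fix p p' assume p: "p \<in> inverse_pairs q" "p' \<in> inverse_pairs q" and eq: "nat (fst p) = nat (fst p')"
    obtain x y x' y' where xy: "p = (x, y)" "p' = (x', y')" by (cases p, cases p') blast
    have "x = x'" using p eq unfolding xy inverse_pairs_def by (auto simp: eq_nat_nat_iff)
    then have "y = y'" using p inverse_pairs_unique[of x y q y'] unfolding xy by simp
    with \<open>x = x'\<close> show "p = p'" by (simp add: xy)
  qed
  have "(\<lambda>p. nat (fst p)) ` inverse_pairs q = totatives q"
  proof (intro equalityI subsetI)
    fix k assume "k \<in> (\<lambda>p. nat (fst p)) ` inverse_pairs q"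
    then obtain x y where xy: "(x, y) \<in> inverse_pairs q" "k = nat x" by auto
    then have x: "0 \<le> x" "x < int q" "[x * y = 1] (mod int q)" by (auto simp: inverse_pairs_def)
    have "x \<noteq> 0" using x(3) assms by (auto simp: cong_def)
    moreover have "coprime (int k) (int q)"
      using inverse_pairs_coprime[OF xy(1)] xy(2) x(1) by simp
    moreover have "int k = x" using x xy by simp
    ultimately show "k \<in> totatives q"
      using x unfolding totatives_def by auto
  next
    fix k assume k: "k \<in> totatives q"
    then have "k < q" using assms totatives_less by simp
    moreover have "coprime (int k) (int q)" using k by (simp add: totatives_def)
    ultimately obtain y where "(int k, y) \<in> inverse_pairs q"
      using inverse_pairs_exists[of "int k" q] by auto
    then show "k \<in> (\<lambda>p. nat (fst p)) ` inverse_pairs q" by (force intro: rev_image_eqI)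
  qed
  with inj have "bij_betw (\<lambda>p. nat (fst p)) (inverse_pairs q) (totatives q)"
    by (simp add: bij_betw_def)
  then show ?thesis by (simp add: bij_betw_same_card totient_def)
qed

lemma norm_add_char [simp]: "norm (add_char q k) = 1" by (simp add: add_char_def)

lemma add_char_0 [simp]: "add_char q 0 = 1" by (simp add: add_char_def)

lemma add_char_add: "add_char q (j + k) = add_char q j * add_char q k"
  by (simp add: add_char_def cis_mult ring_distribs add_divide_distrib)

lemma cnj_add_char: "cnj (add_char q k) = add_char q (- k)"
  by (simp add: add_char_def cis_cnj)

lemma add_char_eq_1_iff:
  assumes "q > 0"
  shows "add_char q k = 1 \<longleftrightarrow> int q dvd k"
proof
  assume "add_char q k = 1"
  then have "cos (2 * pi * of_int k / of_nat q) = 1" by (simp add: add_char_def cis.ctr complex_eq_iff)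
  then obtain n :: int where "2 * pi * of_int k / of_nat q = of_int n * 2 * pi"
    using cos_one_2pi_int by blast
  then have "(of_int k :: real) = of_int (n * int q)" using assms by (simp add: field_simps)
  then have "k = n * int q" by (simp only: of_int_eq_iff)
  then show "int q dvd k" by simp
next
  assume "int q dvd k"
  then obtain n where n: "k = int q * n" by blast
  have "2 * pi * real_of_int k / real q = 2 * pi * real_of_int n" using assms n by simp
  then have "add_char q k = cis (2 * pi * of_int n)" unfolding add_char_def by (rule arg_cong)
  also have "\<dots> = 1" by (rule cis_multiple_2pi) simp
  finally show "add_char q k = 1" .
qed

lemma add_char_cong:
  assumes "q > 0" "[j = k] (mod int q)"
  shows "add_char q j = add_char q k"
proof -
  have "add_char q (j - k) = 1" using assms by (simp add: add_char_eq_1_iff cong_iff_dvd_diff)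
  then have "add_char q (j - k) * add_char q k = add_char q k" by simp
  then show ?thesis by (simp flip: add_char_add)
qed

lemma add_char_mult_nat: "add_char q (int i * k) = add_char q k ^ i"
  by (simp add: add_char_def Complex.DeMoivre mult_ac)

lemma sum_add_char:
  assumes q: "q > 0"
  shows "(\<Sum>m\<in>{0..<int q}. add_char q (m * k)) = (if int q dvd k then of_nat q else 0)"
proof -
  have "(\<Sum>m\<in>{0..<int q}. add_char q (m * k)) = (\<Sum>i<q. add_char q k ^ i)"
    by (rule sum.reindex_bij_witness[of _ int nat]) (auto simp: add_char_mult_nat[symmetric])
  also have "\<dots> = (if int q dvd k then of_nat q else 0)"
  proof (cases "int q dvd k")
    case True
    then show ?thesis using q by (simp add: add_char_eq_1_iff[THEN iffD2])
  next
    case False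
    have "add_char q k ^ q = 1" using q by (simp flip: add_char_mult_nat add: add_char_eq_1_iff)
    then show ?thesis using False q by (simp add: sum_gp_strict add_char_eq_1_iff)
  qed
  finally show ?thesis .
qed

text \<open>
  Orthogonality of the characters of \<open>(\<int>/q)\<^sup>2\<close>: the second moment of an exponential sum counts
  the coincidences of its frequencies.
\<close>

lemma parseval_pairs:
  fixes s t :: "'a \<Rightarrow> int"
  assumes q: "q > 0" and T: "finite T"
  shows "(\<Sum>m\<in>{0..<int q}. \<Sum>n\<in>{0..<int q}. (norm (\<Sum>\<tau>\<in>T. add_char q (m * s \<tau> + n * t \<tau>))) ^ 2)
     = real q ^ 2 * real (card {(\<tau>, \<tau>') \<in> T \<times> T. int q dvd s \<tau> - s \<tau>' \<and> int q dvd t \<tau> - t \<tau>'})"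
proof -
  let ?R = "{0..<int q}"
  let ?f = "\<lambda>m n. \<Sum>\<tau>\<in>T. add_char q (m * s \<tau> + n * t \<tau>)"
  have "complex_of_real (\<Sum>m\<in>?R. \<Sum>n\<in>?R. (norm (?f m n)) ^ 2) = (\<Sum>m\<in>?R. \<Sum>n\<in>?R. ?f m n * cnj (?f m n))"
    by (simp add: complex_norm_square[symmetric] del: cnj_sum)
  also have "\<dots> = (\<Sum>m\<in>?R. \<Sum>n\<in>?R. \<Sum>(\<tau>, \<tau>')\<in>T \<times> T. add_char q (m * (s \<tau> - s \<tau>')) * add_char q (n * (t \<tau> - t \<tau>')))"
    unfolding cnj_sum sum_product sum.cartesian_product cnj_add_char add_char_add[symmetric]
    by (intro sum.cong refl) (auto simp: algebra_simps)
  also have "\<dots> = (\<Sum>(\<tau>, \<tau>')\<in>T \<times> T. \<Sum>m\<in>?R. \<Sum>n\<in>?R. add_char q (m * (s \<tau> - s \<tau>')) * add_char q (n * (t \<tau> - t \<tau>')))"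
    unfolding case_prod_unfold by (subst sum.swap[of _ ?R "T \<times> T"], subst sum.swap) simp
  also have "\<dots> = (\<Sum>(\<tau>, \<tau>')\<in>T \<times> T. (\<Sum>m\<in>?R. add_char q (m * (s \<tau> - s \<tau>'))) * (\<Sum>n\<in>?R. add_char q (n * (t \<tau> - t \<tau>'))))"
    by (simp add: sum_product)
  also have "\<dots> = (\<Sum>x\<in>T \<times> T. if int q dvd s (fst x) - s (snd x) \<and> int q dvd t (fst x) - t (snd x) then of_nat q ^ 2 else 0)"
    unfolding sum_add_char[OF q] by (intro sum.cong refl) (auto simp: power2_eq_square)
  also have "\<dots> = (\<Sum>x\<in>{x\<in>T \<times> T. int q dvd s (fst x) - s (snd x) \<and> int q dvd t (fst x) - t (snd x)}. of_nat q ^ 2)"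
    by (rule sum.inter_filter[symmetric]) (use T in auto)
  also have "{x\<in>T \<times> T. int q dvd s (fst x) - s (snd x) \<and> int q dvd t (fst x) - t (snd x)} =
     {(\<tau>, \<tau>') \<in> T \<times> T. int q dvd s \<tau> - s \<tau>' \<and> int q dvd t \<tau> - t \<tau>'}" by auto
  finally show ?thesis
    by (simp add: mult.commute flip: of_real_eq_iff[where 'a = complex])
qed

text \<open>
  The solutions lie in one class modulo \<open>d / gcd d c\<close>, if there are any.
\<close>

lemma card_linear_congruence_le:
  fixes q d :: nat and c r :: int
  assumes q: "q > 0" and d: "d dvd q"
  shows "card {z \<in> {0..<int q}. int d dvd c * z - r} * d \<le> q * nat (gcd (int d) c)"
proof (cases "{z \<in> {0..<int q}. int d dvd c * z - r} = {}")
  case False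
  then obtain z0 where z0: "int d dvd c * z0 - r" by auto
  have d0: "d > 0" using q d by (auto intro: Nat.gr0I)
  define g where "g = nat (gcd (int d) c)"
  have g: "int g = gcd (int d) c" by (simp add: g_def)
  have g0: "g > 0" using d0 by (simp add: g_def)
  have "g dvd d" using g by (metis gcd_dvd1 int_dvd_int_iff)
  then obtain e where e: "d = g * e" by blast
  have e0: "e > 0" using e d0 by (cases e) auto
  have eq: "e dvd q" using e d by (metis dvd_mult_right)
  let ?S = "{z \<in> {0..<int q}. int d dvd c * z - r}"
  have ediv: "int e dvd z - z0" if "z \<in> ?S" for z
  proof -
    have "int d dvd c * z - r" using that by simp
    from dvd_diff[OF this z0] have "int d dvd (c * z - r) - (c * z0 - r)" .
    then have "int d dvd c * (z - z0)" by (simp add: algebra_simps)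
    moreover obtain c' where c': "c = int g * c'" using g by (metis dvdE gcd_dvd2)
    ultimately have "int g * int e dvd int g * (c' * (z - z0))" using e by (simp add: mult.assoc)
    then have "int e dvd c' * (z - z0)" using g0 by simp
    moreover have "coprime (int e) c'"
    proof -
      have "gcd (int g * int e) (int g * c') = int g" using g c' e by simp
      then have "int g * gcd (int e) c' = int g" by (metis abs_of_nat gcd_mult_distrib_int)
      then show ?thesis using g0 by (simp add: coprime_iff_gcd_eq_1)
    qed
    ultimately show ?thesis by (simp add: coprime_dvd_mult_right_iff)
  qed
  have "inj_on (\<lambda>z. z div int e) ?S"
  proof (rule inj_onI)
    fix z z' assume zz: "z \<in> ?S" "z' \<in> ?S" "z div int e = z' div int e"
    have "int e dvd (z - z0) - (z' - z0)" by (rule dvd_diff[OF ediv[OF zz(1)] ediv[OF zz(2)]])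
    then have "z mod int e = z' mod int e" by (simp add: mod_eq_dvd_iff)
    with zz(3) show "z = z'" by (metis div_mult_mod_eq)
  qed
  moreover have "(\<lambda>z. z div int e) ` ?S \<subseteq> {0..<int (q div e)}"
  proof
    fix y assume "y \<in> (\<lambda>z. z div int e) ` ?S"
    then obtain z where z: "z \<in> ?S" "y = z div int e" by auto
    obtain k where k: "q = e * k" using eq by blast
    have "z < int k * int e" using z k by (simp add: mult.commute)
    moreover have "z div int e * int e \<le> z"
      using div_mult_mod_eq[of z "int e"] pos_mod_sign[of "int e" z] e0 by linarith
    ultimately have "z div int e * int e < int k * int e" by simp
    then have "z div int e < int k" using e0 by simp
    moreover have "0 \<le> z div int e" using z e0 by (simp add: pos_imp_zdiv_nonneg_iff)
    ultimately show "y \<in> {0..<int (q div e)}" using z k e0 by simp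
  qed
  ultimately have "card ?S \<le> q div e"
    by (metis (no_types, lifting) card_inj_on_le card_atLeastLessThan_int diff_zero finite_atLeastLessThan_int nat_int)
  then have "card ?S * d \<le> (q div e) * d" by simp
  also have "\<dots> = q * g" using e eq by (simp add: mult_ac)
  finally show ?thesis by (simp add: g_def)
next
  case True
  show ?thesis unfolding True by simp
qed

text \<open>
  If \<open>q\<close> divides the product, then \<open>q\<close> divides \<open>d1 d2 d3\<close> for divisors \<open>d1, d2, d3\<close> of \<open>q\<close> that
  divide the three factors. For fixed \<open>d1, d2, d3\<close> the differences \<open>z - x\<close> and \<open>z - y\<close> are multiples
  of \<open>d1\<close> and \<open>d2\<close>, and then \<open>2 z\<close> is determined modulo \<open>d3\<close>; this leaves at most
  \<open>2 q\<^sup>3 / (d1 d2 d3) \<le> 2 q\<^sup>2\<close> triples.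
\<close>

lemma card_product_divisible_triples_le:
  fixes q :: nat assumes q: "q > 0"
  shows "card {(x, y, z). x \<in> {0..<int q} \<and> y \<in> {0..<int q} \<and> z \<in> {0..<int q} \<and>
            int q dvd (x + y) * ((z - x) * (z - y))} \<le> 2 * q ^ 2 * card {d. d dvd q} ^ 3"
proof -
  let ?R = "{0..<int q}"
  let ?D = "{d. d dvd q}"
  define T where "T = (\<lambda>(d1, d2, d3). {(x, y, z). x \<in> ?R \<and> y \<in> ?R \<and> z \<in> ?R \<and>
      int d1 dvd z - x \<and> int d2 dvd z - y \<and> int d3 dvd x + y})"
  define J where "J = {(d1, d2, d3). d1 dvd q \<and> d2 dvd q \<and> d3 dvd q \<and> q dvd d1 * d2 * d3}"
  have finD: "finite ?D" using q by simp
  have Jsub: "J \<subseteq> ?D \<times> ?D \<times> ?D" by (auto simp: J_def)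
  have finJ: "finite J" by (rule finite_subset[OF Jsub]) (use finD in auto)
  have cardJ: "card J \<le> card ?D ^ 3"
    using card_mono[OF _ Jsub] finD by (simp add: card_cartesian_product power3_eq_cube)
  have cardT: "card (T d) \<le> 2 * q ^ 2" if "d \<in> J" for d
  proof -
    obtain d1 d2 d3 where d: "d = (d1, d2, d3)" by (cases d) auto
    have dv: "d1 dvd q" "d2 dvd q" "d3 dvd q" "q dvd d1 * d2 * d3" using that by (auto simp: J_def d)
    have pos: "d1 > 0" "d2 > 0" "d3 > 0" using dv q by (auto intro: Nat.gr0I)
    \<comment> \<open>residues \<open>\<alpha>\<close> divisible by \<open>e\<close>, in the form of \<open>card_linear_congruence_le\<close> with \<open>c = 1\<close>\<close>
    define M where "M e = {\<alpha> \<in> ?R. int e dvd 1 * \<alpha> - 0}" for e :: nat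
    define Z where "Z c = {z \<in> ?R. int d3 dvd 2 * z - c}" for c
    have cM: "card (M e) * e \<le> q" if "e dvd q" for e
      using card_linear_congruence_le[OF q that, of 1 0] by (simp add: M_def)
    have cZ: "card (Z c) * d3 \<le> q * 2" for c
    proof -
      have "gcd (int d3) 2 \<le> 2" by (rule zdvd_imp_le) auto
      then have "nat (gcd (int d3) 2) \<le> 2" by linarith
      then show ?thesis using card_linear_congruence_le[OF q dv(3), of 2 c]
        by (metis (no_types, lifting) Z_def mult_le_mono2 order_trans)
    qed
    have finM: "finite (M e)" "finite (Z c)" for e c
      by (rule finite_subset[of _ ?R]; auto simp: M_def Z_def)+
    let ?f = "\<lambda>(x, y, z). ((z - x) mod int q, (z - y) mod int q, z)"
    let ?S = "SIGMA \<alpha>:M d1. SIGMA \<beta>:M d2. Z (\<alpha> + \<beta>)"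
    have inj: "inj_on ?f (T d)"
    proof (rule inj_onI)
      fix p p' assume pp: "p \<in> T d" "p' \<in> T d" "?f p = ?f p'"
      obtain x y z x' y' z' where xyz: "p = (x, y, z)" "p' = (x', y', z')" by (cases p, cases p') auto
      have "z = z'" "(z - x) mod int q = (z - x') mod int q" "(z - y) mod int q = (z - y') mod int q"
        using pp(3) by (auto simp: xyz)
      then have "int q dvd x' - x" "int q dvd y' - y" by (auto simp: mod_eq_dvd_iff)
      then have "x' mod int q = x mod int q" "y' mod int q = y mod int q" by (auto simp: mod_eq_dvd_iff)
      then show "p = p'" using pp(1,2) \<open>z = z'\<close> by (auto simp: T_def d xyz)
    qed
    have sub: "?f ` T d \<subseteq> ?S"
    proof
      fix w assume "w \<in> ?f ` T d"
      then obtain x y z where xyz: "(x, y, z) \<in> T d" "w = ((z - x) mod int q, (z - y) mod int q, z)" by auto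
      have h: "z \<in> ?R" "int d1 dvd z - x" "int d2 dvd z - y" "int d3 dvd x + y"
        using xyz(1) by (auto simp: T_def d)
      have 1: "int d1 dvd (z - x) mod int q" "int d2 dvd (z - y) mod int q"
        using h dv by (auto intro: dvd_mod)
      have "int d3 dvd 2 * z - ((z - x) + (z - y))" using h(4) by (simp add: algebra_simps)
      moreover have "int d3 dvd (z - x) - (z - x) mod int q" "int d3 dvd (z - y) - (z - y) mod int q"
        using dv(3) by (metis dvd_trans int_dvd_int_iff mod_eq_dvd_iff mod_mod_trivial)+
      ultimately have "int d3 dvd (2 * z - ((z - x) + (z - y))) + ((z - x) - (z - x) mod int q) + ((z - y) - (z - y) mod int q)"
        by (intro dvd_add)
      then have "int d3 dvd 2 * z - ((z - x) mod int q + (z - y) mod int q)" by (simp add: algebra_simps)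
      then show "w \<in> ?S" using xyz(2) h 1 q by (auto simp: M_def Z_def)
    qed
    have finS: "finite ?S" using finM by auto
    have "card (T d) \<le> card ?S" by (rule card_inj_on_le[OF inj sub finS])
    also have "card ?S = (\<Sum>\<alpha>\<in>M d1. \<Sum>\<beta>\<in>M d2. card (Z (\<alpha> + \<beta>)))"
      using finM by (simp add: card_SigmaI)
    finally have "card (T d) * (d1 * d2 * d3) \<le> (\<Sum>\<alpha>\<in>M d1. \<Sum>\<beta>\<in>M d2. card (Z (\<alpha> + \<beta>))) * (d1 * d2 * d3)" by simp
    also have "\<dots> = (\<Sum>\<alpha>\<in>M d1. \<Sum>\<beta>\<in>M d2. card (Z (\<alpha> + \<beta>))) * d3 * (d1 * d2)"
      by (simp only: mult_ac)
    also have "\<dots> = (\<Sum>\<alpha>\<in>M d1. \<Sum>\<beta>\<in>M d2. card (Z (\<alpha> + \<beta>)) * d3) * (d1 * d2)"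
      by (simp only: sum_distrib_right)
    also have "\<dots> \<le> (\<Sum>\<alpha>\<in>M d1. \<Sum>\<beta>\<in>M d2. q * 2) * (d1 * d2)"
      by (intro mult_right_mono sum_mono cZ) auto
    also have "\<dots> = (card (M d1) * d1) * (card (M d2) * d2) * (q * 2)" by (simp add: mult_ac)
    also have "\<dots> \<le> q * q * (q * 2)" by (intro mult_mono cM dv) auto
    also have "\<dots> = 2 * q ^ 2 * q" by (simp add: power2_eq_square)
    also have "\<dots> \<le> 2 * q ^ 2 * (d1 * d2 * d3)"
    proof -
      have "q \<le> d1 * d2 * d3" by (rule dvd_imp_le[OF dv(4)]) (use pos in simp)
      then show ?thesis by (rule mult_le_mono2)
    qed
    finally show ?thesis using pos by simp
  qed
  have "{(x, y, z). x \<in> ?R \<and> y \<in> ?R \<and> z \<in> ?R \<and> int q dvd (x + y) * ((z - x) * (z - y))} \<subseteq> (\<Union>d\<in>J. T d)"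
  proof
    fix p assume "p \<in> {(x, y, z). x \<in> ?R \<and> y \<in> ?R \<and> z \<in> ?R \<and> int q dvd (x + y) * ((z - x) * (z - y))}"
    then obtain x y z where p: "p = (x, y, z)" "x \<in> ?R" "y \<in> ?R" "z \<in> ?R"
      "int q dvd (x + y) * ((z - x) * (z - y))" by auto
    obtain a b where ab: "int q = a * b" "a dvd x + y" "b dvd (z - x) * (z - y)"
      using division_decomp[OF p(5)] by auto
    obtain b1 b2 where b: "b = b1 * b2" "b1 dvd z - x" "b2 dvd z - y"
      using division_decomp[OF ab(3)] by auto
    have "int (nat \<bar>b1\<bar> * nat \<bar>b2\<bar> * nat \<bar>a\<bar>) = \<bar>b1\<bar> * \<bar>b2\<bar> * \<bar>a\<bar>" by simp
    also have "\<dots> = \<bar>a * b\<bar>" by (simp only: b(1) abs_mult mult_ac)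
    also have "\<dots> = int q" unfolding ab(1)[symmetric] by simp
    finally have "int q = int (nat \<bar>b1\<bar> * nat \<bar>b2\<bar> * nat \<bar>a\<bar>)" by (rule sym)
    then have q': "q = nat \<bar>b1\<bar> * nat \<bar>b2\<bar> * nat \<bar>a\<bar>" by (simp only: of_nat_eq_iff)
    have "(nat \<bar>b1\<bar>, nat \<bar>b2\<bar>, nat \<bar>a\<bar>) \<in> J" unfolding J_def using q' by auto
    moreover have "p \<in> T (nat \<bar>b1\<bar>, nat \<bar>b2\<bar>, nat \<bar>a\<bar>)"
      using p ab b by (auto simp: T_def)
    ultimately show "p \<in> (\<Union>d\<in>J. T d)" by blast
  qed
  then have "card {(x, y, z). x \<in> ?R \<and> y \<in> ?R \<and> z \<in> ?R \<and> int q dvd (x + y) * ((z - x) * (z - y))} \<le> card (\<Union>d\<in>J. T d)"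
  proof (rule card_mono[rotated])
    have "T d \<subseteq> ?R \<times> ?R \<times> ?R" for d by (cases d) (auto simp: T_def)
    then have "finite (T d)" for d by (rule finite_subset) simp
    then show "finite (\<Union>d\<in>J. T d)" using finJ by blast
  qed
  also have "\<dots> \<le> (\<Sum>d\<in>J. card (T d))" by (rule card_UN_le[OF finJ])
  also have "\<dots> \<le> (\<Sum>d\<in>J. 2 * q ^ 2)" by (intro sum_mono cardT)
  also have "\<dots> = card J * (2 * q ^ 2)" by simp
  also have "\<dots> \<le> card ?D ^ 3 * (2 * q ^ 2)" by (intro mult_right_mono cardJ) auto
  finally show ?thesis by (simp add: mult_ac)
qed

lemma kloosterman_mod:
  assumes "q > 0" shows "kloosterman q (m mod int q) (n mod int q) = kloosterman q m n"
  unfolding kloosterman_def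
proof (intro sum.cong refl, clarify)
  fix x y
  show "add_char q (m mod int q * x + n mod int q * y) = add_char q (m * x + n * y)"
    by (rule add_char_cong[OF assms], intro cong_add cong_mult cong_refl) (auto simp: cong_def)
qed

lemma kloosterman_swap: "kloosterman q m n = kloosterman q n m"
  unfolding kloosterman_def
  by (rule sum.reindex_bij_witness[of _ prod.swap prod.swap])
     (auto simp: inverse_pairs_swap add.commute)

text \<open>
  The substitution \<open>(x, y) \<mapsto> (u x, v y)\<close> permutes the inverse pairs.
\<close>

lemma kloosterman_twist:
  assumes uv: "(u, v) \<in> inverse_pairs q"
  shows "kloosterman q (m * u) (n * v) = kloosterman q m n"
proof -
  have q: "q > 0" using uv by (auto simp: inverse_pairs_def)
  have uv1: "[u * v = 1] (mod int q)" using uv by (auto simp: inverse_pairs_def)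
  have closed: "(a * x mod int q, b * y mod int q) \<in> inverse_pairs q"
    if "(a, b) \<in> inverse_pairs q" "(x, y) \<in> inverse_pairs q" for a b x y
  proof -
    have "[(a * b) * (x * y) = 1 * 1] (mod int q)"
      by (rule cong_mult) (use that in \<open>auto simp: inverse_pairs_def\<close>)
    moreover have "[(a * x mod int q) * (b * y mod int q) = (a * x) * (b * y)] (mod int q)"
      by (intro cong_mult) (auto simp: cong_def)
    ultimately have "[(a * x mod int q) * (b * y mod int q) = 1] (mod int q)"
      by (simp add: mult_ac cong_def)
    then show ?thesis using q by (auto simp: inverse_pairs_def)
  qed
  have inv: "b * (a * x mod int q) mod int q = x"
    if "(a, b) \<in> inverse_pairs q" "x \<in> {0..<int q}" for a b x
  proof -
    have "[b * (a * x mod int q) = b * (a * x)] (mod int q)" by (intro cong_mult) (auto simp: cong_def)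
    moreover have "[(a * b) * x = 1 * x] (mod int q)"
      by (intro cong_mult) (use that in \<open>auto simp: inverse_pairs_def\<close>)
    ultimately have "[b * (a * x mod int q) = x] (mod int q)" by (simp add: mult_ac cong_def)
    then show ?thesis using that by (simp add: cong_def)
  qed
  have vu: "(v, u) \<in> inverse_pairs q" using uv inverse_pairs_swap by blast
  have rng: "x \<in> {0..<int q}" "y \<in> {0..<int q}" if "(x, y) \<in> inverse_pairs q" for x y
    using that by (auto simp: inverse_pairs_def)
  show ?thesis unfolding kloosterman_def
  proof (rule sum.reindex_bij_witness[of _ "\<lambda>(x, y). (v * x mod int q, u * y mod int q)"
        "\<lambda>(x, y). (u * x mod int q, v * y mod int q)"])
    fix p assume p: "p \<in> inverse_pairs q"
    obtain x y where xy: "p = (x, y)" by (cases p)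
    have P: "(x, y) \<in> inverse_pairs q" using p xy by simp
    show "(case case p of (x, y) \<Rightarrow> (u * x mod int q, v * y mod int q) of
            (x, y) \<Rightarrow> (v * x mod int q, u * y mod int q)) = p"
      using inv[OF uv rng(1)[OF P]] inv[OF vu rng(2)[OF P]] by (simp add: xy)
    show "(case p of (x, y) \<Rightarrow> (u * x mod int q, v * y mod int q)) \<in> inverse_pairs q"
      using closed[OF uv P] by (simp add: xy)
    show "(case case p of (x, y) \<Rightarrow> (v * x mod int q, u * y mod int q) of
            (x, y) \<Rightarrow> (u * x mod int q, v * y mod int q)) = p"
      using inv[OF vu rng(1)[OF P]] inv[OF uv rng(2)[OF P]] by (simp add: xy)
    show "(case p of (x, y) \<Rightarrow> (v * x mod int q, u * y mod int q)) \<in> inverse_pairs q"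
      using closed[OF vu P] by (simp add: xy)
    have "add_char q (m * (u * x mod int q) + n * (v * y mod int q)) = add_char q (m * (u * x) + n * (v * y))"
      by (rule add_char_cong[OF q], intro cong_add cong_mult cong_refl) (auto simp: cong_def)
    then show "(case case p of (x, y) \<Rightarrow> (u * x mod int q, v * y mod int q) of
            (x, y) \<Rightarrow> add_char q (m * x + n * y)) = (case p of (x, y) \<Rightarrow> add_char q (m * u * x + n * v * y))"
      by (simp add: xy mult.assoc)
  qed
qed

text \<open>
  By orthogonality the fourth moment is \<open>q\<^sup>2\<close> times the number of quadruples of inverse pairs
  \<open>(xi, yi)\<close> with \<open>x1 + x2 = x3 + x4\<close> and \<open>y1 + y2 = y3 + y4\<close> modulo \<open>q\<close>. Multiplying the second
  congruence by \<open>x1 x2 x3 x4\<close> and eliminating \<open>x4\<close> turns it into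
  \<open>(x1 + x2) (x3 - x1) (x3 - x2) = 0\<close>, and the quadruple is determined by \<open>x1, x2, x3\<close>.
\<close>

lemma kloosterman_fourth_moment:
  assumes q: "q > 0"
  shows "(\<Sum>m\<in>{0..<int q}. \<Sum>n\<in>{0..<int q}. norm (kloosterman q m n) ^ 4)
     \<le> 2 * real q ^ 4 * real (card {d. d dvd q}) ^ 3"
proof -
  let ?P = "inverse_pairs q" and ?R = "{0..<int q}"
  define s :: "(int \<times> int) \<times> (int \<times> int) \<Rightarrow> int" where "s = (\<lambda>((x, y), (x', y')). x + x')"
  define t :: "(int \<times> int) \<times> (int \<times> int) \<Rightarrow> int" where "t = (\<lambda>((x, y), (x', y')). y + y')"
  have sq: "kloosterman q m n ^ 2 = (\<Sum>\<tau>\<in>?P \<times> ?P. add_char q (m * s \<tau> + n * t \<tau>))" for m n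
    unfolding kloosterman_def power2_eq_square sum_product sum.cartesian_product
    by (intro sum.cong refl) (auto simp: s_def t_def add_char_add[symmetric] algebra_simps)
  let ?S = "{(\<tau>, \<tau>') \<in> (?P \<times> ?P) \<times> (?P \<times> ?P). int q dvd s \<tau> - s \<tau>' \<and> int q dvd t \<tau> - t \<tau>'}"
  let ?T = "{(x, y, z). x \<in> ?R \<and> y \<in> ?R \<and> z \<in> ?R \<and> int q dvd (x + y) * ((z - x) * (z - y))}"
  have "(\<Sum>m\<in>?R. \<Sum>n\<in>?R. norm (kloosterman q m n) ^ 4) = (\<Sum>m\<in>?R. \<Sum>n\<in>?R. norm (kloosterman q m n ^ 2) ^ 2)"
    by (simp add: norm_power flip: power_mult)
  also have "\<dots> = real q ^ 2 * real (card ?S)"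
    unfolding sq by (rule parseval_pairs[OF q]) simp
  finally have eq: "(\<Sum>m\<in>?R. \<Sum>n\<in>?R. norm (kloosterman q m n) ^ 4) = real q ^ 2 * real (card ?S)" .
  have "card ?S \<le> card ?T"
  proof (rule card_inj_on_le[where f = "\<lambda>(((x1, y1), (x2, y2)), ((x3, y3), (x4, y4))). (x1, x2, x3)"])
    show "finite ?T" by (rule finite_subset[of _ "?R \<times> ?R \<times> ?R"]) auto
    show "inj_on (\<lambda>(((x1, y1), (x2, y2)), ((x3, y3), (x4, y4))). (x1, x2, x3)) ?S"
    proof (rule inj_onI)
      fix w w' assume ww: "w \<in> ?S" "w' \<in> ?S"
        "(\<lambda>(((x1, y1), (x2, y2)), ((x3, y3), (x4, y4))). (x1, x2, x3)) w = (\<lambda>(((x1, y1), (x2, y2)), ((x3, y3), (x4, y4))). (x1, x2, x3)) w'"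
      obtain x1 y1 x2 y2 x3 y3 x4 y4 where w: "w = (((x1, y1), (x2, y2)), ((x3, y3), (x4, y4)))" by (metis prod.collapse)
      obtain x1' y1' x2' y2' x3' y3' x4' y4' where w': "w' = (((x1', y1'), (x2', y2')), ((x3', y3'), (x4', y4')))" by (metis prod.collapse)
      have eqs: "x1' = x1" "x2' = x2" "x3' = x3" using ww(3) unfolding w w' by auto
      have "(x1, y1) \<in> ?P" "(x2, y2) \<in> ?P" "(x3, y3) \<in> ?P" "(x4, y4) \<in> ?P"
        "(x1, y1') \<in> ?P" "(x2, y2') \<in> ?P" "(x3, y3') \<in> ?P" "(x4', y4') \<in> ?P"
        "int q dvd s ((x1, y1), (x2, y2)) - s ((x3, y3), (x4, y4))"
        "int q dvd s ((x1, y1'), (x2, y2')) - s ((x3, y3'), (x4', y4'))"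
        using ww(1,2) unfolding w w' eqs by auto
      note h = this
      have "int q dvd (x1 + x2 - (x3 + x4')) - (x1 + x2 - (x3 + x4))"
        by (rule dvd_diff) (use h(9,10) in \<open>simp_all add: s_def\<close>)
      then have "int q dvd x4 - x4'" by simp
      then have "x4 mod int q = x4' mod int q" by (simp add: mod_eq_dvd_iff)
      then have x4: "x4 = x4'" using h(4,8) by (simp add: inverse_pairs_def)
      show "w = w'" unfolding w w' eqs
        using inverse_pairs_unique[OF h(1) h(5)] inverse_pairs_unique[OF h(2) h(6)]
          inverse_pairs_unique[OF h(3) h(7)] inverse_pairs_unique[OF h(4), of y4'] h(8) x4 by simp
    qed
    show "(\<lambda>(((x1, y1), (x2, y2)), ((x3, y3), (x4, y4))). (x1, x2, x3)) ` ?S \<subseteq> ?T"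
    proof clarify
      fix x1 y1 x2 y2 x3 y3 x4 y4
      assume h: "(x1, y1) \<in> ?P" "(x2, y2) \<in> ?P" "(x3, y3) \<in> ?P" "(x4, y4) \<in> ?P"
        "int q dvd s ((x1, y1), (x2, y2)) - s ((x3, y3), (x4, y4))"
        "int q dvd t ((x1, y1), (x2, y2)) - t ((x3, y3), (x4, y4))"
      have c: "[x1 * y1 = 1] (mod int q)" "[x2 * y2 = 1] (mod int q)" "[x3 * y3 = 1] (mod int q)" "[x4 * y4 = 1] (mod int q)"
        using h by (auto simp: inverse_pairs_def)
      have cs: "[x1 + x2 = x3 + x4] (mod int q)" "[y1 + y2 = y3 + y4] (mod int q)"
        using h(5,6) by (auto simp: s_def t_def cong_iff_dvd_diff)
      have x4: "[x4 = x1 + x2 - x3] (mod int q)"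
        using cs(1) by (auto simp: cong_iff_dvd_diff dvd_diff_commute algebra_simps)
      have "[(x1 * y1) * (x2 * (x3 * x4)) + (x2 * y2) * (x1 * (x3 * x4)) = 1 * (x2 * (x3 * x4)) + 1 * (x1 * (x3 * x4))] (mod int q)"
        by (intro cong_add cong_mult c cong_refl)
      moreover have "[(x3 * y3) * (x1 * (x2 * x4)) + (x4 * y4) * (x1 * (x2 * x3)) = 1 * (x1 * (x2 * x4)) + 1 * (x1 * (x2 * x3))] (mod int q)"
        by (intro cong_add cong_mult c cong_refl)
      moreover have "[(y1 + y2) * (x1 * x2 * (x3 * x4)) = (y3 + y4) * (x1 * x2 * (x3 * x4))] (mod int q)"
        by (intro cong_mult cs cong_refl)
      ultimately have 1: "[x2 * (x3 * x4) + x1 * (x3 * x4) = x1 * (x2 * x4) + x1 * (x2 * x3)] (mod int q)"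
        by (simp add: cong_def algebra_simps)
      have 2: "[x2 * (x3 * x4) + x1 * (x3 * x4) = x2 * (x3 * (x1 + x2 - x3)) + x1 * (x3 * (x1 + x2 - x3))] (mod int q)"
        by (intro cong_add cong_mult x4 cong_refl)
      have 3: "[x1 * (x2 * x4) + x1 * (x2 * x3) = x1 * (x2 * (x1 + x2 - x3)) + x1 * (x2 * x3)] (mod int q)"
        by (intro cong_add cong_mult x4 cong_refl)
      have "[x2 * (x3 * (x1 + x2 - x3)) + x1 * (x3 * (x1 + x2 - x3)) = x1 * (x2 * (x1 + x2 - x3)) + x1 * (x2 * x3)] (mod int q)"
        using 1 2 3 by (simp add: cong_def)
      then have "int q dvd - (x2 * (x3 * (x1 + x2 - x3)) + x1 * (x3 * (x1 + x2 - x3)) - (x1 * (x2 * (x1 + x2 - x3)) + x1 * (x2 * x3)))"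
        by (simp only: cong_iff_dvd_diff dvd_minus_iff)
      also have "- (x2 * (x3 * (x1 + x2 - x3)) + x1 * (x3 * (x1 + x2 - x3)) - (x1 * (x2 * (x1 + x2 - x3)) + x1 * (x2 * x3)))
          = (x1 + x2) * ((x3 - x1) * (x3 - x2))" by (simp add: algebra_simps)
      finally show "x1 \<in> ?R \<and> x2 \<in> ?R \<and> x3 \<in> ?R \<and> int q dvd (x1 + x2) * ((x3 - x1) * (x3 - x2))"
        using h by (auto simp: inverse_pairs_def)
    qed
  qed
  also have "\<dots> \<le> 2 * q ^ 2 * card {d. d dvd q} ^ 3" by (rule card_product_divisible_triples_le[OF q])
  finally have "real (card ?S) \<le> real (2 * q ^ 2 * card {d. d dvd q} ^ 3)" by (simp only: of_nat_le_iff)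
  then have "real q ^ 2 * real (card ?S) \<le> real q ^ 2 * real (2 * q ^ 2 * card {d. d dvd q} ^ 3)"
    by (intro mult_left_mono) auto
  also have "\<dots> = 2 * real q ^ 4 * real (card {d. d dvd q}) ^ 3"
    by (simp add: power2_eq_square power4_eq_xxxx)
  finally show ?thesis using eq by simp
qed

text \<open>
  All \<open>\<phi>(q)\<close> unit twists of \<open>(m, n)\<close> give the same Kloosterman sum, and a pair of residues arises from
  at most \<open>gcd m q\<close> of them. Hence \<open>\<phi>(q)\<close> times the fourth power is at most \<open>gcd m q\<close> times the
  whole fourth moment.
\<close>

lemma norm_kloosterman_le:
  assumes q: "q \<ge> 2"
  shows "norm (kloosterman q m n) \<le> 2 * real (gcd (nat \<bar>m\<bar>) q) * real q powr (3/4) * real (card {d. d dvd q})"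
proof -
  let ?P = "inverse_pairs q" and ?R = "{0..<int q}"
  have q0: "q > 0" using q by simp
  define g where "g = nat (gcd (int q) m)"
  have g_eq: "g = gcd (nat \<bar>m\<bar>) q"
    unfolding g_def gcd_int_def by (simp add: gcd.commute)
  have g1: "g \<ge> 1" using q0 by (simp add: g_eq Suc_le_eq)
  define D where "D = card {d. d dvd q}"
  define f where "f = (\<lambda>(u, v). (m * u mod int q, n * v mod int q))"
  define h where "h = (\<lambda>(a, b). norm (kloosterman q a b) ^ 4)"
  have fin: "finite (?R \<times> ?R)" by simp
  have fR: "f ` ?P \<subseteq> ?R \<times> ?R" using q0 by (auto simp: f_def)
  have fiber: "card {p \<in> ?P. f p = c} \<le> g" for c
  proof -
    let ?U = "{u \<in> ?R. int q dvd m * u - fst c}"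
    have fib: "{p \<in> ?P. f p = c} \<subseteq> ?P" by auto
    have "card {p \<in> ?P. f p = c} \<le> card ?U"
    proof (rule card_inj_on_le[where f = fst])
      show "finite ?U" by (rule finite_subset[of _ ?R]) auto
      show "inj_on fst {p \<in> ?P. f p = c}"
        by (rule inj_onI) (auto dest: inverse_pairs_unique)
      show "fst ` {p \<in> ?P. f p = c} \<subseteq> ?U"
      proof clarify
        fix u v assume uv: "(u, v) \<in> ?P"
        have "u \<in> ?R" using uv by (simp add: inverse_pairs_def)
        moreover have "int q dvd m * u - m * u mod int q" by (simp add: mod_eq_dvd_iff[symmetric])
        ultimately show "fst (u, v) \<in> ?R \<and> int q dvd m * fst (u, v) - fst (f (u, v))" by (simp add: f_def)
      qed
    qed
    moreover have "card ?U * q \<le> q * g"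
      using card_linear_congruence_le[OF q0 dvd_refl, of m "fst c"] by (simp add: g_def)
    ultimately show ?thesis using q0 by (simp add: mult.commute[of _ q])
  qed
  have "real (totient q) * norm (kloosterman q m n) ^ 4 = (\<Sum>p\<in>?P. norm (kloosterman q m n) ^ 4)"
    by (simp add: card_inverse_pairs[OF q])
  also have "\<dots> = (\<Sum>p\<in>?P. h (f p))"
    by (intro sum.cong refl) (auto simp: h_def f_def kloosterman_mod[OF q0] kloosterman_twist)
  also have "\<dots> = (\<Sum>c\<in>?R \<times> ?R. \<Sum>p\<in>{p\<in>?P. f p = c}. h (f p))"
    by (rule sum.group[symmetric]) (use fR in auto)
  also have "\<dots> = (\<Sum>c\<in>?R \<times> ?R. real (card {p\<in>?P. f p = c}) * h c)"
    by (intro sum.cong refl) simp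
  also have "\<dots> \<le> (\<Sum>c\<in>?R \<times> ?R. real g * h c)"
    by (intro sum_mono mult_right_mono of_nat_mono fiber) (auto simp: h_def)
  also have "\<dots> = real g * (\<Sum>a\<in>?R. \<Sum>b\<in>?R. norm (kloosterman q a b) ^ 4)"
    by (simp add: sum_distrib_left h_def sum.cartesian_product)
  also have "\<dots> \<le> real g * (2 * real q ^ 4 * real D ^ 3)"
    unfolding D_def by (intro mult_left_mono kloosterman_fourth_moment q0) auto
  finally have 1: "real (totient q) * norm (kloosterman q m n) ^ 4 \<le> real g * (2 * real q ^ 4 * real D ^ 3)" .
  have 2: "real q \<le> real (totient q) * real D"
    using le_totient_mult_card_divisors[OF q0] unfolding D_def by (metis of_nat_le_iff of_nat_mult)
  have "real q * norm (kloosterman q m n) ^ 4 \<le> (real (totient q) * real D) * norm (kloosterman q m n) ^ 4"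
    by (intro mult_right_mono 2) auto
  also have "\<dots> = real D * (real (totient q) * norm (kloosterman q m n) ^ 4)" by simp
  also have "\<dots> \<le> real D * (real g * (2 * real q ^ 4 * real D ^ 3))" by (intro mult_left_mono 1) auto
  also have "\<dots> = real q * (2 * real g * real q ^ 3 * real D ^ 4)"
    by (simp add: power4_eq_xxxx power3_eq_cube)
  finally have "norm (kloosterman q m n) ^ 4 \<le> 2 * real g * real q ^ 3 * real D ^ 4"
    using q0 by simp
  also have "\<dots> \<le> (16 * real g ^ 4) * real q ^ 3 * real D ^ 4"
  proof (intro mult_right_mono)
    have "real g ^ 1 \<le> real g ^ 4" by (rule power_increasing) (use g1 in auto)
    then have "real g \<le> real g ^ 4" by (simp only: power_one_right)
    then show "2 * real g \<le> 16 * real g ^ 4" by linarith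
  qed auto
  also have "\<dots> = (2 * real g * real q powr (3/4) * real D) ^ 4"
  proof -
    have "(real q powr (3/4)) ^ 4 = real q ^ 3"
      using q0 by (simp add: powr_power)
    then show ?thesis by (simp add: power_mult_distrib)
  qed
  finally show ?thesis unfolding g_eq D_def by (rule power_le_imp_le_base[of _ 3, simplified]) auto
qed

lemma sin_lower_bound_cubic:
  fixes x :: real assumes "x \<ge> 0" shows "x - x ^ 3 / 6 \<le> sin x"
proof -
  have "\<bar>sin x - x\<bar> \<le> inverse 6 * \<bar>x\<bar> ^ 3"
    using Maclaurin_sin_bound[of x 3] by (simp add: sin_coeff_def numeral_3_eq_3 fact_numeral)
  then show ?thesis using assms by (simp add: abs_if split: if_splits)
qed

text \<open>
  A lower bound that vanishes to first order at both ends of the period; the reciprocal of the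
  left-hand side splits as \<open>1 / x + 1 / (1 - x)\<close>.
\<close>

lemma sin_pi_mult_ge:
  fixes x :: real
  assumes "0 \<le> x" "x \<le> 1"
  shows "x * (1 - x) \<le> sin (pi * x)"
proof -
  have *: "y * (1 - y) \<le> sin (pi * y)" if "0 \<le> y" "y \<le> 1/2" for y :: real
  proof -
    have y4: "pi * y \<le> 2" using that pi_less_4 mult_mono[of pi 4 y "1/2"] by simp
    have "y * (1 - y) \<le> y * 1" using that by (intro mult_left_mono) auto
    also have "\<dots> \<le> (pi * y) * (1 / 3)" using pi_gt3 that mult_right_mono[of 3 pi y] by simp
    also have "\<dots> \<le> (pi * y) * (1 - (pi * y) ^ 2 / 6)"
    proof (rule mult_left_mono)
      have "(pi * y) ^ 2 \<le> 2 ^ 2" by (intro power_mono y4) (use that in auto)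
      then show "1 / 3 \<le> 1 - (pi * y) ^ 2 / 6" by simp
    qed (use that in auto)
    also have "\<dots> = pi * y - (pi * y) ^ 3 / 6" by (simp add: field_simps power2_eq_square power3_eq_cube)
    also have "\<dots> \<le> sin (pi * y)" using that by (intro sin_lower_bound_cubic) auto
    finally show ?thesis .
  qed
  show ?thesis
  proof (cases "x \<le> 1/2")
    case True
    then show ?thesis using * assms by auto
  next
    case False
    have "sin (pi * (1 - x)) = sin (pi * x)" by (simp add: right_diff_distrib sin_diff)
    then show ?thesis using *[of "1 - x"] assms False by (simp add: mult.commute)
  qed
qed

text \<open>
  A geometric sum whose ratio \<open>z\<close> satisfies \<open>norm (z - 1) = 2 sin (\<pi> m / q)\<close>.
\<close>

lemma norm_sum_add_char_interval_le:
  fixes m a b :: int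
  assumes q: "q > 0" and m: "0 < m" "m < int q"
  shows "norm (\<Sum>k\<in>{a..<b}. add_char q (- (m * k))) \<le> real q * (1 / of_int m + 1 / (real q - of_int m))"
proof -
  define z where "z = add_char q (- m)"
  have tele: "(z - 1) * (\<Sum>k\<in>{a..<b}. add_char q (- (m * k))) = add_char q (- (m * b)) - add_char q (- (m * a))" if "a \<le> b"
    using that
  proof (induction b rule: int_ge_induct)
    case (step i)
    have "{a..<i + 1} = insert i {a..<i}" using step.hyps by auto
    moreover have "add_char q (- (m * (i + 1))) = z * add_char q (- (m * i))"
      by (simp add: z_def algebra_simps flip: add_char_add)
    ultimately show ?case using step.IH by (simp add: algebra_simps)
  qed simp
  define x where "x = of_int m / real q"
  have x: "0 < x" "x < 1" using m q by (auto simp: x_def divide_less_eq)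
  have z: "norm (z - 1) = 2 * sin (pi * x)"
  proof -
    have "z = exp (\<i> * of_real (- (2 * pi * x)))" by (simp add: z_def add_char_def x_def cis_conv_exp)
    then have "norm (z - 1) = 2 * \<bar>sin (- (2 * pi * x) / 2)\<bar>" by (simp only: dist_exp_i_1)
    also have "\<dots> = 2 * sin (pi * x)"
      using x by (simp add: sin_ge_zero mult_le_cancel_left1)
    finally show ?thesis .
  qed
  have pos: "x * (1 - x) > 0" using x by simp
  have zz: "norm (z - 1) \<ge> 2 * (x * (1 - x))" using sin_pi_mult_ge[of x] x z by simp
  have rhs: "1 / (x * (1 - x)) = real q * (1 / of_int m + 1 / (real q - of_int m))"
  proof -
    have "1 / (x * (1 - x)) = 1 / x + 1 / (1 - x)" using x by (simp add: field_simps)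
    also have "1 / x = real q * (1 / of_int m)" by (simp add: x_def)
    also have "1 / (1 - x) = real q * (1 / (real q - of_int m))" using q by (simp add: x_def field_simps)
    finally show ?thesis by (simp add: ring_distribs)
  qed
  show ?thesis
  proof (cases "a \<le> b")
    case True
    have "norm (z - 1) * norm (\<Sum>k\<in>{a..<b}. add_char q (- (m * k))) = norm (add_char q (- (m * b)) - add_char q (- (m * a)))"
      using tele[OF True] by (metis norm_mult)
    also have "\<dots> \<le> 2" by (rule order_trans[OF norm_triangle_ineq4]) simp
    finally have "2 * (x * (1 - x)) * norm (\<Sum>k\<in>{a..<b}. add_char q (- (m * k))) \<le> 2"
      using mult_right_mono[OF zz norm_ge_zero[of "\<Sum>k\<in>{a..<b}. add_char q (- (m * k))"]] by linarith
    then have "norm (\<Sum>k\<in>{a..<b}. add_char q (- (m * k))) \<le> 1 / (x * (1 - x))"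
      using pos by (simp add: field_simps)
    then show ?thesis using rhs by simp
  next
    case False
    then show ?thesis unfolding rhs[symmetric] using pos by simp
  qed
qed

lemma sum_gcd_over_le:
  assumes "q \<ge> 1"
  shows "(\<Sum>m=1..q. real (gcd m q) / real m) \<le> real (card {d. d dvd q}) * (1 + ln (real q))"
proof -
  have fin: "finite {d. d dvd q}" using assms by simp
  have "(\<Sum>m=1..q. real (gcd m q) / real m) \<le> (\<Sum>m=1..q. \<Sum>d | d dvd q. if d dvd m then real d / real m else 0)"
  proof (rule sum_mono)
    fix m assume m: "m \<in> {1..q}"
    have "real (gcd m q) / real m = (\<Sum>d\<in>{gcd m q}. if d dvd m then real d / real m else 0)" by simp
    also have "\<dots> \<le> (\<Sum>d | d dvd q. if d dvd m then real d / real m else 0)"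
      by (rule sum_mono2) (use fin in auto)
    finally show "real (gcd m q) / real m \<le> (\<Sum>d | d dvd q. if d dvd m then real d / real m else 0)" .
  qed
  also have "\<dots> = (\<Sum>d | d dvd q. \<Sum>m=1..q. if d dvd m then real d / real m else 0)" by (rule sum.swap)
  also have "\<dots> \<le> (\<Sum>d | d dvd q. 1 + ln (real q))"
  proof (rule sum_mono)
    fix d assume "d \<in> {d. d dvd q}"
    then have d: "d dvd q" "d > 0" using assms by (auto intro: Nat.gr0I)
    have "(\<Sum>m=1..q. if d dvd m then real d / real m else 0) = (\<Sum>m\<in>{m\<in>{1..q}. d dvd m}. real d / real m)"
      by (rule sum.inter_filter[symmetric]) auto
    also have "\<dots> \<le> (\<Sum>k=1..q. 1 / real k)"
    proof (rule sum_le_included[where i = "\<lambda>k. d * k"])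
      show "\<forall>m\<in>{m\<in>{1..q}. d dvd m}. \<exists>k\<in>{1..q}. d * k = m \<and> real d / real m \<le> 1 / real k"
      proof
        fix m assume m: "m \<in> {m\<in>{1..q}. d dvd m}"
        then obtain k where k: "m = d * k" by blast
        moreover have "k \<ge> 1" using m k by (cases k) auto
        moreover have "k \<le> d * k" using d by simp
        moreover have "m \<le> q" using m by simp
        ultimately have "k \<le> q" by linarith
        with \<open>m = d * k\<close> \<open>k \<ge> 1\<close> show "\<exists>k\<in>{1..q}. d * k = m \<and> real d / real m \<le> 1 / real k"
          using m d by (intro bexI[of _ k]) auto
      qed
    qed auto
    also have "\<dots> \<le> 1 + ln (real q)" by (rule sum_le_harm_ln[OF assms])
    finally show "(\<Sum>m=1..q. if d dvd m then real d / real m else 0) \<le> 1 + ln (real q)" .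
  qed
  finally show ?thesis by simp
qed

text \<open>
  Both indicator functions are expanded in additive characters modulo \<open>q\<close>.
\<close>

lemma card_inverse_pairs_box:
  fixes q :: nat and A B :: "int set"
  assumes q: "q > 0" and A: "A \<subseteq> {0..<int q}" and B: "B \<subseteq> {0..<int q}"
  defines "FA \<equiv> \<lambda>m. \<Sum>a\<in>A. add_char q (- (m * a))" and "FB \<equiv> \<lambda>n. \<Sum>b\<in>B. add_char q (- (n * b))"
  shows "of_nat q ^ 2 * of_nat (card {(x, y) \<in> inverse_pairs q. x \<in> A \<and> y \<in> B})
     = (\<Sum>m\<in>{0..<int q}. \<Sum>n\<in>{0..<int q}. FA m * FB n * kloosterman q m n)"
proof -
  let ?R = "{0..<int q}" and ?P = "inverse_pairs q"
  have finAB: "finite A" "finite B" using A B finite_subset by blast+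
  have ind: "(\<Sum>m\<in>?R. (\<Sum>a\<in>S. add_char q (- (m * a))) * add_char q (m * x)) = (if x \<in> S then of_nat q else 0)"
    if "x \<in> ?R" "S \<subseteq> ?R" for x S
  proof -
    have fin: "finite S" using that finite_subset by blast
    have "(\<Sum>m\<in>?R. (\<Sum>a\<in>S. add_char q (- (m * a))) * add_char q (m * x)) = (\<Sum>m\<in>?R. \<Sum>a\<in>S. add_char q (m * (x - a)))"
      unfolding sum_distrib_right by (intro sum.cong refl) (simp add: algebra_simps flip: add_char_add)
    also have "\<dots> = (\<Sum>a\<in>S. \<Sum>m\<in>?R. add_char q (m * (x - a)))" by (rule sum.swap)
    also have "\<dots> = (\<Sum>a\<in>S. if x = a then of_nat q else 0)"
    proof (rule sum.cong[OF refl])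
      fix a assume "a \<in> S"
      then have "int q dvd x - a \<longleftrightarrow> x = a" using that by (auto simp: mod_eq_dvd_iff[symmetric])
      then show "(\<Sum>m\<in>?R. add_char q (m * (x - a))) = (if x = a then of_nat q else 0)"
        by (simp add: sum_add_char[OF q])
    qed
    also have "\<dots> = (if x \<in> S then of_nat q else 0)" using fin by simp
    finally show ?thesis .
  qed
  have "(\<Sum>m\<in>?R. \<Sum>n\<in>?R. FA m * FB n * kloosterman q m n)
     = (\<Sum>m\<in>?R. \<Sum>n\<in>?R. \<Sum>p\<in>?P. (FA m * add_char q (m * fst p)) * (FB n * add_char q (n * snd p)))"
    unfolding kloosterman_def sum_distrib_left
    by (intro sum.cong refl) (auto simp: add_char_add mult_ac)
  also have "\<dots> = (\<Sum>p\<in>?P. \<Sum>m\<in>?R. \<Sum>n\<in>?R. (FA m * add_char q (m * fst p)) * (FB n * add_char q (n * snd p)))"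
    by (subst sum.swap[of _ ?R ?P], subst sum.swap) simp
  also have "\<dots> = (\<Sum>p\<in>?P. (\<Sum>m\<in>?R. FA m * add_char q (m * fst p)) * (\<Sum>n\<in>?R. FB n * add_char q (n * snd p)))"
    by (simp add: sum_product)
  also have "\<dots> = (\<Sum>p\<in>?P. if fst p \<in> A \<and> snd p \<in> B then of_nat q ^ 2 else 0)"
  proof (rule sum.cong[OF refl])
    fix p assume "p \<in> ?P"
    then have "fst p \<in> ?R" "snd p \<in> ?R" by (auto simp: inverse_pairs_def)
    then show "(\<Sum>m\<in>?R. FA m * add_char q (m * fst p)) * (\<Sum>n\<in>?R. FB n * add_char q (n * snd p))
       = (if fst p \<in> A \<and> snd p \<in> B then of_nat q ^ 2 else 0)"
      using ind[of "fst p" A] ind[of "snd p" B] A B by (simp add: FA_def FB_def power2_eq_square)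
  qed
  also have "\<dots> = (\<Sum>p\<in>{p\<in>?P. fst p \<in> A \<and> snd p \<in> B}. of_nat q ^ 2)"
    by (rule sum.inter_filter[symmetric]) simp
  also have "{p\<in>?P. fst p \<in> A \<and> snd p \<in> B} = {(x, y) \<in> ?P. x \<in> A \<and> y \<in> B}" by auto
  finally show ?thesis by (simp add: mult.commute)
qed

definition inverse_box_discrepancy :: "nat \<Rightarrow> int \<Rightarrow> int \<Rightarrow> int \<Rightarrow> int \<Rightarrow> real" where
  "inverse_box_discrepancy q a b c d =
    \<bar>real (card {(x, y) \<in> inverse_pairs q. x \<in> {a..<b} \<and> y \<in> {c..<d}})
      - real (totient q) / real q ^ 2 * real (card {a..<b}) * real (card {c..<d})\<bar>"

text \<open>
  The two parts of the weight are exchanged by \<open>m \<mapsto> q - m\<close>.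
\<close>

lemma sum_reflected_over_le:
  fixes f :: "nat \<Rightarrow> real"
  assumes q: "q \<ge> 1" and f: "\<And>m. m \<in> {1..<q} \<Longrightarrow> f (q - m) = f m"
    and nonneg: "\<And>m. 0 \<le> f m" and B: "(\<Sum>m=1..q. f m / real m) \<le> B"
  shows "(\<Sum>m\<in>{1..<int q}. real q * (1 / of_int m + 1 / (real q - of_int m)) * f (nat m)) \<le> 2 * real q * B"
proof -
  have "(\<Sum>m\<in>{1..<int q}. real q * (1 / of_int m + 1 / (real q - of_int m)) * f (nat m))
      = (\<Sum>m\<in>{1..<q}. real q * (1 / real m + 1 / (real q - real m)) * f m)"
    by (rule sum.reindex_bij_witness[of _ int nat]) auto
  also have "\<dots> = real q * (\<Sum>m\<in>{1..<q}. f m / real m) + real q * (\<Sum>m\<in>{1..<q}. f m / (real q - real m))"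
    by (simp add: sum_distrib_left ring_distribs sum.distrib)
  also have "(\<Sum>m\<in>{1..<q}. f m / (real q - real m)) = (\<Sum>m\<in>{1..<q}. f m / real m)"
    by (rule sum.reindex_bij_witness[of _ "\<lambda>m. q - m" "\<lambda>m. q - m"]) (auto simp: f of_nat_diff)
  also have "real q * (\<Sum>m\<in>{1..<q}. f m / real m) + real q * (\<Sum>m\<in>{1..<q}. f m / real m)
      = 2 * real q * (\<Sum>m\<in>{1..<q}. f m / real m)" by simp
  also have "\<dots> \<le> 2 * real q * B"
  proof (rule mult_left_mono)
    have "(\<Sum>m\<in>{1..<q}. f m / real m) \<le> (\<Sum>m=1..q. f m / real m)"
      by (rule sum_mono2) (use nonneg in auto)
    then show "(\<Sum>m\<in>{1..<q}. f m / real m) \<le> B" using B by linarith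
  qed simp
  finally show ?thesis .
qed

text \<open>
  In the completed count the frequency \<open>(0, 0)\<close> is the expected number. For the others
  the transforms of the intervals decay like \<open>q / m\<close> and the Kloosterman sum is estimated through
  whichever frequency is nonzero, so the total is a divisor function and two harmonic sums times
  \<open>q powr (3/4)\<close>.
\<close>

lemma inverse_pairs_discrepancy_explicit:
  fixes a b c d :: int
  assumes q: "q \<ge> 2" and ab: "0 \<le> a" "b \<le> int q" and cd: "0 \<le> c" "d \<le> int q"
  shows "inverse_box_discrepancy q a b c d
    \<le> 16 * real q powr (3/4) * real (card {d. d dvd q}) ^ 2 * (1 + ln (real q)) ^ 2"
proof -
  let ?R = "{0..<int q}" and ?R' = "{1..<int q}"
  define A B where "A = {a..<b}" and "B = {c..<d}"
  have AB: "A \<subseteq> ?R" "B \<subseteq> ?R" using ab cd by (auto simp: A_def B_def)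
  define FA where "FA m = (\<Sum>a\<in>A. add_char q (- (m * a)))" for m
  define FB where "FB m = (\<Sum>b\<in>B. add_char q (- (m * b)))" for m
  define N where "N = real (card {(x, y) \<in> inverse_pairs q. x \<in> A \<and> y \<in> B})"
  define D where "D = real (card {d. d dvd q})"
  define L where "L = 1 + ln (real q)"
  define \<kappa> where "\<kappa> = 2 * real q powr (3/4) * D"
  define w where "w m = (if m = 0 then real q else real q * (1 / of_int m + 1 / (real q - of_int m)))" for m :: int
  define g where "g m = real (gcd m q)" for m :: nat
  have q0: "q > 0" "real q > 0" using q by auto
  have L1: "L \<ge> 1" using q by (simp add: L_def)
  have D1: "D \<ge> 1"
  proof -
    have "{d. d dvd q} \<noteq> {}" by auto
    then have "card {d. d dvd q} > 0" using q by (simp add: card_gt_0_iff)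
    then show ?thesis by (simp add: D_def Suc_le_eq)
  qed
  have \<kappa>0: "\<kappa> \<ge> 0" using D1 by (simp add: \<kappa>_def)
  have w0: "w m \<ge> 0" if "m \<in> ?R" for m using that q by (auto simp: w_def)
  have R: "?R = insert 0 ?R'" "0 \<notin> ?R'" using q by auto
  have F: "norm (\<Sum>a\<in>S. add_char q (- (m * a))) \<le> w m" if "m \<in> ?R" "S = {i..<j}" "S \<subseteq> ?R" for m i j S
  proof (cases "m = 0")
    case True
    have "card S \<le> card ?R" by (rule card_mono) (use that in auto)
    then show ?thesis using True by (simp add: w_def)
  next
    case False
    then show ?thesis using norm_sum_add_char_interval_le[OF q0(1), of m i j] that by (simp add: w_def)
  qed
  have FA: "norm (FA m) \<le> w m" and FB: "norm (FB m) \<le> w m" if "m \<in> ?R" for m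
    unfolding FA_def FB_def using F[OF that A_def AB(1)] F[OF that B_def AB(2)] by auto
  have K: "norm (kloosterman q m n) \<le> \<kappa> * g (nat m)" if "m \<in> ?R" for m n
  proof -
    have "nat \<bar>m\<bar> = nat m" using that by simp
    then show ?thesis using norm_kloosterman_le[OF q, of m n]
      unfolding \<kappa>_def g_def D_def by (simp only: mult_ac)
  qed
  have K': "norm (kloosterman q n m) \<le> \<kappa> * g (nat m)" if "m \<in> ?R" for m n
    using K[OF that, of n] by (simp add: kloosterman_swap)
  have s1: "(\<Sum>m\<in>?R'. w m) \<le> 2 * real q * L"
  proof -
    have "(\<Sum>m\<in>?R'. w m) = (\<Sum>m\<in>?R'. real q * (1 / of_int m + 1 / (real q - of_int m)) * (\<lambda>_. 1) (nat m))"
      by (intro sum.cong refl) (auto simp: w_def)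
    also have "\<dots> \<le> 2 * real q * L"
      unfolding L_def by (rule sum_reflected_over_le) (use q sum_le_harm_ln[of q] in auto)
    finally show ?thesis .
  qed
  have s2: "(\<Sum>m\<in>?R'. w m * g (nat m)) \<le> 2 * real q * (D * L)"
  proof -
    have "(\<Sum>m\<in>?R'. w m * g (nat m)) = (\<Sum>m\<in>?R'. real q * (1 / of_int m + 1 / (real q - of_int m)) * g (nat m))"
      by (intro sum.cong refl) (auto simp: w_def)
    also have "\<dots> \<le> 2 * real q * (D * L)"
      unfolding L_def D_def
    proof (rule sum_reflected_over_le)
      fix m assume "m \<in> {1..<q}"
      then have "gcd (q - m) q = gcd m q" by (metis atLeastLessThan_iff gcd.commute gcd_diff1_nat gcd_diff2_nat less_imp_le)
      then show "g (q - m) = g m" by (simp add: g_def)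
    qed (use q sum_gcd_over_le[of q] in \<open>auto simp: g_def\<close>)
    finally show ?thesis .
  qed
  have s3: "(\<Sum>m\<in>?R. w m) \<le> real q * (1 + 2 * L)"
    using s1 R by (simp add: w_def algebra_simps)
  define t where "t m n = FA m * FB n * kloosterman q m n" for m n
  have tot: "of_nat q ^ 2 * complex_of_real N = (\<Sum>m\<in>?R. \<Sum>n\<in>?R. t m n)"
    using card_inverse_pairs_box[OF q0(1) AB] by (simp add: N_def t_def FA_def FB_def)
  have t00: "t 0 0 = complex_of_real (real (card A) * real (card B) * real (totient q))"
    by (simp add: t_def FA_def FB_def kloosterman_def card_inverse_pairs[OF q] case_prod_unfold)
  have "(\<Sum>m\<in>?R. \<Sum>n\<in>?R. t m n) = (\<Sum>n\<in>?R. t 0 n) + (\<Sum>m\<in>?R'. \<Sum>n\<in>?R. t m n)"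
    using R by simp
  also have "(\<Sum>n\<in>?R. t 0 n) = t 0 0 + (\<Sum>n\<in>?R'. t 0 n)" using R by simp
  finally have "norm (of_nat q ^ 2 * complex_of_real N - t 0 0) = norm ((\<Sum>n\<in>?R'. t 0 n) + (\<Sum>m\<in>?R'. \<Sum>n\<in>?R. t m n))"
    using tot by simp
  also have "\<dots> \<le> norm (\<Sum>n\<in>?R'. t 0 n) + norm (\<Sum>m\<in>?R'. \<Sum>n\<in>?R. t m n)" by (rule norm_triangle_ineq)
  also have "norm (\<Sum>n\<in>?R'. t 0 n) \<le> (\<Sum>n\<in>?R'. real q * w n * (\<kappa> * g (nat n)))"
  proof (rule sum_norm_le)
    fix n assume n: "n \<in> ?R'"
    have "norm (FA 0) \<le> real q" using FA[of 0] q0 by (simp add: w_def)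
    then show "norm (t 0 n) \<le> real q * w n * (\<kappa> * g (nat n))"
      unfolding t_def norm_mult using n w0 \<kappa>0 by (intro mult_mono FB K') (auto simp: g_def)
  qed
  also have "(\<Sum>n\<in>?R'. real q * w n * (\<kappa> * g (nat n))) = real q * \<kappa> * (\<Sum>n\<in>?R'. w n * g (nat n))"
    by (simp add: sum_distrib_left mult_ac)
  also have "\<dots> \<le> real q * \<kappa> * (2 * real q * (D * L))"
    by (rule mult_left_mono[OF s2]) (use \<kappa>0 in auto)
  also have "norm (\<Sum>m\<in>?R'. \<Sum>n\<in>?R. t m n) \<le> (\<Sum>m\<in>?R'. \<Sum>n\<in>?R. w m * w n * (\<kappa> * g (nat m)))"
  proof (intro sum_norm_le)
    fix m n assume mn: "m \<in> ?R'" "n \<in> ?R"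
    then show "norm (t m n) \<le> w m * w n * (\<kappa> * g (nat m))"
      unfolding t_def norm_mult using w0 \<kappa>0 by (intro mult_mono FA FB K) (auto simp: g_def)
  qed
  also have "\<dots> = \<kappa> * (\<Sum>m\<in>?R'. w m * g (nat m)) * (\<Sum>n\<in>?R. w n)"
    by (simp add: sum_distrib_left sum_distrib_right mult_ac)
  also have "\<dots> \<le> \<kappa> * (2 * real q * (D * L)) * (real q * (1 + 2 * L))"
    by (intro mult_mono mult_left_mono s2 s3 sum_nonneg mult_nonneg_nonneg) (use \<kappa>0 w0 D1 L1 in auto)
  also have "real q * \<kappa> * (2 * real q * (D * L)) + \<kappa> * (2 * real q * (D * L)) * (real q * (1 + 2 * L))
     = real q ^ 2 * (\<kappa> * D * (4 * L + 4 * (L * L)))"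
    by (simp add: algebra_simps power2_eq_square)
  also have "\<dots> \<le> real q ^ 2 * (\<kappa> * D * (8 * (L * L)))"
  proof (intro mult_left_mono)
    have "L * 1 \<le> L * L" using L1 by (intro mult_left_mono) auto
    then show "4 * L + 4 * (L * L) \<le> 8 * (L * L)" by simp
  qed (use \<kappa>0 D1 in auto)
  finally have "norm (of_nat q ^ 2 * complex_of_real N - t 0 0) \<le> real q ^ 2 * (\<kappa> * D * (8 * (L * L)))" by simp
  also have "of_nat q ^ 2 * complex_of_real N - t 0 0
      = complex_of_real (real q ^ 2 * (N - real (totient q) / real q ^ 2 * real (card A) * real (card B)))"
    unfolding t00 using q0 by (simp add: field_simps)
  finally have "real q ^ 2 * \<bar>N - real (totient q) / real q ^ 2 * real (card A) * real (card B)\<bar> \<le> real q ^ 2 * (\<kappa> * D * (8 * (L * L)))"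
    unfolding norm_of_real abs_mult by simp
  then have "\<bar>N - real (totient q) / real q ^ 2 * real (card A) * real (card B)\<bar> \<le> \<kappa> * D * (8 * (L * L))"
    using q0 by simp
  also have "\<kappa> * D * (8 * (L * L)) = 16 * real q powr (3/4) * D ^ 2 * L ^ 2"
    by (simp add: \<kappa>_def power2_eq_square)
  finally show ?thesis unfolding inverse_box_discrepancy_def N_def A_def B_def D_def L_def .
qed

lemma one_plus_ln_le_powr:
  fixes x s :: real
  assumes "x \<ge> 1" "s > 0"
  shows "1 + ln x \<le> (1 + 1 / s) * x powr s"
proof -
  have "1 \<le> x powr s" using assms by (simp add: ge_one_powr_ge_zero)
  moreover have "ln x \<le> x powr s / s" using assms by (intro ln_powr_bound) auto
  ultimately show ?thesis by (simp add: algebra_simps)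
qed

lemma inverse_pairs_discrepancy:
  fixes \<delta> :: real
  assumes "\<delta> > 0"
  obtains C where "C > 0" "\<And>q a b c d. \<lbrakk>q \<ge> 2; 0 \<le> a; b \<le> int q; 0 \<le> c; d \<le> int q\<rbrakk> \<Longrightarrow>
    inverse_box_discrepancy q a b c d \<le> C * real q powr (3/4 + \<delta>)"
proof -
  \<comment> \<open>two divisor functions and two logarithms share the exponent \<open>\<delta>\<close>\<close>
  define s where "s = \<delta> / 4"
  have s: "s > 0" using assms by (simp add: s_def)
  obtain C1 where C1: "C1 > 0" "\<And>n::nat. n > 0 \<Longrightarrow> real (card {d. d dvd n}) \<le> C1 * real n powr s"
    using card_divisors_le_powr[OF s] by blast
  define C2 where "C2 = 1 + 1 / s"
  have C2: "C2 > 0" using s by (simp add: C2_def add_pos_pos)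
  show ?thesis
  proof
    show "16 * C1 ^ 2 * C2 ^ 2 > 0" using C1 C2 by simp
    fix q :: nat and a b c d :: int
    assume h: "q \<ge> 2" "0 \<le> a" "b \<le> int q" "0 \<le> c" "d \<le> int q"
    have "inverse_box_discrepancy q a b c d
      \<le> 16 * real q powr (3/4) * real (card {d. d dvd q}) ^ 2 * (1 + ln (real q)) ^ 2"
      by (rule inverse_pairs_discrepancy_explicit[OF h])
    also have "\<dots> \<le> 16 * real q powr (3/4) * (C1 * real q powr s) ^ 2 * (C2 * real q powr s) ^ 2"
      unfolding C2_def using h s C1
      by (intro mult_mono power_mono one_plus_ln_le_powr order_refl) auto
    also have "\<dots> = 16 * C1 ^ 2 * C2 ^ 2 * (real q powr (3/4) * (real q powr s) ^ 4)"
      by (simp add: power_mult_distrib power2_eq_square power4_eq_xxxx mult_ac)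
    also have "(real q powr s) ^ 4 = real q powr \<delta>"
      using h by (simp add: powr_power s_def)
    also have "real q powr (3/4) * real q powr \<delta> = real q powr (3/4 + \<delta>)" by (simp add: powr_add)
    finally show "inverse_box_discrepancy q a b c d \<le> 16 * C1 ^ 2 * C2 ^ 2 * real q powr (3/4 + \<delta>)" .
  qed
qed

section \<open>Summation by parts and the truncated ratio\<close>

text \<open>
  Abel summation: the increments of \<open>F\<close> have one sign and telescope.
\<close>

lemma abel_antimono:
  fixes F x :: "nat \<Rightarrow> real"
  assumes S: "\<And>n. n \<le> N \<Longrightarrow> \<bar>\<Sum>i<n. x i\<bar> \<le> E"
    and F: "\<And>i j. i \<le> j \<Longrightarrow> j < N \<Longrightarrow> F j \<le> F i" "\<And>i. i < N \<Longrightarrow> 0 \<le> F i \<and> F i \<le> B"  and B: "0 \<le> B"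
    and n: "n \<le> N"
  shows "\<bar>\<Sum>i<n. F i * x i\<bar> \<le> B * E"
proof (cases n)
  case 0
  have "0 \<le> E" using S[of 0] by simp
  then show ?thesis using 0 B by simp
next
  case (Suc m)
  have E: "0 \<le> E" using S[of 0] by simp
  have *: "Suc m \<le> N \<Longrightarrow> \<bar>(\<Sum>i<Suc m. F i * x i) - F m * (\<Sum>i<Suc m. x i)\<bar> \<le> (F 0 - F m) * E" for m
  proof (induction m)
    case (Suc m)
    have "(\<Sum>i<Suc (Suc m). F i * x i) - F (Suc m) * (\<Sum>i<Suc (Suc m). x i)
       = ((\<Sum>i<Suc m. F i * x i) - F m * (\<Sum>i<Suc m. x i)) + (F m - F (Suc m)) * (\<Sum>i<Suc m. x i)"
      by (simp add: algebra_simps)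
    also have "\<bar>\<dots>\<bar> \<le> (F 0 - F m) * E + (F m - F (Suc m)) * E"
    proof (rule order_trans[OF abs_triangle_ineq], rule add_mono)
      show "\<bar>(\<Sum>i<Suc m. F i * x i) - F m * (\<Sum>i<Suc m. x i)\<bar> \<le> (F 0 - F m) * E"
        using Suc by simp
      have "F (Suc m) \<le> F m" using F(1)[of m "Suc m"] Suc.prems by simp
      then show "\<bar>(F m - F (Suc m)) * (\<Sum>i<Suc m. x i)\<bar> \<le> (F m - F (Suc m)) * E"
        unfolding abs_mult using S[of "Suc m"] Suc.prems by (intro mult_mono) auto
    qed
    finally show ?case by (simp add: algebra_simps)
  qed (simp add: E)
  have m: "Suc m \<le> N" using n Suc by simp
  have "\<bar>F m * (\<Sum>i<Suc m. x i)\<bar> \<le> F m * E"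
    unfolding abs_mult using S[OF m] F(2)[of m] m by (intro mult_mono) auto
  then have "\<bar>\<Sum>i<Suc m. F i * x i\<bar> \<le> (F 0 - F m) * E + F m * E"
    using *[OF m] by linarith
  also have "\<dots> = F 0 * E" by (simp add: algebra_simps)
  also have "\<dots> \<le> B * E" using F(2)[of 0] m E by (intro mult_right_mono) auto
  finally show ?thesis using Suc by simp
qed

definition monotone_seq :: "nat \<Rightarrow> (nat \<Rightarrow> real) \<Rightarrow> bool" where
  "monotone_seq N F \<longleftrightarrow> (\<forall>i j. i \<le> j \<and> j < N \<longrightarrow> F i \<le> F j) \<or> (\<forall>i j. i \<le> j \<and> j < N \<longrightarrow> F j \<le> F i)"

text \<open>
  An increasing weight is reduced to \<open>B - F\<close>. The conclusion holds for all partial sums, so the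
  lemma can be applied again to treat products of monotone weights.
\<close>

lemma abel_monotone:
  fixes F x :: "nat \<Rightarrow> real"
  assumes S: "\<And>n. n \<le> N \<Longrightarrow> \<bar>\<Sum>i<n. x i\<bar> \<le> E"
    and F: "monotone_seq N F" "\<And>i. i < N \<Longrightarrow> 0 \<le> F i \<and> F i \<le> B" and B: "0 \<le> B"
    and n: "n \<le> N"
  shows "\<bar>\<Sum>i<n. F i * x i\<bar> \<le> 2 * B * E"
proof -
  have E: "0 \<le> E" using S[of 0] by simp
  consider "\<And>i j. i \<le> j \<Longrightarrow> j < N \<Longrightarrow> F i \<le> F j" | "\<And>i j. i \<le> j \<Longrightarrow> j < N \<Longrightarrow> F j \<le> F i"
    using F(1) unfolding monotone_seq_def by blast
  then show ?thesis
  proof cases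
    case 1
    have "\<bar>\<Sum>i<n. (B - F i) * x i\<bar> \<le> B * E"
      by (rule abel_antimono[OF S _ _ B n]) (use 1 F(2) in auto)
    moreover have "\<bar>B * (\<Sum>i<n. x i)\<bar> \<le> B * E"
      unfolding abs_mult using S[OF n] B by (intro mult_mono) auto
    moreover have "(\<Sum>i<n. F i * x i) = B * (\<Sum>i<n. x i) - (\<Sum>i<n. (B - F i) * x i)"
      by (simp add: sum_distrib_left sum_subtractf[symmetric] algebra_simps)
    ultimately show ?thesis by linarith
  next
    case 2
    have "\<bar>\<Sum>i<n. F i * x i\<bar> \<le> B * E" by (rule abel_antimono[OF S 2 F(2) B n])
    moreover have "0 \<le> B * E" using B E by simp
    ultimately show ?thesis by linarith
  qed
qed

text \<open>
  The fraction of a half arc of a disc that the shadow of a parent with abscissa \<open>b\<close> leaves visible: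
  it is \<open>c / b\<close> for a number \<open>c\<close> that depends only on the disc, capped at both ends.
\<close>

definition trunc_ratio :: "real \<Rightarrow> real \<Rightarrow> real" where
  "trunc_ratio c b = min 1 (max 0 (c / b))"

lemma trunc_ratio_bounds: "0 \<le> trunc_ratio c b" "trunc_ratio c b \<le> 1"
  by (auto simp: trunc_ratio_def)

lemma trunc_ratio_mono: "b > 0 \<Longrightarrow> c \<le> c' \<Longrightarrow> trunc_ratio c b \<le> trunc_ratio c' b"
  unfolding trunc_ratio_def by (intro min.mono max.mono divide_right_mono) auto

text \<open>
  As a function of \<open>c\<close> the increment rises up to \<open>c = j\<close> and falls to \<open>0\<close> at \<open>c = j + 1\<close>. It is thus
  a difference of two increasing functions bounded by \<open>1 / (j + 1)\<close>, and the sum of these bounds over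
  \<open>j\<close> is only logarithmic.
\<close>

lemma trunc_ratio_diff_Suc:
  assumes j: "j \<ge> 1"
  shows "trunc_ratio c (real j) - trunc_ratio c (real j + 1)
     = min (real j) (max 0 c) / (real j * (real j + 1)) - min 1 (max 0 (c - real j)) / (real j + 1)"
proof -
  have j0: "real j > 0" using j by simp
  consider "c \<le> 0" | "0 < c" "c \<le> real j" | "real j < c" "c \<le> real j + 1" | "real j + 1 < c" by linarith
  then show ?thesis
  proof cases
    case 1
    then have "c / real j \<le> 0" "c / (real j + 1) \<le> 0" using j0 by (auto simp: divide_le_0_iff)
    then show ?thesis using 1 j0 by (simp add: trunc_ratio_def)
  next
    case 2
    then have "0 \<le> c / real j" "c / real j \<le> 1" "0 \<le> c / (real j + 1)" "c / (real j + 1) \<le> 1" using j0 by auto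
    then have "trunc_ratio c (real j) - trunc_ratio c (real j + 1) = c / real j - c / (real j + 1)"
      by (simp add: trunc_ratio_def)
    also have "\<dots> = c / (real j * (real j + 1))" using j0 by (simp add: field_simps)
    finally show ?thesis using 2 by simp
  next
    case 3
    then have "1 \<le> c / real j" "0 \<le> c / (real j + 1)" "c / (real j + 1) \<le> 1" using j0 by auto
    then have "trunc_ratio c (real j) - trunc_ratio c (real j + 1) = 1 - c / (real j + 1)"
      by (simp add: trunc_ratio_def)
    also have "\<dots> = 1 / (real j + 1) - (c - real j) / (real j + 1)" using j0 by (simp add: field_simps)
    finally show ?thesis using 3 j0 by simp
  next
    case 4
    then have "1 \<le> c / real j" "1 \<le> c / (real j + 1)" using j0 by auto
    then show ?thesis using 4 j0 by (simp add: trunc_ratio_def)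
  qed
qed

text \<open>
  Layer decomposition in \<open>b\<close>: only the events \<open>b \<le> j\<close>, whose frequency is known, remain.
\<close>

lemma trunc_ratio_layers:
  fixes b q :: nat
  assumes "1 \<le> b" "b \<le> q"
  shows "trunc_ratio c (real b) = trunc_ratio c (real q)
     + (\<Sum>j\<in>{1..<q}. (trunc_ratio c (real j) - trunc_ratio c (real j + 1)) * (if b \<le> j then 1 else 0))"
proof -
  have "(\<Sum>j\<in>{1..<q}. (trunc_ratio c (real j) - trunc_ratio c (real j + 1)) * (if b \<le> j then 1 else 0))
     = (\<Sum>j\<in>{b..<q}. trunc_ratio c (real j) - trunc_ratio c (real (Suc j)))"
    by (rule sum.mono_neutral_cong_right) (use assms in \<open>auto simp: add.commute\<close>)
  also have "\<dots> = trunc_ratio c (real b) - trunc_ratio c (real q)"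
    using sum_Suc_diff'[of b q "\<lambda>j. - trunc_ratio c (real j)"] assms by simp
  finally show ?thesis by simp
qed

lemma sum_trunc_ratio_layers:
  fixes q :: nat
  assumes "q \<ge> 1"
  shows "real q * trunc_ratio c (real q)
     + (\<Sum>j\<in>{1..<q}. (trunc_ratio c (real j) - trunc_ratio c (real j + 1)) * real j)
     = (\<Sum>b=1..q. trunc_ratio c (real b))"
proof -
  have "(\<Sum>b=1..q. trunc_ratio c (real b)) = (\<Sum>b=1..q. trunc_ratio c (real q)
     + (\<Sum>j\<in>{1..<q}. (trunc_ratio c (real j) - trunc_ratio c (real j + 1)) * (if b \<le> j then 1 else 0)))"
    by (intro sum.cong refl trunc_ratio_layers) auto
  also have "\<dots> = real q * trunc_ratio c (real q) +
     (\<Sum>b=1..q. \<Sum>j\<in>{1..<q}. (trunc_ratio c (real j) - trunc_ratio c (real j + 1)) * (if b \<le> j then 1 else 0))"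
    by (simp add: sum.distrib)
  also have "(\<Sum>b=1..q. \<Sum>j\<in>{1..<q}. (trunc_ratio c (real j) - trunc_ratio c (real j + 1)) * (if b \<le> j then 1 else 0))
     = (\<Sum>j\<in>{1..<q}. (trunc_ratio c (real j) - trunc_ratio c (real j + 1)) * (\<Sum>b=1..q. if b \<le> j then 1 else 0))"
    by (subst sum.swap) (simp add: sum_distrib_left)
  also have "\<dots> = (\<Sum>j\<in>{1..<q}. (trunc_ratio c (real j) - trunc_ratio c (real j + 1)) * real j)"
  proof (intro sum.cong refl)
    fix j assume j: "j \<in> {1..<q}"
    have "(\<Sum>b=1..q. if b \<le> j then 1 else 0 :: real) = (\<Sum>b\<in>{1..j}. 1)"
      by (rule sum.mono_neutral_cong_right) (use j in auto)
    then show "(trunc_ratio c (real j) - trunc_ratio c (real j + 1)) * (\<Sum>b=1..q. if b \<le> j then 1 else 0)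
      = (trunc_ratio c (real j) - trunc_ratio c (real j + 1)) * real j" by simp
  qed
  finally show ?thesis by simp
qed

lemma monotone_seq_comp_antimono:
  assumes "mono f" and "\<And>i j. i \<le> j \<Longrightarrow> j < N \<Longrightarrow> c j \<le> c i"
  shows "monotone_seq N (\<lambda>i. f (c i))"
  using assms unfolding monotone_seq_def by (auto dest: monoD)

text \<open>
  Here \<open>ch j i\<close> indicates that the \<open>i\<close>-th point has its second coordinate at most \<open>j\<close>. The layer
  decomposition writes the weight as a combination of these indicators with coefficients that are
  products and differences of functions monotone in \<open>i\<close>. Replacing each indicator by its density
  \<open>\<rho> j\<close> costs \<open>E\<close> times the sizes of the coefficients, and reassembling the layers gives the
  average over \<open>b\<close>.
\<close>

lemma weighted_equidistribution:
  fixes ch :: "nat \<Rightarrow> nat \<Rightarrow> real" and W c :: "nat \<Rightarrow> real" and q N :: nat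
  assumes q: "q \<ge> 1"
    and ch: "\<And>j n. j \<in> {1..q} \<Longrightarrow> n \<le> N \<Longrightarrow> \<bar>(\<Sum>i<n. ch j i) - \<rho> * real j * real n\<bar> \<le> E"
    and W: "monotone_seq N W" "\<And>i. i < N \<Longrightarrow> 0 \<le> W i \<and> W i \<le> M" and M: "0 \<le> M"
    and c: "\<And>i j. i \<le> j \<Longrightarrow> j < N \<Longrightarrow> c j \<le> c i"
  shows "\<bar>(\<Sum>i<N. W i * (trunc_ratio (c i) q * ch q i
             + (\<Sum>j\<in>{1..<q}. (trunc_ratio (c i) j - trunc_ratio (c i) (real j + 1)) * ch j i)))
          - \<rho> * (\<Sum>i<N. W i * (\<Sum>b=1..q. trunc_ratio (c i) b))\<bar> \<le> 12 * M * E * (1 + ln (real q))"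
proof -
  \<comment> \<open>the deviation from the mean density; its partial sums are at most \<open>E\<close>\<close>
  define x where "x j i = ch j i - \<rho> * real j" for j i
  have E: "0 \<le> E" using ch[of 1 0] q by simp
  have x: "\<bar>\<Sum>i<n. W i * x j i\<bar> \<le> 2 * M * E" if "j \<in> {1..q}" "n \<le> N" for j n
  proof (rule abel_monotone[OF _ W M that(2)])
    fix n assume "n \<le> N"
    then show "\<bar>\<Sum>i<n. x j i\<bar> \<le> E"
      using ch[OF that(1)] by (simp add: x_def sum_subtractf mult.commute)
  qed
  have gen: "\<bar>\<Sum>i<N. f (c i) * (W i * x j i)\<bar> \<le> 4 * M * E * B"
    if "j \<in> {1..q}" "mono f" "\<And>y. 0 \<le> f y \<and> f y \<le> B" for j f B
  proof -
    have "\<bar>\<Sum>i<N. f (c i) * (W i * x j i)\<bar> \<le> 2 * B * (2 * M * E)"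
      by (rule abel_monotone[OF x[OF that(1)] monotone_seq_comp_antimono[OF that(2) c] that(3)])
         (use that(3)[of 0] in auto)
    then show ?thesis by (simp add: mult_ac)
  qed
  define d where "d j i = trunc_ratio (c i) (real j) - trunc_ratio (c i) (real j + 1)" for j i
  have 1: "\<bar>\<Sum>i<N. trunc_ratio (c i) q * (W i * x q i)\<bar> \<le> 4 * M * E * 1"
    by (rule gen[where f = "\<lambda>y. trunc_ratio y q"]) (use q in \<open>auto intro!: monoI trunc_ratio_mono trunc_ratio_bounds\<close>)
  have 2: "\<bar>\<Sum>i<N. d j i * (W i * x j i)\<bar> \<le> 8 * M * E * (1 / (real j + 1))" if j: "j \<in> {1..<q}" for j
  proof -
    have "\<bar>\<Sum>i<N. (min (real j) (max 0 (c i)) / (real j * (real j + 1))) * (W i * x j i)\<bar> \<le> 4 * M * E * (1 / (real j + 1))"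
      by (rule gen[where f = "\<lambda>y. min (real j) (max 0 y) / (real j * (real j + 1))"])
         (use j in \<open>auto intro!: monoI divide_right_mono simp: divide_le_eq\<close>)
    moreover have "\<bar>\<Sum>i<N. (min 1 (max 0 (c i - real j)) / (real j + 1)) * (W i * x j i)\<bar> \<le> 4 * M * E * (1 / (real j + 1))"
      by (rule gen[where f = "\<lambda>y. min 1 (max 0 (y - real j)) / (real j + 1)"])
         (use j in \<open>auto intro!: monoI divide_right_mono simp: divide_le_eq\<close>)
    moreover have "(\<Sum>i<N. d j i * (W i * x j i)) = (\<Sum>i<N. (min (real j) (max 0 (c i)) / (real j * (real j + 1))) * (W i * x j i))
       - (\<Sum>i<N. (min 1 (max 0 (c i - real j)) / (real j + 1)) * (W i * x j i))"
      unfolding sum_subtractf[symmetric] d_def using j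
      by (intro sum.cong refl) (simp add: trunc_ratio_diff_Suc left_diff_distrib)
    ultimately show ?thesis by linarith
  qed
  have "(\<Sum>i<N. W i * (trunc_ratio (c i) q * ch q i + (\<Sum>j\<in>{1..<q}. d j i * ch j i)))
          - \<rho> * (\<Sum>i<N. W i * (\<Sum>b=1..q. trunc_ratio (c i) b))
      = (\<Sum>i<N. trunc_ratio (c i) q * (W i * x q i) + (\<Sum>j\<in>{1..<q}. d j i * (W i * x j i)))"
    unfolding sum_distrib_left[of \<rho>] sum_subtractf[symmetric]
  proof (intro sum.cong refl)
    fix i
    have "(\<Sum>b=1..q. trunc_ratio (c i) b) = real q * trunc_ratio (c i) q + (\<Sum>j\<in>{1..<q}. d j i * real j)"
      using sum_trunc_ratio_layers[OF q, of "c i"] by (simp add: d_def)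
    then show "W i * (trunc_ratio (c i) q * ch q i + (\<Sum>j\<in>{1..<q}. d j i * ch j i)) - \<rho> * (W i * (\<Sum>b=1..q. trunc_ratio (c i) b))
       = trunc_ratio (c i) q * (W i * x q i) + (\<Sum>j\<in>{1..<q}. d j i * (W i * x j i))"
      by (simp add: x_def algebra_simps sum_distrib_left sum_subtractf)
  qed
  also have "\<dots> = (\<Sum>i<N. trunc_ratio (c i) q * (W i * x q i)) + (\<Sum>j\<in>{1..<q}. \<Sum>i<N. d j i * (W i * x j i))"
    unfolding sum.distrib by (subst sum.swap) simp
  also have "\<bar>\<dots>\<bar> \<le> 4 * M * E * 1 + (\<Sum>j\<in>{1..<q}. 8 * M * E * (1 / (real j + 1)))"
    by (intro order_trans[OF abs_triangle_ineq] add_mono 1 order_trans[OF sum_abs] sum_mono 2)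
  also have "\<dots> = 4 * M * E + 8 * M * E * (\<Sum>j\<in>{1..<q}. 1 / (real j + 1))"
    by (simp only: mult_1_right sum_distrib_left)
  also have "\<dots> \<le> 4 * M * E + 8 * M * E * (1 + ln (real q))"
  proof -
    have "(\<Sum>j\<in>{1..<q}. 1 / (real j + 1)) = (\<Sum>k\<in>{2..q}. 1 / real k)"
      by (rule sum.reindex_bij_witness[of _ "\<lambda>k. k - 1" Suc]) (auto simp: add.commute of_nat_diff)
    also have "\<dots> \<le> (\<Sum>k=1..q. 1 / real k)" by (rule sum_mono2) auto
    also have "\<dots> \<le> 1 + ln (real q)" by (rule sum_le_harm_ln[OF q])
    finally show ?thesis using M E by (intro add_left_mono mult_left_mono) auto
  qed
  also have "\<dots> \<le> 12 * M * E * (1 + ln (real q))"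
  proof -
    have "4 * M * E * 1 \<le> 4 * M * E * (1 + ln (real q))" using M E q by (intro mult_left_mono) auto
    then show ?thesis by linarith
  qed
  finally show ?thesis unfolding d_def .
qed

text \<open>
  The mean of \<open>trunc_ratio z\<close> over \<open>{0..1}\<close>.
\<close>

definition trunc_mean :: "real \<Rightarrow> real" where
  "trunc_mean z = (if z \<le> 0 then 0 else if z < 1 then z - z * ln z else 1)"

text \<open>
  Comparison with the primitive \<open>\<Phi>\<close> of the decreasing function \<open>trunc_ratio c\<close>, normalised by
  \<open>\<Phi> 0 = 0\<close>. At \<open>b = 0\<close> the function has the value \<open>1\<close> as a limit, whereas division by zero would
  give \<open>0\<close>.
\<close>

lemma sum_trunc_ratio:
  fixes q :: nat
  assumes q: "q \<ge> 1"
  shows "\<bar>(\<Sum>b=1..q. trunc_ratio c (real b)) - real q * trunc_mean (c / real q)\<bar> \<le> 1"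
proof (cases "c \<le> 0")
  case True
  then have "trunc_ratio c (real b) = 0" for b
    by (auto simp: trunc_ratio_def divide_le_0_iff intro!: min_absorb2 max_absorb1)
  moreover have "c / real q \<le> 0" using True by (simp add: divide_le_0_iff)
  ultimately show ?thesis by (simp add: trunc_mean_def)
next
  case False
  then have c: "c > 0" by simp
  define \<Phi> where "\<Phi> b = (if b \<le> c then b else c + c * ln (b / c))" for b
  have step: "trunc_ratio c (real b + 1) \<le> \<Phi> (real b + 1) - \<Phi> (real b) \<and>
      \<Phi> (real b + 1) - \<Phi> (real b) \<le> (if b = 0 then 1 else trunc_ratio c (real b))" for b :: nat
  proof -
    define t where "t = real b"
    have t: "t \<ge> 0" by (simp add: t_def)
    have pc: "0 \<le> c / t" "0 \<le> c / (t + 1)" using c t by auto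
    consider "t + 1 \<le> c" | "t < c" "c < t + 1" | "c \<le> t" by linarith
    then have "trunc_ratio c (t + 1) \<le> \<Phi> (t + 1) - \<Phi> t \<and>
      \<Phi> (t + 1) - \<Phi> t \<le> (if t = 0 then 1 else trunc_ratio c t)"
    proof cases
      case 1
      have "t \<noteq> 0 \<Longrightarrow> 1 \<le> c / t" using 1 t by (simp add: le_divide_eq)
      then show ?thesis using 1 pc t trunc_ratio_bounds(2) by (auto simp: \<Phi>_def trunc_ratio_def)
    next
      case 2
      have \<Phi>: "\<Phi> (t + 1) - \<Phi> t = c + c * ln ((t + 1) / c) - t" using 2 by (simp add: \<Phi>_def)
      have tr: "trunc_ratio c (t + 1) = c / (t + 1)" using 2 c t by (simp add: trunc_ratio_def)
      have "ln (c / (t + 1)) \<le> c / (t + 1) - 1" using c t by (intro ln_le_minus_one) auto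
      then have l1: "ln ((t + 1) / c) \<ge> 1 - c / (t + 1)" using c t by (simp add: ln_div)
      have l2: "ln ((t + 1) / c) \<le> (t + 1) / c - 1" using c t by (intro ln_le_minus_one) auto
      have "c * (1 - c / (t + 1)) \<le> c * ln ((t + 1) / c)" using l1 c by (intro mult_left_mono) auto
      moreover have "c / (t + 1) \<le> c + c * (1 - c / (t + 1)) - t"
      proof -
        define e where "e = c / (t + 1)"
        have e: "(t + 1) * e = c" using t by (simp add: e_def)
        have "0 \<le> ((t + 1) - c) * (c - t)" using 2 by simp
        also have "\<dots> = 2 * c * (t + 1) - c * ((t + 1) * e) - t * (t + 1) - (t + 1) * e"
          unfolding e by (simp add: algebra_simps)
        also have "\<dots> = (t + 1) * (c + c * (1 - e) - t - e)" by (simp add: algebra_simps)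
        also have "\<dots> = (t + 1) * (c + c * (1 - c / (t + 1)) - t - c / (t + 1))" by (simp add: e_def)
        finally show ?thesis using t by (simp add: zero_le_mult_iff)
      qed
      moreover have "c * ln ((t + 1) / c) \<le> c * ((t + 1) / c - 1)" using l2 c by (intro mult_left_mono) auto
      moreover have "c * ((t + 1) / c - 1) = t + 1 - c" using c by (simp add: field_simps)
      moreover have "t \<noteq> 0 \<Longrightarrow> trunc_ratio c t = 1" using 2 t by (simp add: trunc_ratio_def)
      ultimately show ?thesis unfolding \<Phi> tr by auto
    next
      case 3
      then have t0: "t > 0" using c by simp
      have tr: "trunc_ratio c (t + 1) = c / (t + 1)" "trunc_ratio c t = c / t" using 3 c t0 by (auto simp: trunc_ratio_def)
      have \<Phi>: "\<Phi> (t + 1) - \<Phi> t = c * (ln (t + 1) - ln t)"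
        using 3 c t0 by (simp add: \<Phi>_def ln_div algebra_simps)
      have "ln (t / (t + 1)) \<le> t / (t + 1) - 1" using t0 by (intro ln_le_minus_one) auto
      then have "1 / (t + 1) \<le> ln (t + 1) - ln t" using t0 by (simp add: ln_div field_simps)
      then have "c * (1 / (t + 1)) \<le> c * (ln (t + 1) - ln t)" using c by (intro mult_left_mono) auto
      moreover have "ln ((t + 1) / t) \<le> (t + 1) / t - 1" using t0 by (intro ln_le_minus_one) auto
      then have "ln (t + 1) - ln t \<le> 1 / t" using t0 by (simp add: ln_div field_simps)
      then have "c * (ln (t + 1) - ln t) \<le> c * (1 / t)" using c by (intro mult_left_mono) auto
      ultimately show ?thesis unfolding \<Phi> tr using t0 by simp
    qed
    then show ?thesis unfolding t_def by simp
  qed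
  have tele: "(\<Sum>b<n. \<Phi> (real b + 1) - \<Phi> (real b)) = \<Phi> (real n)" for n
    using sum_lessThan_telescope[of "\<lambda>b. \<Phi> (real b)" n] c by (simp add: add.commute \<Phi>_def)
  have "(\<Sum>b<q. trunc_ratio c (real b + 1)) \<le> (\<Sum>b<q. \<Phi> (real b + 1) - \<Phi> (real b))"
    by (rule sum_mono) (use step in blast)
  then have lo: "(\<Sum>b<q. trunc_ratio c (real b + 1)) \<le> \<Phi> (real q)" by (simp only: tele)
  have "(\<Sum>b<q. \<Phi> (real b + 1) - \<Phi> (real b)) \<le> (\<Sum>b<q. if b = 0 then 1 else trunc_ratio c (real b))"
    by (rule sum_mono) (use step in blast)
  then have hi: "\<Phi> (real q) \<le> (\<Sum>b<q. if b = 0 then 1 else trunc_ratio c (real b))" by (simp only: tele)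
  have e1: "(\<Sum>b<q. trunc_ratio c (real b + 1)) = (\<Sum>b=1..q. trunc_ratio c (real b))"
    by (rule sum.reindex_bij_witness[of _ "\<lambda>b. b - 1" Suc]) (auto simp: add.commute)
  have e2: "(\<Sum>b<q. if b = 0 then 1 else trunc_ratio c (real b)) \<le> 1 + (\<Sum>b=1..q. trunc_ratio c (real b))"
  proof -
    have "{..<q} = insert 0 {1..<q}" using q by auto
    then have "(\<Sum>b<q. if b = 0 then 1 else trunc_ratio c (real b)) = 1 + (\<Sum>b\<in>{1..<q}. trunc_ratio c (real b))"
      by simp
    also have "(\<Sum>b\<in>{1..<q}. trunc_ratio c (real b)) \<le> (\<Sum>b=1..q. trunc_ratio c (real b))"
      by (rule sum_mono2) (auto simp: trunc_ratio_bounds)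
    finally show ?thesis by simp
  qed
  have "\<Phi> (real q) = real q * trunc_mean (c / real q)"
  proof -
    have "real q > 0" using q by simp
    then show ?thesis using c by (auto simp: \<Phi>_def trunc_mean_def ln_div field_simps)
  qed
  then show ?thesis using lo hi e1 e2 by linarith
qed

lemma trunc_mean_bounds: "0 \<le> trunc_mean z" "trunc_mean z \<le> 1"
proof -
  have "0 < z \<Longrightarrow> z < 1 \<Longrightarrow> 0 \<le> z - z * ln z \<and> z - z * ln z \<le> 1"
  proof -
    assume z: "0 < z" "z < 1"
    have "z * ln z \<le> 0" using z by (simp add: mult_le_0_iff)
    moreover have "ln (1 / z) \<le> 1 / z - 1" using z by (intro ln_le_minus_one) auto
    then have "- ln z \<le> 1 / z - 1" using z by (simp add: ln_div)
    then have "z * (- ln z) \<le> z * (1 / z - 1)" using z by (intro mult_left_mono) auto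
    then have "z - z * ln z \<le> 1" using z by (simp add: algebra_simps)
    ultimately show "0 \<le> z - z * ln z \<and> z - z * ln z \<le> 1" using z by linarith
  qed
  then show "0 \<le> trunc_mean z" "trunc_mean z \<le> 1" by (auto simp: trunc_mean_def)
qed

lemma trunc_mean_mono: "mono trunc_mean"
proof (rule monoI)
  fix x y :: real assume xy: "x \<le> y"
  consider "x \<le> 0" | "y \<ge> 1" | "0 < x" "y < 1" by linarith
  then show "trunc_mean x \<le> trunc_mean y"
  proof cases
    case 1
    then have "trunc_mean x = 0" by (simp add: trunc_mean_def)
    then show ?thesis using trunc_mean_bounds(1) by simp
  next
    case 2
    then have "trunc_mean y = 1" by (simp add: trunc_mean_def)
    then show ?thesis using trunc_mean_bounds(2) by simp
  next
    case 3
    have "(\<lambda>z. z - z * ln z) x \<le> (\<lambda>z. z - z * ln z) y"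
    proof (rule DERIV_nonneg_imp_nondecreasing[OF xy])
      fix z assume z: "x \<le> z" "z \<le> y"
      then have "((\<lambda>z. z - z * ln z) has_real_derivative - ln z) (at z)"
        using 3 by (auto intro!: derivative_eq_intros)
      moreover have "- ln z \<ge> 0" using z 3 by simp
      ultimately show "\<exists>y. ((\<lambda>z. z - z * ln z) has_real_derivative y) (at z) \<and> 0 \<le> y" by blast
    qed
    then show ?thesis using 3 xy by (simp add: trunc_mean_def)
  qed
qed

section \<open>Weighted sums over modular inverses\<close>

lemma sum_inverse_pairs_strip:
  fixes h :: "int \<Rightarrow> int \<Rightarrow> real" and y1 :: int
  assumes "0 \<le> y1" "y1 + int N \<le> int q"
  shows "(\<Sum>(a, b)\<in>{(a, b) \<in> inverse_pairs q. y1 \<le> a \<and> a < y1 + int N}. h a b)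
     = (\<Sum>i<N. \<Sum>b\<in>{0..<int q}. if (y1 + int i, b) \<in> inverse_pairs q then h (y1 + int i) b else 0)"
proof -
  have "(\<Sum>i<N. \<Sum>b\<in>{0..<int q}. if (y1 + int i, b) \<in> inverse_pairs q then h (y1 + int i) b else 0)
     = (\<Sum>(i, b)\<in>{..<N} \<times> {0..<int q}. if (y1 + int i, b) \<in> inverse_pairs q then h (y1 + int i) b else 0)"
    by (rule sum.cartesian_product)
  also have "\<dots> = (\<Sum>p\<in>{p \<in> {..<N} \<times> {0..<int q}. (y1 + int (fst p), snd p) \<in> inverse_pairs q}. h (y1 + int (fst p)) (snd p))"
    by (subst sum.inter_filter) (auto simp: case_prod_unfold)
  also have "\<dots> = (\<Sum>(a, b)\<in>{(a, b) \<in> inverse_pairs q. y1 \<le> a \<and> a < y1 + int N}. h a b)"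
    by (rule sum.reindex_bij_witness[of _ "\<lambda>(a, b). (nat (a - y1), b)" "\<lambda>(i, b). (y1 + int i, b)"])
       (auto simp: inverse_pairs_def)
  finally show ?thesis by simp
qed

text \<open>
  The weight may be applied to the inverse \<open>b\<close> itself or to \<open>q - b\<close>, the denominators of the two
  parents. The function \<open>\<beta>\<close> covers both; its sublevel sets have to be intervals of the right length.
\<close>

lemma inverse_pairs_weighted_sum:
  fixes W c :: "int \<Rightarrow> real" and \<beta> :: "int \<Rightarrow> nat" and q N :: nat and y1 :: int
  assumes q: "q \<ge> 2" and y: "0 \<le> y1" "y1 + int N \<le> int q"
    and E: "\<And>a b c d. \<lbrakk>0 \<le> a; b \<le> int q; 0 \<le> c; d \<le> int q\<rbrakk> \<Longrightarrow>
      inverse_box_discrepancy q a b c d \<le> E"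
    and \<beta>: "\<And>x y. (x, y) \<in> inverse_pairs q \<Longrightarrow> 1 \<le> \<beta> y \<and> \<beta> y \<le> q"
    and int: "\<And>j. j \<in> {1..q} \<Longrightarrow> \<exists>c d. 0 \<le> c \<and> d \<le> int q \<and> card {c..<d} = j \<and>
        (\<forall>x y. (x, y) \<in> inverse_pairs q \<longrightarrow> (\<beta> y \<le> j \<longleftrightarrow> y \<in> {c..<d}))"
    and W: "monotone_seq N (\<lambda>i. W (y1 + int i))" "\<And>i. i < N \<Longrightarrow> 0 \<le> W (y1 + int i) \<and> W (y1 + int i) \<le> M" and M: "0 \<le> M"
    and c: "\<And>i j. i \<le> j \<Longrightarrow> j < N \<Longrightarrow> c (y1 + int j) \<le> c (y1 + int i)"
  shows "\<bar>(\<Sum>(a, b)\<in>{(a, b) \<in> inverse_pairs q. y1 \<le> a \<and> a < y1 + int N}. W a * trunc_ratio (c a) (\<beta> b))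
     - real (totient q) / real q ^ 2 * (\<Sum>i<N. W (y1 + int i) * (\<Sum>b=1..q. trunc_ratio (c (y1 + int i)) b))\<bar>
     \<le> 12 * M * E * (1 + ln (real q))"
proof -
  define ch where "ch j i = (\<Sum>b\<in>{0..<int q}. if (y1 + int i, b) \<in> inverse_pairs q \<and> \<beta> b \<le> j then 1 else 0 :: real)" for j i
  have pre: "\<bar>(\<Sum>i<n. ch j i) - real (totient q) / real q ^ 2 * real j * real n\<bar> \<le> E" if j: "j \<in> {1..q}" and n: "n \<le> N" for j n
  proof -
    obtain c d where cd: "0 \<le> c" "d \<le> int q" "card {c..<d} = j"
       "\<And>x y. (x, y) \<in> inverse_pairs q \<Longrightarrow> (\<beta> y \<le> j \<longleftrightarrow> y \<in> {c..<d})" using int[OF j] by blast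
    have yn: "y1 + int n \<le> int q" using y n by simp
    have "(\<Sum>i<n. ch j i) = (\<Sum>i<n. \<Sum>b\<in>{0..<int q}. if (y1 + int i, b) \<in> inverse_pairs q then (if \<beta> b \<le> j then 1 else 0) else 0)"
      unfolding ch_def by (intro sum.cong refl) auto
    also have "\<dots> = (\<Sum>(a, b)\<in>{(a, b) \<in> inverse_pairs q. y1 \<le> a \<and> a < y1 + int n}. if \<beta> b \<le> j then 1 else 0)"
      by (rule sum_inverse_pairs_strip[symmetric, OF y(1) yn])
    also have "\<dots> = (\<Sum>p\<in>{(a, b) \<in> inverse_pairs q. y1 \<le> a \<and> a < y1 + int n}. if \<beta> (snd p) \<le> j then 1 else 0)"
      by (simp add: case_prod_unfold)
    also have "\<dots> = (\<Sum>p\<in>{p \<in> {(a, b) \<in> inverse_pairs q. y1 \<le> a \<and> a < y1 + int n}. \<beta> (snd p) \<le> j}. 1)"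
      by (rule sum.inter_filter[symmetric]) (rule finite_subset[OF _ finite_inverse_pairs], auto)
    also have "{p \<in> {(a, b) \<in> inverse_pairs q. y1 \<le> a \<and> a < y1 + int n}. \<beta> (snd p) \<le> j}
       = {(x, y) \<in> inverse_pairs q. x \<in> {y1..<y1 + int n} \<and> y \<in> {c..<d}}" using cd(4) by auto
    finally have "(\<Sum>i<n. ch j i) = real (card {(x, y) \<in> inverse_pairs q. x \<in> {y1..<y1 + int n} \<and> y \<in> {c..<d}})" by simp
    then show ?thesis using E[OF y(1) yn cd(1,2)] cd(3) by (simp add: inverse_box_discrepancy_def mult_ac)
  qed
  have "(\<Sum>(a, b)\<in>{(a, b) \<in> inverse_pairs q. y1 \<le> a \<and> a < y1 + int N}. W a * trunc_ratio (c a) (\<beta> b))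
     = (\<Sum>i<N. \<Sum>b\<in>{0..<int q}. if (y1 + int i, b) \<in> inverse_pairs q then W (y1 + int i) * trunc_ratio (c (y1 + int i)) (\<beta> b) else 0)"
    by (rule sum_inverse_pairs_strip[OF y])
  also have "\<dots> = (\<Sum>i<N. W (y1 + int i) * (trunc_ratio (c (y1 + int i)) q * ch q i
             + (\<Sum>j\<in>{1..<q}. (trunc_ratio (c (y1 + int i)) j - trunc_ratio (c (y1 + int i)) (real j + 1)) * ch j i)))"
  proof (rule sum.cong[OF refl])
    fix i
    let ?a = "y1 + int i"
    let ?D = "\<lambda>j::nat. trunc_ratio (c ?a) j - trunc_ratio (c ?a) (real j + 1)"
    have "(if (?a, b) \<in> inverse_pairs q then trunc_ratio (c ?a) (\<beta> b) else 0)
      = trunc_ratio (c ?a) q * (if (?a, b) \<in> inverse_pairs q \<and> \<beta> b \<le> q then 1 else 0)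
        + (\<Sum>j\<in>{1..<q}. ?D j * (if (?a, b) \<in> inverse_pairs q \<and> \<beta> b \<le> j then 1 else 0))" for b
    proof (cases "(?a, b) \<in> inverse_pairs q")
      case True
      then show ?thesis using trunc_ratio_layers[of "\<beta> b" q "c ?a"] \<beta>[OF True] by simp
    qed simp
    then have "(\<Sum>b\<in>{0..<int q}. if (?a, b) \<in> inverse_pairs q then trunc_ratio (c ?a) (\<beta> b) else 0)
       = trunc_ratio (c ?a) q * ch q i + (\<Sum>b\<in>{0..<int q}. \<Sum>j\<in>{1..<q}. ?D j * (if (?a, b) \<in> inverse_pairs q \<and> \<beta> b \<le> j then 1 else 0))"
      by (simp add: sum.distrib ch_def sum_distrib_left)
    also have "(\<Sum>b\<in>{0..<int q}. \<Sum>j\<in>{1..<q}. ?D j * (if (?a, b) \<in> inverse_pairs q \<and> \<beta> b \<le> j then 1 else 0))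
       = (\<Sum>j\<in>{1..<q}. ?D j * ch j i)"
      by (subst sum.swap) (simp only: ch_def sum_distrib_left)
    finally have "W ?a * (\<Sum>b\<in>{0..<int q}. if (?a, b) \<in> inverse_pairs q then trunc_ratio (c ?a) (\<beta> b) else 0)
      = W ?a * (trunc_ratio (c ?a) q * ch q i + (\<Sum>j\<in>{1..<q}. ?D j * ch j i))" by simp
    moreover have "W ?a * (\<Sum>b\<in>{0..<int q}. if (?a, b) \<in> inverse_pairs q then trunc_ratio (c ?a) (\<beta> b) else 0)
      = (\<Sum>b\<in>{0..<int q}. if (?a, b) \<in> inverse_pairs q then W ?a * trunc_ratio (c ?a) (\<beta> b) else 0)"
      unfolding sum_distrib_left by (intro sum.cong refl) auto
    ultimately show "(\<Sum>b\<in>{0..<int q}. if (?a, b) \<in> inverse_pairs q then W ?a * trunc_ratio (c ?a) (\<beta> b) else 0)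
      = W ?a * (trunc_ratio (c ?a) q * ch q i + (\<Sum>j\<in>{1..<q}. ?D j * ch j i))" by simp
  qed
  finally have eq: "(\<Sum>(a, b)\<in>{(a, b) \<in> inverse_pairs q. y1 \<le> a \<and> a < y1 + int N}. W a * trunc_ratio (c a) (\<beta> b)) = \<dots>" .
  show ?thesis unfolding eq
    by (rule weighted_equidistribution[where c = "\<lambda>i. c (y1 + int i)" and W = "\<lambda>i. W (y1 + int i)"])
       (use q pre W M c in auto)
qed

definition monotone_fun_on :: "real set \<Rightarrow> (real \<Rightarrow> real) \<Rightarrow> bool" where
  "monotone_fun_on S F \<longleftrightarrow> (\<forall>x\<in>S. \<forall>y\<in>S. x \<le> y \<longrightarrow> F x \<le> F y) \<or> (\<forall>x\<in>S. \<forall>y\<in>S. x \<le> y \<longrightarrow> F y \<le> F x)"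

text \<open>
  Left Riemann sums err by at most the mesh times the variation, of which \<open>V\<close> is a majorant.
\<close>

lemma riemann_sum_variation:
  fixes f :: "real \<Rightarrow> real" and V :: "nat \<Rightarrow> real"
  assumes h: "h \<ge> 0" and int: "f integrable_on {\<alpha>..\<alpha> + real n * h}"
    and V: "\<And>i x. i < n \<Longrightarrow> \<alpha> + real i * h \<le> x \<Longrightarrow> x \<le> \<alpha> + real (Suc i) * h \<Longrightarrow>
       \<bar>f x - f (\<alpha> + real i * h)\<bar> \<le> V (Suc i) - V i"
  shows "\<bar>h * (\<Sum>i<n. f (\<alpha> + real i * h)) - integral {\<alpha>..\<alpha> + real n * h} f\<bar> \<le> h * (V n - V 0)"
  using int V
proof (induction n)
  case (Suc n)
  let ?a = "\<alpha> + real n * h" and ?b = "\<alpha> + real (Suc n) * h"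
  have ab: "\<alpha> \<le> ?a" "?a \<le> ?b" using h by (auto simp: algebra_simps)
  have i1: "f integrable_on {\<alpha>..?a}" and i2: "f integrable_on {?a..?b}"
    using Suc.prems(1) by (rule integrable_on_subinterval; use ab in auto)+
  have IH: "\<bar>h * (\<Sum>i<n. f (\<alpha> + real i * h)) - integral {\<alpha>..?a} f\<bar> \<le> h * (V n - V 0)"
    by (rule Suc.IH[OF i1]) (use Suc.prems(2) in auto)
  have "\<bar>integral {?a..?b} f - integral {?a..?b} (\<lambda>_. f ?a)\<bar> = \<bar>integral {?a..?b} (\<lambda>x. f x - f ?a)\<bar>"
    using i2 by (subst integral_diff) auto
  also have "\<dots> \<le> integral {?a..?b} (\<lambda>_. V (Suc n) - V n)"
    unfolding real_norm_def[symmetric]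
    by (rule integral_norm_bound_integral)
       (use i2 Suc.prems(2)[of n] in \<open>auto intro!: integrable_diff\<close>)
  also have "\<dots> = h * (V (Suc n) - V n)" using ab by (simp add: algebra_simps)
  also have "integral {?a..?b} (\<lambda>_. f ?a) = h * f ?a" using ab by (simp add: algebra_simps)
  finally have st: "\<bar>integral {?a..?b} f - h * f ?a\<bar> \<le> h * (V (Suc n) - V n)" .
  have comb: "integral {\<alpha>..?b} f = integral {\<alpha>..?a} f + integral {?a..?b} f"
    using Henstock_Kurzweil_Integration.integral_combine[OF ab Suc.prems(1)] by simp
  have "h * (\<Sum>i<Suc n. f (\<alpha> + real i * h)) = h * (\<Sum>i<n. f (\<alpha> + real i * h)) + h * f ?a"
    by (simp add: algebra_simps)
  moreover have "h * (V (Suc n) - V 0) = h * (V n - V 0) + h * (V (Suc n) - V n)"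
    by (simp add: algebra_simps)
  ultimately show ?case using IH st comb by linarith
qed simp

text \<open>
  A product of two bounded monotone functions has variation at most \<open>2 B B'\<close>.
\<close>

lemma riemann_sum_monotone_product:
  fixes F G :: "real \<Rightarrow> real"
  assumes h: "h \<ge> 0" and int: "(\<lambda>x. F x * G x) integrable_on {\<alpha>..\<alpha> + real n * h}"
    and F: "monotone_fun_on {\<alpha>..\<alpha> + real n * h} F" "\<And>x. x \<in> {\<alpha>..\<alpha> + real n * h} \<Longrightarrow> 0 \<le> F x \<and> F x \<le> B"
    and G: "monotone_fun_on {\<alpha>..\<alpha> + real n * h} G" "\<And>x. x \<in> {\<alpha>..\<alpha> + real n * h} \<Longrightarrow> 0 \<le> G x \<and> G x \<le> B'"
  shows "\<bar>h * (\<Sum>i<n. F (\<alpha> + real i * h) * G (\<alpha> + real i * h)) - integral {\<alpha>..\<alpha> + real n * h} (\<lambda>x. F x * G x)\<bar> \<le> 2 * h * B * B'"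
proof -
  let ?S = "{\<alpha>..\<alpha> + real n * h}"
  define p where "p i = \<alpha> + real i * h" for i
  have pS: "p i \<in> ?S" if "i \<le> n" for i using that h by (auto simp: p_def intro!: mult_right_mono)
  have sign: "\<exists>s. (s = 1 \<or> s = -1) \<and> (\<forall>x\<in>?S. \<forall>y\<in>?S. x \<le> y \<longrightarrow> s * H x \<le> s * H y)" if "monotone_fun_on ?S H" for H
  proof -
    from that consider "\<forall>x\<in>?S. \<forall>y\<in>?S. x \<le> y \<longrightarrow> H x \<le> H y" | "\<forall>x\<in>?S. \<forall>y\<in>?S. x \<le> y \<longrightarrow> H y \<le> H x"
      unfolding monotone_fun_on_def by blast
    then show ?thesis
    proof cases
      case 1 then show ?thesis by (intro exI[of _ 1]) simp
    next
      case 2 then show ?thesis by (intro exI[of _ "-1"]) simp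
    qed
  qed
  obtain s where s: "s = 1 \<or> s = -1" "\<And>x y. x \<in> ?S \<Longrightarrow> y \<in> ?S \<Longrightarrow> x \<le> y \<Longrightarrow> s * F x \<le> s * F y"
    using sign[OF F(1)] by blast
  obtain s' where s': "s' = 1 \<or> s' = -1" "\<And>x y. x \<in> ?S \<Longrightarrow> y \<in> ?S \<Longrightarrow> x \<le> y \<Longrightarrow> s' * G x \<le> s' * G y"
    using sign[OF G(1)] by blast
  define V where "V i = B' * (s * F (p i)) + B * (s' * G (p i))" for i
  have B: "0 \<le> B" "0 \<le> B'" using F(2)[of \<alpha>] G(2)[of \<alpha>] h by auto
  have "\<bar>h * (\<Sum>i<n. F (\<alpha> + real i * h) * G (\<alpha> + real i * h)) - integral ?S (\<lambda>x. F x * G x)\<bar> \<le> h * (V n - V 0)"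
  proof (rule riemann_sum_variation[OF h int])
    fix i x assume i: "i < n" and x: "\<alpha> + real i * h \<le> x" "x \<le> \<alpha> + real (Suc i) * h"
    have x': "p i \<le> x" "x \<le> p (Suc i)" using x by (auto simp: p_def)
    have m: "p i \<in> ?S" "p (Suc i) \<in> ?S" using pS i by auto
    then have xS: "x \<in> ?S" using x' by auto
    have 1: "\<bar>F x - F (p i)\<bar> \<le> s * F (p (Suc i)) - s * F (p i)"
      using s(2)[OF m(1) xS x'(1)] s(2)[OF xS m(2) x'(2)] s(1) by auto
    have 2: "\<bar>G x - G (p i)\<bar> \<le> s' * G (p (Suc i)) - s' * G (p i)"
      using s'(2)[OF m(1) xS x'(1)] s'(2)[OF xS m(2) x'(2)] s'(1) by auto
    have "F x * G x - F (p i) * G (p i) = G x * (F x - F (p i)) + F (p i) * (G x - G (p i))"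
      by (simp add: algebra_simps)
    also have "\<bar>\<dots>\<bar> \<le> B' * (s * F (p (Suc i)) - s * F (p i)) + B * (s' * G (p (Suc i)) - s' * G (p i))"
      by (intro order_trans[OF abs_triangle_ineq] add_mono; unfold abs_mult; intro mult_mono 1 2)
         (use F(2)[OF m(1)] G(2)[OF xS] B in auto)
    also have "\<dots> = V (Suc i) - V i" by (simp add: V_def algebra_simps)
    finally show "\<bar>F x * G x - F (\<alpha> + real i * h) * G (\<alpha> + real i * h)\<bar> \<le> V (Suc i) - V i" by (simp add: p_def)
  qed
  also have "\<dots> \<le> h * (2 * B * B')"
  proof (rule mult_left_mono[OF _ h])
    have n: "p n \<in> ?S" "p 0 \<in> ?S" using pS by auto
    have "s * F (p n) - s * F (p 0) \<le> B" "s' * G (p n) - s' * G (p 0) \<le> B'"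
      using F(2)[OF n(1)] F(2)[OF n(2)] G(2)[OF n(1)] G(2)[OF n(2)] s(1) s'(1) by auto
    then have "B' * (s * F (p n) - s * F (p 0)) + B * (s' * G (p n) - s' * G (p 0)) \<le> B' * B + B * B'"
      using B by (intro add_mono mult_left_mono) auto
    then show "V n - V 0 \<le> 2 * B * B'" by (simp add: V_def algebra_simps)
  qed
  finally show ?thesis by (simp add: mult_ac)
qed

lemma bounded_measurable_integrable_on:
  fixes f :: "real \<Rightarrow> real"
  assumes "f \<in> borel_measurable borel" "\<And>x. x \<in> {a..b} \<Longrightarrow> \<bar>f x\<bar> \<le> B"
  shows "set_integrable lborel {a..b} f" "f integrable_on {a..b}"
proof -
  show 1: "set_integrable lborel {a..b} f"
    unfolding set_integrable_def
  proof (rule integrableI_bounded_set_indicator[where B = B])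
    show "{a..b} \<in> sets lborel" by simp
    show "f \<in> borel_measurable lborel" using assms(1) by simp
    show "emeasure lborel {a..b} < \<infinity>" by (simp add: emeasure_lborel_Icc_eq)
    show "AE x in lborel. x \<in> {a..b} \<longrightarrow> norm (f x) \<le> B" using assms(2) by auto
  qed
  show "f integrable_on {a..b}" using set_borel_integral_eq_integral(1)[OF 1] .
qed

lemma integral_endpoint_change:
  fixes f :: "real \<Rightarrow> real"
  assumes int: "f integrable_on {0..1}" and f: "\<And>x. x \<in> {0..1} \<Longrightarrow> 0 \<le> f x \<and> f x \<le> B"
    and s: "0 \<le> s" "s \<le> s'" "s' \<le> 1" and t: "0 \<le> t" "t \<le> t'" "t' \<le> 1"
    and d: "\<bar>s - t\<bar> \<le> e" "\<bar>s' - t'\<bar> \<le> e"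
  shows "\<bar>integral {s..s'} f - integral {t..t'} f\<bar> \<le> 2 * e * B"
proof -
  define F where "F x = integral {0..x} f" for x
  have sub: "f integrable_on {x..y}" if "0 \<le> x" "y \<le> 1" for x y
    using int by (rule integrable_on_subinterval) (use that in auto)
  have F: "integral {x..y} f = F y - F x" if "0 \<le> x" "x \<le> y" "y \<le> 1" for x y
    using Henstock_Kurzweil_Integration.integral_combine[of 0 x y f] sub[of 0 y] that by (simp add: F_def)
  have B: "0 \<le> B" using f[of 0] by simp
  have lip: "\<bar>F y - F x\<bar> \<le> B * \<bar>y - x\<bar>" if "0 \<le> x" "x \<le> y" "y \<le> 1" for x y
  proof -
    have "0 \<le> integral {x..y} f" by (rule integral_nonneg[OF sub]) (use that f in auto)
    moreover have "integral {x..y} f \<le> integral {x..y} (\<lambda>_. B)" by (rule integral_le[OF sub]) (use that f in auto)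
    ultimately show ?thesis using that by (simp add: F mult.commute)
  qed
  have lip': "\<bar>F y - F x\<bar> \<le> B * e" if "0 \<le> x" "x \<le> 1" "0 \<le> y" "y \<le> 1" "\<bar>x - y\<bar> \<le> e" for x y
  proof -
    have "\<bar>F y - F x\<bar> \<le> B * \<bar>x - y\<bar>"
      using lip[of x y] lip[of y x] that by (cases "x \<le> y") (auto simp: abs_minus_commute)
    also have "\<dots> \<le> B * e" using that B by (intro mult_left_mono) auto
    finally show ?thesis .
  qed
  have "integral {s..s'} f - integral {t..t'} f = (F s' - F t') - (F s - F t)" using F[OF s] F[OF t] by simp
  moreover have "\<bar>F s' - F t'\<bar> \<le> B * e" "\<bar>F s - F t\<bar> \<le> B * e"
    using s t d by (auto intro!: lip' simp: abs_minus_commute)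
  ultimately show ?thesis by (simp add: mult_ac)
qed

section \<open>The lattice sum\<close>

text \<open>
  The limiting visible fraction of a disc at scaled distance \<open>x = \<epsilon> n\<close>, averaged over the parents.
  The value \<open>1\<close> for \<open>x \<le> 0\<close> makes the function decreasing on the whole line.
\<close>

definition profile :: "real \<Rightarrow> real" where
  "profile x = (if x \<le> 0 then 1 else trunc_mean (1 / x - 1))"

lemma profile_bounds: "0 \<le> profile x" "profile x \<le> 1"
  by (auto simp: profile_def trunc_mean_bounds)

lemma profile_antimono: "x \<le> y \<Longrightarrow> profile y \<le> profile x"
  using trunc_mean_bounds(2) by (auto simp: profile_def intro!: monoD[OF trunc_mean_mono] divide_left_mono)

lemma profile_eq_0: "x \<ge> 1 \<Longrightarrow> profile x = 0"
  by (simp add: profile_def trunc_mean_def)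

lemma profile_measurable [measurable]: "profile \<in> borel_measurable borel"
proof -
  have [measurable]: "trunc_mean \<in> borel_measurable borel" by (rule borel_measurable_mono[OF trunc_mean_mono])
  show ?thesis unfolding profile_def by measurable
qed

text \<open>
  For negative \<open>s\<close> each term is compared, by the mean value theorem, with the increment of
  \<open>x powr (s + 1) / (s + 1)\<close>.
\<close>

lemma sum_powr_le:
  fixes s :: real
  assumes s: "s > -1"
  shows "(\<Sum>q=1..N. real q powr s) \<le> max 1 (1 / (s + 1)) * real N powr (s + 1)"
proof (cases "s \<ge> 0")
  case True
  have "(\<Sum>q=1..N. real q powr s) \<le> (\<Sum>q=1..N. real N powr s)"
    by (intro sum_mono powr_mono2) (use True in auto)
  also have "\<dots> = real N powr (s + 1)" by (cases "N = 0") (auto simp: powr_add)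
  also have "\<dots> \<le> max 1 (1 / (s + 1)) * real N powr (s + 1)"
    using mult_right_mono[of 1 "max 1 (1 / (s + 1))" "real N powr (s + 1)"] by simp
  finally show ?thesis .
next
  case False
  define p where "p = s + 1"
  have p: "0 < p" "p < 1" using s False by (auto simp: p_def)
  have "(\<Sum>q=1..N. real q powr s) \<le> 1 / p * real N powr p"
  proof (induction N)
    case (Suc N)
    have "real (Suc N) powr s \<le> 1 / p * (real (Suc N) powr p - real N powr p)"
    proof (cases "N = 0")
      case True
      then show ?thesis using p by simp
    next
      case False
      have "\<exists>z>real N. z < real (Suc N) \<and> real (Suc N) powr p - real N powr p = (real (Suc N) - real N) * (p * z powr (p - 1))"
        by (rule MVT2) (use False p in \<open>auto intro!: derivative_eq_intros simp: powr_diff\<close>)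
      then obtain z where z: "real N < z" "z < real (Suc N)" "real (Suc N) powr p - real N powr p = p * z powr (p - 1)" by auto
      have "real (Suc N) powr (p - 1) \<le> z powr (p - 1)" using z p False by (intro powr_mono2') auto
      then show ?thesis using z p by (simp add: p_def)
    qed
    then show ?case using Suc.IH by (simp add: algebra_simps)
  qed simp
  also have "\<dots> \<le> max 1 (1 / p) * real N powr p" by (intro mult_right_mono) auto
  finally show ?thesis by (simp add: p_def)
qed

text \<open>
  The moment of order \<open>r\<close> of the density \<open>profile\<close>; the limiting density of the scaled free path is
  \<open>12 / \<pi>\<^sup>2\<close> times \<open>profile\<close>.
\<close>

definition free_path_moment :: "real \<Rightarrow> real" where
  "free_path_moment r = integral {0..1} (\<lambda>x. x powr r * profile x)"

lemma powr_profile_integrable: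
  assumes "r > 0" "0 \<le> b"
  shows "set_integrable lborel {0..b} (\<lambda>x. x powr r * profile x)" "(\<lambda>x. x powr r * profile x) integrable_on {0..b}"
proof -
  have "\<bar>x powr r * profile x\<bar> \<le> b powr r * 1" if "x \<in> {0..b}" for x
    unfolding abs_mult using that assms profile_bounds[of x] by (intro mult_mono) (auto intro!: powr_mono2)
  then show "set_integrable lborel {0..b} (\<lambda>x. x powr r * profile x)" "(\<lambda>x. x powr r * profile x) integrable_on {0..b}"
    by (intro bounded_measurable_integrable_on[where B = "b powr r * 1"]; simp)+
qed

text \<open>
  Summation by parts replaces \<open>\<phi>(q) / q\<close> by its mean, because \<open>x powr r * profile x\<close> is a product of
  an increasing and a decreasing function; what remains is a Riemann sum of mesh \<open>\<eta>\<close>, which covers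
  the support \<open>{0..1}\<close> of the profile.
\<close>

lemma sum_totient_profile:
  fixes \<eta> r :: real and N :: nat
  assumes r: "r > 0" and \<eta>: "0 < \<eta>" and N: "1 \<le> \<eta> * real N" "\<eta> * real N \<le> 4"
  shows "\<bar>(\<Sum>q=1..N. real (totient q) / real q * (\<eta> * ((\<eta> * real q) powr r * profile (\<eta> * real q))))
     - 6 / pi\<^sup>2 * free_path_moment r\<bar> \<le> 14 * 4 powr r * (\<eta> * (1 + ln (real N)))"
proof -
  have N1: "N \<ge> 1" using N(1) by (cases N) auto
  define L where "L = 1 + ln (real N)"
  have L: "L \<ge> 1" using N1 by (simp add: L_def)
  define f where "f x = x powr r * profile x" for x :: real
  define x where "x i = real (totient (Suc i)) / real (Suc i) - 6 / pi\<^sup>2" for i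
  have pref: "\<bar>\<Sum>i<n. x i\<bar> \<le> 3 * L" if "n \<le> N" for n
  proof (cases "n = 0")
    case False
    have "(\<Sum>i<n. x i) = (\<Sum>q=1..n. real (totient q) / real q) - 6 / pi\<^sup>2 * real n"
    proof -
      have "(\<Sum>i<n. real (totient (Suc i)) / real (Suc i)) = (\<Sum>q=1..n. real (totient q) / real q)"
        by (rule sum.reindex_bij_witness[of _ "\<lambda>q. q - 1" Suc]) auto
      then show ?thesis by (simp add: x_def sum_subtractf)
    qed
    then have "\<bar>\<Sum>i<n. x i\<bar> \<le> 3 * (1 + ln (real n))" using sum_totient_over[of n] False by simp
    also have "\<dots> \<le> 3 * L" using that False by (simp add: L_def)
    finally show ?thesis .
  qed (use L in simp)
  have pos: "0 \<le> \<eta> * real (Suc i)" "\<eta> * real (Suc i) \<le> 4" if "i < N" for i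
  proof -
    have "\<eta> * real (Suc i) \<le> \<eta> * real N" using that \<eta> by (intro mult_left_mono) auto
    then show "\<eta> * real (Suc i) \<le> 4" using N by simp
  qed (use \<eta> in auto)
  have a1: "\<bar>\<Sum>i<n. (\<eta> * real (Suc i)) powr r * x i\<bar> \<le> 2 * 4 powr r * (3 * L)" if "n \<le> N" for n
  proof (rule abel_monotone[OF pref _ _ _ that])
    show "monotone_seq N (\<lambda>i. (\<eta> * real (Suc i)) powr r)"
      unfolding monotone_seq_def using \<eta> r by (intro disjI1) (auto intro!: powr_mono2 mult_left_mono)
  qed (use r pos in \<open>auto intro!: powr_mono2\<close>)
  have a2: "\<bar>\<Sum>i<N. profile (\<eta> * real (Suc i)) * ((\<eta> * real (Suc i)) powr r * x i)\<bar> \<le> 2 * 1 * (2 * 4 powr r * (3 * L))"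
  proof (rule abel_monotone[OF a1])
    show "monotone_seq N (\<lambda>i. profile (\<eta> * real (Suc i)))"
      unfolding monotone_seq_def using \<eta> by (intro disjI2) (auto intro!: profile_antimono mult_left_mono)
  qed (auto simp: profile_bounds)
  have int: "f integrable_on {0..0 + real N * \<eta>}"
    unfolding f_def using powr_profile_integrable(2)[OF r] \<eta> by simp
  have riem: "\<bar>\<eta> * (\<Sum>i<N. (0 + real i * \<eta>) powr r * profile (0 + real i * \<eta>)) - integral {0..0 + real N * \<eta>} (\<lambda>x. x powr r * profile x)\<bar>
     \<le> 2 * \<eta> * 4 powr r * 1"
  proof (rule riemann_sum_monotone_product)
    show "(\<lambda>x. x powr r * profile x) integrable_on {0..0 + real N * \<eta>}" using int unfolding f_def[abs_def] by simp
    show "monotone_fun_on {0..0 + real N * \<eta>} (\<lambda>x. x powr r)"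
      unfolding monotone_fun_on_def using r by (intro disjI1) (auto intro!: powr_mono2)
    show "monotone_fun_on {0..0 + real N * \<eta>} profile"
      unfolding monotone_fun_on_def by (intro disjI2) (auto intro!: profile_antimono)
    show "0 \<le> x powr r \<and> x powr r \<le> 4 powr r" if "x \<in> {0..0 + real N * \<eta>}" for x
      using that r N by (auto intro!: powr_mono2 simp: mult.commute)
  qed (use \<eta> in \<open>auto simp: profile_bounds\<close>)
  have "integral {0..real N * \<eta>} f = integral {0..1} f + integral {1..real N * \<eta>} f"
    by (rule Henstock_Kurzweil_Integration.integral_combine[symmetric])
       (use N int in \<open>auto simp: mult.commute\<close>)
  also have "integral {1..real N * \<eta>} f = integral {1..real N * \<eta>} (\<lambda>_. 0)"
    by (rule integral_cong) (simp add: f_def profile_eq_0)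
  finally have intN: "integral {0..0 + real N * \<eta>} (\<lambda>x. x powr r * profile x) = free_path_moment r"
    by (simp add: f_def[abs_def] free_path_moment_def)
  have shift: "(\<Sum>i<N. f (0 + real i * \<eta>)) = (\<Sum>q=1..N. f (\<eta> * real q))"
  proof -
    have "(\<Sum>i<N. f (\<eta> * real i)) + f (\<eta> * real N) = f (\<eta> * real 0) + (\<Sum>i<N. f (\<eta> * real (Suc i)))"
      using sum.lessThan_Suc[of "\<lambda>i. f (\<eta> * real i)" N] sum.lessThan_Suc_shift[of "\<lambda>i. f (\<eta> * real i)" N] by simp
    moreover have "f (\<eta> * real N) = 0" using N by (simp add: f_def profile_eq_0)
    moreover have "f (\<eta> * real 0) = 0" by (simp add: f_def)
    moreover have "(\<Sum>i<N. f (\<eta> * real (Suc i))) = (\<Sum>q=1..N. f (\<eta> * real q))"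
      by (rule sum.reindex_bij_witness[of _ "\<lambda>q. q - 1" Suc]) auto
    ultimately show ?thesis by (simp add: mult.commute)
  qed
  have R: "\<bar>\<eta> * (\<Sum>q=1..N. f (\<eta> * real q)) - free_path_moment r\<bar> \<le> 2 * \<eta> * 4 powr r"
    using riem unfolding intN shift[symmetric] by (simp add: f_def)
  have split: "(\<Sum>q=1..N. real (totient q) / real q * (\<eta> * f (\<eta> * real q)))
     = \<eta> * (\<Sum>i<N. profile (\<eta> * real (Suc i)) * ((\<eta> * real (Suc i)) powr r * x i)) + 6 / pi\<^sup>2 * (\<eta> * (\<Sum>q=1..N. f (\<eta> * real q)))"
  proof -
    have "(\<Sum>i<N. profile (\<eta> * real (Suc i)) * ((\<eta> * real (Suc i)) powr r * x i))
        = (\<Sum>q=1..N. f (\<eta> * real q) * (real (totient q) / real q - 6 / pi\<^sup>2))"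
      by (rule sum.reindex_bij_witness[of _ "\<lambda>q. q - 1" Suc]) (auto simp: x_def f_def)
    then show ?thesis by (simp add: sum_distrib_left algebra_simps flip: sum.distrib)
  qed
  have "\<bar>(\<Sum>q=1..N. real (totient q) / real q * (\<eta> * f (\<eta> * real q))) - 6 / pi\<^sup>2 * free_path_moment r\<bar>
     = \<bar>\<eta> * (\<Sum>i<N. profile (\<eta> * real (Suc i)) * ((\<eta> * real (Suc i)) powr r * x i))
       + 6 / pi\<^sup>2 * (\<eta> * (\<Sum>q=1..N. f (\<eta> * real q)) - free_path_moment r)\<bar>"
    unfolding split by (simp add: algebra_simps)
  also have "\<dots> \<le> \<eta> * (12 * 4 powr r * L) + 1 * (2 * \<eta> * 4 powr r)"
    by (intro order_trans[OF abs_triangle_ineq] add_mono; unfold abs_mult; intro mult_mono)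
       (use a2 R \<eta> six_over_pi_squared_le L in auto)
  also have "\<dots> = 12 * (4 powr r * \<eta> * L) + 2 * (4 powr r * \<eta> * 1)" by simp
  also have "\<dots> \<le> 12 * (4 powr r * \<eta> * L) + 2 * (4 powr r * \<eta> * L)"
    using \<eta> L by (intro add_mono mult_left_mono) auto
  finally show ?thesis by (simp add: f_def L_def mult_ac)
qed

text \<open>
  To leading order, the moment carried by the directions that first hit \<open>(q, a)\<close>, where \<open>b\<close> is the
  inverse of \<open>a\<close> modulo \<open>q\<close>: the scaled path \<open>\<epsilon> n\<close> to the power \<open>r\<close> times the two visible half arcs
  \<open>\<epsilon> / n * trunc_ratio c _\<close>.
\<close>

definition lattice_term :: "real \<Rightarrow> real \<Rightarrow> nat \<Rightarrow> int \<Rightarrow> int \<Rightarrow> real" where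
  "lattice_term \<epsilon> r q a b = (let n = sqrt (real q ^ 2 + of_int a ^ 2); c = real q / (\<epsilon> * n) - real q in
     \<epsilon>\<^sup>2 * (\<epsilon> * n) powr (r - 1) * (trunc_ratio c (of_int b) + trunc_ratio c (real q - of_int b)))"

lemma abs_diff_chain:
  fixes x1 x2 a b i e m k :: real
  assumes "\<bar>x1 - a\<bar> \<le> e" "\<bar>x2 - a\<bar> \<le> e" "\<bar>a - b\<bar> \<le> m" "\<bar>b - i\<bar> \<le> k"
  shows "\<bar>x1 + x2 - 2 * i\<bar> \<le> 2 * (e + m + k)"
proof (rule abs_leI)
  show "x1 + x2 - 2 * i \<le> 2 * (e + m + k)" using assms[THEN abs_le_D1] by argo
  show "- (x1 + x2 - 2 * i) \<le> 2 * (e + m + k)" using assms[THEN abs_le_D2] by argo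
qed

text \<open>
  For fixed \<open>q\<close>, equidistribution replaces the sum over inverse pairs by an average over all \<open>b\<close>
  and all \<open>a\<close>, the average over \<open>b\<close> is \<open>profile (\<epsilon> n)\<close>, and the sum over \<open>a\<close> is a Riemann sum in
  \<open>t = a / q\<close>. The weights are monotone in \<open>t\<close> since \<open>\<epsilon> n = \<epsilon> q * sqrt (1 + t\<^sup>2)\<close> is.
\<close>

lemma lattice_terms_row:
  fixes \<epsilon> r t1 t2 :: real and q :: nat
  assumes \<epsilon>: "\<epsilon> > 0" and q: "q \<ge> 2" and t: "0 \<le> t1" "t1 \<le> t2" "t2 \<le> 1"
    and E: "\<And>a b c d. \<lbrakk>0 \<le> a; b \<le> int q; 0 \<le> c; d \<le> int q\<rbrakk> \<Longrightarrow>
      inverse_box_discrepancy q a b c d \<le> E"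
  defines "f \<equiv> \<lambda>t. (\<epsilon> * real q * sqrt (1 + t\<^sup>2)) powr (r - 1) * profile (\<epsilon> * real q * sqrt (1 + t\<^sup>2))"
  shows "f integrable_on {t1..t2}"
    "\<bar>(\<Sum>(a, b)\<in>{(a, b) \<in> inverse_pairs q. t1 \<le> of_int a / real q \<and> of_int a / real q \<le> t2}. lattice_term \<epsilon> r q a b)
      - 2 * \<epsilon>\<^sup>2 * real (totient q) * integral {t1..t2} f\<bar>
    \<le> \<epsilon>\<^sup>2 * (2 powr \<bar>r - 1\<bar> * (\<epsilon> * real q) powr (r - 1)) * (24 * E * (1 + ln (real q)) + 10)"
proof -
  have q0: "real q > 0" using q by simp
  define n where "n a = sqrt (real q ^ 2 + of_int a ^ 2)" for a :: int
  define c where "c a = real q / (\<epsilon> * n a) - real q" for a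
  define u where "u t = \<epsilon> * real q * sqrt (1 + t\<^sup>2)" for t
  define W where "W a = (\<epsilon> * n a) powr (r - 1)" for a
  define M where "M = 2 powr \<bar>r - 1\<bar> * (\<epsilon> * real q) powr (r - 1)"
  define \<rho> where "\<rho> = real (totient q) / real q ^ 2"
  have M0: "M \<ge> 0" by (simp add: M_def)
  have u_pos: "u t > 0" for t using \<epsilon> q0 by (simp add: u_def add_pos_nonneg)
  have u_mono: "0 \<le> t \<Longrightarrow> t \<le> t' \<Longrightarrow> u t \<le> u t'" for t t'
    unfolding u_def using \<epsilon> q0 by (intro mult_left_mono real_sqrt_le_mono add_left_mono power_mono) auto
  have u_lo: "\<epsilon> * real q \<le> u t" for t
    using mult_left_mono[of 1 "sqrt (1 + t\<^sup>2)" "\<epsilon> * real q"] \<epsilon> q0 by (simp add: u_def)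
  have u_hi: "u t \<le> 2 * (\<epsilon> * real q)" if "0 \<le> t" "t \<le> 1" for t
  proof -
    have "t\<^sup>2 \<le> 1" using that by (simp add: power_le_one)
    then have "sqrt (1 + t\<^sup>2) \<le> sqrt 4" by (intro real_sqrt_le_mono) simp
    then show ?thesis using mult_left_mono[of "sqrt (1 + t\<^sup>2)" 2 "\<epsilon> * real q"] \<epsilon> q0 by (simp add: u_def)
  qed
  \<comment> \<open>\<open>u t\<close> is the scaled length \<open>\<epsilon> n\<close> as a function of the slope\<close>
  have u_n: "u (of_int a / real q) = \<epsilon> * n a" for a
  proof -
    have "real q * sqrt (1 + (of_int a / real q)\<^sup>2) = sqrt (real q ^ 2 * (1 + (of_int a / real q)\<^sup>2))"
      by (simp add: real_sqrt_mult)
    also have "real q ^ 2 * (1 + (of_int a / real q)\<^sup>2) = real q ^ 2 + of_int a ^ 2"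
      using q0 by (simp add: field_simps)
    finally show ?thesis by (simp add: u_def n_def)
  qed
  have powM: "0 \<le> (u t) powr (r - 1) \<and> (u t) powr (r - 1) \<le> M" if "0 \<le> t" "t \<le> 1" for t
  proof (cases "r \<ge> 1")
    case True
    have "(u t) powr (r - 1) \<le> (2 * (\<epsilon> * real q)) powr (r - 1)"
      using True u_hi[OF that] u_pos[of t] by (intro powr_mono2) auto
    also have "\<dots> = M" using True \<epsilon> q0 by (simp add: M_def powr_mult)
    finally show ?thesis by simp
  next
    case False
    have "(u t) powr (r - 1) \<le> (\<epsilon> * real q) powr (r - 1)"
      using False u_lo[of t] \<epsilon> q0 by (intro powr_mono2') auto
    also have "\<dots> \<le> M" unfolding M_def
      using mult_right_mono[of 1 "2 powr \<bar>r - 1\<bar>" "(\<epsilon> * real q) powr (r - 1)"] by (simp add: ge_one_powr_ge_zero)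
    finally show ?thesis by simp
  qed
  have F_mono: "monotone_fun_on {0..1} (\<lambda>t. u t powr (r - 1))"
  proof (cases "r \<ge> 1")
    case True
    then show ?thesis unfolding monotone_fun_on_def
      using u_mono u_pos by (intro disjI1 ballI impI powr_mono2) (auto intro: less_imp_le)
  next
    case False
    then show ?thesis unfolding monotone_fun_on_def
      using u_mono u_pos by (intro disjI2 ballI impI powr_mono2') auto
  qed
  have G_mono: "monotone_fun_on {0..1} (\<lambda>t. profile (u t))"
    unfolding monotone_fun_on_def using u_mono by (intro disjI2 ballI impI profile_antimono) auto
  have fF: "f = (\<lambda>t. u t powr (r - 1) * profile (u t))" by (simp add: f_def u_def)
  have fM: "0 \<le> f t \<and> f t \<le> M" if "t \<in> {0..1}" for t
    using powM[of t] profile_bounds[of "u t"] that mult_mono[of "u t powr (r - 1)" M "profile (u t)" 1] M0 by (simp add: fF)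
  have int01: "f integrable_on {0..1}"
  proof (rule bounded_measurable_integrable_on(2))
    have [measurable]: "u \<in> borel_measurable borel" unfolding u_def by measurable
    show "f \<in> borel_measurable borel" unfolding fF by measurable
    show "\<bar>f x\<bar> \<le> M" if "x \<in> {0..1}" for x using fM[OF that] by simp
  qed
  show "f integrable_on {t1..t2}" using int01 by (rule integrable_on_subinterval) (use t in auto)
  \<comment> \<open>the admissible \<open>a\<close> are the integers of \<open>{y1..<y2}\<close>; the cap at \<open>q\<close> keeps them residues\<close>
  define y1 where "y1 = \<lceil>real q * t1\<rceil>"
  define y2 where "y2 = min (\<lfloor>real q * t2\<rfloor> + 1) (int q)"
  have y1: "0 \<le> y1" "real q * t1 \<le> of_int y1" "of_int y1 < real q * t1 + 1"
  proof -
    have "real q * t1 \<ge> 0" using t q0 by simp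
    then show "0 \<le> y1" "real q * t1 \<le> of_int y1" "of_int y1 < real q * t1 + 1"
      unfolding y1_def by linarith+
  qed
  have y12: "y1 \<le> y2"
  proof -
    have qt: "real q * t1 \<le> real q * t2" "real q * t1 \<le> real q * 1" using t q0 by (auto intro!: mult_left_mono)
    then have "y1 \<le> int q" unfolding y1_def by (simp add: ceiling_le_iff)
    moreover have "y1 \<le> \<lfloor>real q * t2\<rfloor> + 1" unfolding y1_def using qt(1) by linarith
    ultimately show ?thesis by (simp add: y2_def)
  qed
  have y2: "y2 \<le> int q" "of_int y2 \<le> real q * t2 + 1" "real q * t2 \<le> of_int y2"
  proof -
    show "y2 \<le> int q" by (simp add: y2_def)
    show "of_int y2 \<le> real q * t2 + 1" unfolding y2_def by linarith
    have "real q * t2 \<le> real q * 1" using t q0 by (intro mult_left_mono) auto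
    then show "real q * t2 \<le> of_int y2" unfolding y2_def by linarith
  qed
  define N where "N = nat (y2 - y1)"
  have N: "y1 + int N = y2" using y12 by (simp add: N_def)
  have NQ: "real N \<le> real q" using N y1 y2 by linarith
  have set_eq: "{(a, b) \<in> inverse_pairs q. t1 \<le> of_int a / real q \<and> of_int a / real q \<le> t2}
     = {(a, b) \<in> inverse_pairs q. y1 \<le> a \<and> a < y1 + int N}"
  proof -
    have "(t1 \<le> of_int a / real q \<and> of_int a / real q \<le> t2) \<longleftrightarrow> (y1 \<le> a \<and> a < y2)" if "(a, b) \<in> inverse_pairs q" for a b
    proof -
      have a: "a < int q" using that by (simp add: inverse_pairs_def)
      have "t1 \<le> of_int a / real q \<longleftrightarrow> y1 \<le> a" unfolding y1_def
        using q0 by (simp add: ceiling_le_iff pos_le_divide_eq mult.commute)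
      moreover have "of_int a / real q \<le> t2 \<longleftrightarrow> a \<le> \<lfloor>real q * t2\<rfloor>"
        using q0 by (simp add: le_floor_iff pos_divide_le_eq mult.commute)
      ultimately show ?thesis using a by (auto simp: y2_def)
    qed
    then show ?thesis unfolding N by auto
  qed
  have t_range: "0 \<le> of_int (y1 + int i) / real q" "of_int (y1 + int i) / real q \<le> 1" if "i \<le> N" for i
  proof -
    have "y1 + int i \<le> int q" using that N y2 by simp
    then have "of_int (y1 + int i) \<le> real q" by linarith
    then show "of_int (y1 + int i) / real q \<le> 1" using q0 by (simp only: divide_le_eq_1_pos)
    show "0 \<le> of_int (y1 + int i) / real q" using y1 q0 by simp
  qed
  have n_mono: "\<epsilon> * n (y1 + int i) \<le> \<epsilon> * n (y1 + int j)" if "i \<le> j" "j < N" for i j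
    unfolding u_n[symmetric] using t_range[of i] q0 that by (intro u_mono divide_right_mono) auto
  have n_pos: "\<epsilon> * n a > 0" for a using u_pos[of "of_int a / real q"] by (simp add: u_n)
  have W_u: "W a = u (of_int a / real q) powr (r - 1)" for a by (simp add: W_def u_n)
  have W_mono: "monotone_seq N (\<lambda>i. W (y1 + int i))"
  proof -
    have le: "of_int (y1 + int i) / real q \<le> (of_int (y1 + int j) / real q :: real)" if "i \<le> j" for i j
      using that q0 by (intro divide_right_mono) auto
    show ?thesis using F_mono unfolding monotone_fun_on_def monotone_seq_def W_u
      using t_range le by (meson atLeastAtMost_iff le_trans less_imp_le_nat)
  qed
  have W_bd: "0 \<le> W (y1 + int i) \<and> W (y1 + int i) \<le> M" if "i < N" for i
    unfolding W_u using powM t_range[of i] that by simp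
  have c_mono: "c (y1 + int j) \<le> c (y1 + int i)" if "i \<le> j" "j < N" for i j
    unfolding c_def
  proof (rule diff_right_mono, rule divide_left_mono)
    show "0 < \<epsilon> * n (y1 + int j) * (\<epsilon> * n (y1 + int i))" by (intro mult_pos_pos n_pos)
  qed (use n_mono[OF that] q0 in auto)
  define S where "S = (\<Sum>i<N. W (y1 + int i) * (\<Sum>b=1..q. trunc_ratio (c (y1 + int i)) b))"
  have b_range: "1 \<le> y \<and> y < int q" if "(x, y) \<in> inverse_pairs q" for x y
  proof -
    have "0 \<le> y" "y < int q" "[x * y = 1] (mod int q)" using that by (auto simp: inverse_pairs_def)
    moreover have "y \<noteq> 0" using calculation(3) q by (auto simp: cong_def)
    ultimately show ?thesis by simp
  qed
  have eq1: "\<bar>(\<Sum>(a, b)\<in>{(a, b) \<in> inverse_pairs q. y1 \<le> a \<and> a < y1 + int N}. W a * trunc_ratio (c a) (nat b)) - \<rho> * S\<bar>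
     \<le> 12 * M * E * (1 + ln (real q))"
    unfolding \<rho>_def S_def
  proof (rule inverse_pairs_weighted_sum[where W = W and c = c and \<beta> = nat, OF q y1(1) _ E _ _ W_mono W_bd M0 c_mono])
    show "y1 + int N \<le> int q" using N y2 by simp
    show "1 \<le> nat y \<and> nat y \<le> q" if "(x, y) \<in> inverse_pairs q" for x y using b_range[OF that] by auto
    fix j assume j: "j \<in> {1..q}"
    show "\<exists>c d. 0 \<le> c \<and> d \<le> int q \<and> card {c..<d} = j \<and> (\<forall>x y. (x, y) \<in> inverse_pairs q \<longrightarrow> (nat y \<le> j) = (y \<in> {c..<d}))"
    proof (cases "j = q")
      case True
      show ?thesis by (rule exI[of _ 0], rule exI[of _ "int q"]) (use True b_range in \<open>force simp: nat_le_iff\<close>)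
    next
      case False
      show ?thesis by (rule exI[of _ 1], rule exI[of _ "int j + 1"]) (use False b_range j in \<open>force simp: nat_le_iff\<close>)
    qed
  qed
  have eq2: "\<bar>(\<Sum>(a, b)\<in>{(a, b) \<in> inverse_pairs q. y1 \<le> a \<and> a < y1 + int N}. W a * trunc_ratio (c a) (nat (int q - b))) - \<rho> * S\<bar>
     \<le> 12 * M * E * (1 + ln (real q))"
    unfolding \<rho>_def S_def
  proof (rule inverse_pairs_weighted_sum[where W = W and c = c and \<beta> = "\<lambda>b. nat (int q - b)", OF q y1(1) _ E _ _ W_mono W_bd M0 c_mono])
    show "y1 + int N \<le> int q" using N y2 by simp
    show "1 \<le> nat (int q - y) \<and> nat (int q - y) \<le> q" if "(x, y) \<in> inverse_pairs q" for x y using b_range[OF that] by auto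
    fix j assume j: "j \<in> {1..q}"
    show "\<exists>c d. 0 \<le> c \<and> d \<le> int q \<and> card {c..<d} = j \<and> (\<forall>x y. (x, y) \<in> inverse_pairs q \<longrightarrow> (nat (int q - y) \<le> j) = (y \<in> {c..<d}))"
      by (rule exI[of _ "int q - int j"], rule exI[of _ "int q"]) (use b_range j in \<open>force simp: nat_le_iff\<close>)
  qed
  have row: "(\<Sum>(a, b)\<in>{(a, b) \<in> inverse_pairs q. t1 \<le> of_int a / real q \<and> of_int a / real q \<le> t2}. lattice_term \<epsilon> r q a b)
    = \<epsilon>\<^sup>2 * ((\<Sum>(a, b)\<in>{(a, b) \<in> inverse_pairs q. y1 \<le> a \<and> a < y1 + int N}. W a * trunc_ratio (c a) (nat b))
       + (\<Sum>(a, b)\<in>{(a, b) \<in> inverse_pairs q. y1 \<le> a \<and> a < y1 + int N}. W a * trunc_ratio (c a) (nat (int q - b))))"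
    unfolding set_eq sum.distrib[symmetric] sum_distrib_left
  proof (rule sum.cong[OF refl])
    fix p assume p: "p \<in> {(a, b) \<in> inverse_pairs q. y1 \<le> a \<and> a < y1 + int N}"
    obtain a b where ab: "p = (a, b)" by (cases p)
    have b: "1 \<le> b" "b < int q" using b_range p ab by auto
    then have "real (nat b) = of_int b" "real (nat (int q - b)) = real q - of_int b" by auto
    then show "(case p of (a, b) \<Rightarrow> lattice_term \<epsilon> r q a b) = \<epsilon>\<^sup>2 * ((case p of (a, b) \<Rightarrow> W a * trunc_ratio (c a) (nat b)) + (case p of (a, b) \<Rightarrow> W a * trunc_ratio (c a) (nat (int q - b))))"
      unfolding ab prod.case by (simp add: lattice_term_def Let_def W_def c_def n_def algebra_simps)
  qed
  have tq: "real (totient q) \<le> real q" by (simp add: totient_le)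
  have \<rho>: "0 \<le> \<rho>" "\<rho> * real q \<le> 1" using tq q0 by (auto simp: \<rho>_def power2_eq_square divide_le_eq)
  have eq3: "\<bar>\<rho> * S - \<rho> * (real q * (\<Sum>i<N. f (of_int (y1 + int i) / real q)))\<bar> \<le> M"
  proof -
    have cq: "trunc_mean (c a / real q) = profile (u (of_int a / real q))" for a
    proof -
      have "c a / real q = 1 / (\<epsilon> * n a) - 1" using q0 by (simp add: c_def diff_divide_distrib)
      then show ?thesis using n_pos[of a] by (simp add: profile_def u_n)
    qed
    have "S - real q * (\<Sum>i<N. f (of_int (y1 + int i) / real q))
       = (\<Sum>i<N. W (y1 + int i) * ((\<Sum>b=1..q. trunc_ratio (c (y1 + int i)) b) - real q * trunc_mean (c (y1 + int i) / real q)))"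
      unfolding S_def fF cq by (simp add: sum_distrib_left sum_subtractf[symmetric] W_u algebra_simps)
    also have "\<bar>\<dots>\<bar> \<le> (\<Sum>i<N. M * 1)"
    proof (rule order_trans[OF sum_abs], rule sum_mono)
      fix i assume i: "i \<in> {..<N}"
      have "\<bar>(\<Sum>b=1..q. trunc_ratio (c (y1 + int i)) b) - real q * trunc_mean (c (y1 + int i) / real q)\<bar> \<le> 1"
        by (rule sum_trunc_ratio) (use q in simp)
      then show "\<bar>W (y1 + int i) * ((\<Sum>b=1..q. trunc_ratio (c (y1 + int i)) b) - real q * trunc_mean (c (y1 + int i) / real q))\<bar> \<le> M * 1"
        unfolding abs_mult using W_bd[of i] i by (intro mult_mono) auto
    qed
    also have "\<dots> \<le> real q * M" using NQ M0 by (simp add: mult_right_mono)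
    finally have "\<rho> * \<bar>S - real q * (\<Sum>i<N. f (of_int (y1 + int i) / real q))\<bar> \<le> \<rho> * (real q * M)"
      using \<rho> by (intro mult_left_mono) auto
    also have "\<dots> \<le> 1 * M" unfolding mult.assoc[symmetric] using \<rho> M0 by (intro mult_right_mono) auto
    finally show ?thesis using \<rho>(1) by (simp add: right_diff_distrib[symmetric] abs_mult)
  qed
  have eq4: "\<bar>(1 / real q) * (\<Sum>i<N. f (of_int (y1 + int i) / real q)) - integral {t1..t2} f\<bar> \<le> 4 * M / real q"
  proof -
    define \<alpha> where "\<alpha> = of_int y1 / real q"
    have pt: "of_int (y1 + int i) / real q = \<alpha> + real i * (1 / real q)" for i by (simp add: \<alpha>_def add_divide_distrib)
    have range: "{\<alpha>..\<alpha> + real N * (1 / real q)} \<subseteq> {0..1}"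
      using t_range[of 0] t_range[of N] by (auto simp: \<alpha>_def add_divide_distrib)
    have sub: "f integrable_on {\<alpha>..\<alpha> + real N * (1 / real q)}" by (rule integrable_on_subinterval[OF int01 range])
    have "\<bar>(1 / real q) * (\<Sum>i<N. u (\<alpha> + real i * (1 / real q)) powr (r - 1) * profile (u (\<alpha> + real i * (1 / real q))))
       - integral {\<alpha>..\<alpha> + real N * (1 / real q)} (\<lambda>t. u t powr (r - 1) * profile (u t))\<bar> \<le> 2 * (1 / real q) * M * 1"
    proof (rule riemann_sum_monotone_product)
      show "(\<lambda>t. u t powr (r - 1) * profile (u t)) integrable_on {\<alpha>..\<alpha> + real N * (1 / real q)}" using sub by (simp add: fF)
      show "monotone_fun_on {\<alpha>..\<alpha> + real N * (1 / real q)} (\<lambda>t. u t powr (r - 1))"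
        "monotone_fun_on {\<alpha>..\<alpha> + real N * (1 / real q)} (\<lambda>t. profile (u t))"
        using F_mono G_mono range unfolding monotone_fun_on_def by (meson subsetD)+
      show "0 \<le> u x powr (r - 1) \<and> u x powr (r - 1) \<le> M" if "x \<in> {\<alpha>..\<alpha> + real N * (1 / real q)}" for x
        using powM[of x] that range by (meson atLeastAtMost_iff subsetD)
    qed (auto simp: profile_bounds)
    then have "\<bar>(1 / real q) * (\<Sum>i<N. f (of_int (y1 + int i) / real q)) - integral {\<alpha>..\<alpha> + real N * (1 / real q)} f\<bar> \<le> 2 * (1 / real q) * M"
      unfolding pt fF by simp
    moreover have "\<bar>integral {\<alpha>..\<alpha> + real N * (1 / real q)} f - integral {t1..t2} f\<bar> \<le> 2 * (1 / real q) * M"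
    proof (rule integral_endpoint_change[OF int01 fM])
      have end_eq: "\<alpha> + real N * (1 / real q) = of_int y2 / real q" using N pt[of N] by simp
      show "0 \<le> \<alpha>" "\<alpha> \<le> \<alpha> + real N * (1 / real q)" using t_range[of 0] by (auto simp: \<alpha>_def)
      show "\<alpha> + real N * (1 / real q) \<le> 1" using t_range[of N] pt[of N] by simp
      have "\<bar>of_int y1 - real q * t1\<bar> \<le> 1" "\<bar>of_int y2 - real q * t2\<bar> \<le> 1" using y1 y2 by auto
      moreover have "\<alpha> - t1 = (of_int y1 - real q * t1) / real q" "of_int y2 / real q - t2 = (of_int y2 - real q * t2) / real q"
        using q0 by (auto simp: \<alpha>_def field_simps)
      ultimately show "\<bar>\<alpha> - t1\<bar> \<le> 1 / real q" "\<bar>\<alpha> + real N * (1 / real q) - t2\<bar> \<le> 1 / real q"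
        unfolding end_eq using q0 by (auto simp: abs_divide divide_right_mono)
    qed (use t in auto)
    ultimately have "\<bar>(1 / real q) * (\<Sum>i<N. f (of_int (y1 + int i) / real q)) - integral {t1..t2} f\<bar>
       \<le> 2 * (1 / real q) * M + 2 * (1 / real q) * M" by (rule abs_diff_triangle)
    also have "\<dots> = 4 * M / real q" by simp
    finally show ?thesis .
  qed
  have eq5: "\<bar>\<rho> * (real q * (\<Sum>i<N. f (of_int (y1 + int i) / real q))) - real (totient q) * integral {t1..t2} f\<bar> \<le> 4 * M"
  proof -
    have "\<rho> * (real q * (\<Sum>i<N. f (of_int (y1 + int i) / real q))) - real (totient q) * integral {t1..t2} f
      = real (totient q) * ((1 / real q) * (\<Sum>i<N. f (of_int (y1 + int i) / real q)) - integral {t1..t2} f)"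
      using q0 by (simp add: \<rho>_def power2_eq_square right_diff_distrib)
    also have "\<bar>\<dots>\<bar> \<le> real q * (4 * M / real q)"
      unfolding abs_mult using tq by (intro mult_mono eq4) auto
    finally show ?thesis using q0 by simp
  qed
  define X1 where "X1 = (\<Sum>(a, b)\<in>{(a, b) \<in> inverse_pairs q. y1 \<le> a \<and> a < y1 + int N}. W a * trunc_ratio (c a) (nat b))"
  define X2 where "X2 = (\<Sum>(a, b)\<in>{(a, b) \<in> inverse_pairs q. y1 \<le> a \<and> a < y1 + int N}. W a * trunc_ratio (c a) (nat (int q - b)))"
  define I where "I = real (totient q) * integral {t1..t2} f"
  have "\<bar>X1 + X2 - 2 * I\<bar> \<le> 2 * (12 * M * E * (1 + ln (real q)) + M + 4 * M)"
  proof -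
    from abs_diff_chain[OF eq1 eq2 eq3 eq5] show ?thesis unfolding X1_def[symmetric] X2_def[symmetric] I_def[symmetric] .
  qed
  also have "\<dots> = M * (24 * E * (1 + ln (real q)) + 10)" by (simp add: algebra_simps)
  finally have "\<epsilon>\<^sup>2 * \<bar>X1 + X2 - 2 * I\<bar> \<le> \<epsilon>\<^sup>2 * (M * (24 * E * (1 + ln (real q)) + 10))"
    by (intro mult_left_mono) auto
  moreover have "\<epsilon>\<^sup>2 * (X1 + X2) - 2 * \<epsilon>\<^sup>2 * real (totient q) * integral {t1..t2} f = \<epsilon>\<^sup>2 * (X1 + X2 - 2 * I)"
    by (simp add: I_def algebra_simps)
  then have "\<bar>\<epsilon>\<^sup>2 * (X1 + X2) - 2 * \<epsilon>\<^sup>2 * real (totient q) * integral {t1..t2} f\<bar> = \<epsilon>\<^sup>2 * \<bar>X1 + X2 - 2 * I\<bar>"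
    by (simp only: abs_mult abs_power2)
  ultimately show "\<bar>(\<Sum>(a, b)\<in>{(a, b) \<in> inverse_pairs q. t1 \<le> of_int a / real q \<and> of_int a / real q \<le> t2}. lattice_term \<epsilon> r q a b)
      - 2 * \<epsilon>\<^sup>2 * real (totient q) * integral {t1..t2} f\<bar>
    \<le> \<epsilon>\<^sup>2 * (2 powr \<bar>r - 1\<bar> * (\<epsilon> * real q) powr (r - 1)) * (24 * E * (1 + ln (real q)) + 10)"
    unfolding row X1_def[symmetric] X2_def[symmetric] M_def[symmetric] by (simp add: mult.assoc)
qed

definition lattice_row :: "real \<Rightarrow> real \<Rightarrow> real \<Rightarrow> real \<Rightarrow> nat \<Rightarrow> real" where
  "lattice_row \<epsilon> r t1 t2 q =
    (\<Sum>(a, b)\<in>{(a, b) \<in> inverse_pairs q. t1 \<le> of_int a / real q \<and> of_int a / real q \<le> t2}. lattice_term \<epsilon> r q a b)"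

lemma has_integral_arctan:
  assumes "t1 \<le> t2"
  shows "((\<lambda>t. 1 / (1 + t\<^sup>2)) has_integral arctan t2 - arctan t1) {t1..t2}"
  by (rule fundamental_theorem_of_calculus[OF assms])
     (auto intro!: derivative_eq_intros simp: has_real_derivative_iff_has_vector_derivative[symmetric] divide_inverse)

text \<open>
  With \<open>\<eta> = \<epsilon> * sqrt (1 + t\<^sup>2)\<close>, the sum over \<open>q\<close> under the integral is \<open>2 / (1 + t\<^sup>2)\<close> times the
  totient sum of \<open>sum_totient_profile\<close>, up to its term for \<open>q = 1\<close>; here \<open>1 / (1 + t\<^sup>2)\<close> is the
  density of the angle with respect to the slope \<open>t\<close>.
\<close>

lemma lattice_sum_main_term:
  fixes \<epsilon> r t1 t2 :: real and Q :: nat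
  assumes r: "r > 0" and \<epsilon>: "0 < \<epsilon>" "\<epsilon> \<le> 1/4" and t: "0 \<le> t1" "t1 \<le> t2" "t2 \<le> 1"
    and Q: "1 / \<epsilon> \<le> real Q" "real Q \<le> 1 / \<epsilon> + 1"
  defines "f \<equiv> \<lambda>q t. (\<epsilon> * real q * sqrt (1 + t\<^sup>2)) powr (r - 1) * profile (\<epsilon> * real q * sqrt (1 + t\<^sup>2))"
  assumes int: "\<And>q. q \<in> {2..Q} \<Longrightarrow> f q integrable_on {t1..t2}"
  shows "\<bar>(\<Sum>q=2..Q. 2 * \<epsilon>\<^sup>2 * real (totient q) * integral {t1..t2} (f q))
     - 12 / pi\<^sup>2 * free_path_moment r * (arctan t2 - arctan t1)\<bar> \<le> (56 * 4 powr r + 4) * (\<epsilon> * (1 + ln (real Q)))"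
proof -
  define B where "B = (56 * 4 powr r + 4) * (\<epsilon> * (1 + ln (real Q)))"
  define m where "m = 12 / pi\<^sup>2 * free_path_moment r"
  define H where "H t = (\<Sum>q=2..Q. 2 * \<epsilon>\<^sup>2 * real (totient q) * f q t)" for t
  have "4 \<le> 1 / \<epsilon>" using \<epsilon> by (simp add: field_simps)
  then have Q4: "Q \<ge> 4" using Q by linarith
  have pt: "\<bar>H t - m * (1 / (1 + t\<^sup>2))\<bar> \<le> B" if t01: "t \<in> {t1..t2}" for t
  proof -
    define u where "u = sqrt (1 + t\<^sup>2)"
    define \<eta> where "\<eta> = \<epsilon> * u"
    have "t\<^sup>2 \<le> 1" using t01 t by (simp add: power_le_one)
    then have "u \<le> sqrt 4" unfolding u_def by (intro real_sqrt_le_mono) simp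
    then have u: "1 \<le> u" "u \<le> 2" by (auto simp: u_def)
    have u2: "u\<^sup>2 = 1 + t\<^sup>2" by (simp add: u_def)
    have \<eta>: "0 < \<eta>" "\<eta> \<le> 2 * \<epsilon>" "\<epsilon> \<le> \<eta>" using \<epsilon> u by (auto simp: \<eta>_def)
    have N1: "1 \<le> \<eta> * real Q"
    proof -
      have "\<epsilon> * (1 / \<epsilon>) \<le> \<eta> * real Q" using \<eta> \<epsilon> Q by (intro mult_mono) auto
      then show ?thesis using \<epsilon> by simp
    qed
    have N2: "\<eta> * real Q \<le> 4"
    proof -
      have "\<eta> * real Q \<le> (2 * \<epsilon>) * (1 / \<epsilon> + 1)" using \<eta> \<epsilon> Q by (intro mult_mono) auto
      also have "\<dots> = 2 + 2 * \<epsilon>" using \<epsilon> by (simp add: field_simps)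
      finally show ?thesis using \<epsilon> by simp
    qed
    define g where "g q = real (totient q) / real q * (\<eta> * ((\<eta> * real q) powr r * profile (\<eta> * real q)))" for q :: nat
    have s: "\<bar>(\<Sum>q=1..Q. g q) - 6 / pi\<^sup>2 * free_path_moment r\<bar> \<le> 14 * 4 powr r * (\<eta> * (1 + ln (real Q)))"
      unfolding g_def by (rule sum_totient_profile[OF r \<eta>(1) N1 N2])
    have g1: "0 \<le> g 1" "g 1 \<le> \<eta>"
    proof -
      have "\<eta> powr r * profile \<eta> \<le> 1 * 1"
        using \<eta> \<epsilon> r profile_bounds[of \<eta>] by (intro mult_mono powr_le1) auto
      then have "\<eta> * (\<eta> powr r * profile \<eta>) \<le> \<eta> * 1" using \<eta> by (intro mult_left_mono) auto
      then show "g 1 \<le> \<eta>" by (simp add: g_def)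
      show "0 \<le> g 1" using \<eta> profile_bounds by (simp add: g_def)
    qed
    have sp: "(\<Sum>q=1..Q. g q) = g 1 + (\<Sum>q=2..Q. g q)"
      using sum.atLeast_Suc_atMost[of 1 Q g] Q4 by (simp add: numeral_2_eq_2)
    have "H t = (2 / (1 + t\<^sup>2)) * (\<Sum>q=2..Q. g q)"
      unfolding H_def sum_distrib_left
    proof (rule sum.cong[OF refl])
      fix q assume "q \<in> {2..Q}"
      then have q: "real q > 0" by simp
      have "(\<eta> * real q) powr r = (\<eta> * real q) powr (r - 1) * (\<eta> * real q)"
        using \<eta> q by (simp add: powr_diff)
      then have "2 / (1 + t\<^sup>2) * g q = 2 / u\<^sup>2 * (real (totient q) * \<eta>\<^sup>2 * ((\<eta> * real q) powr (r - 1) * profile (\<eta> * real q)))"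
        using q unfolding u2[symmetric] by (simp add: g_def power2_eq_square)
      also have "\<dots> = 2 * \<epsilon>\<^sup>2 * real (totient q) * ((\<eta> * real q) powr (r - 1) * profile (\<eta> * real q))"
        using u by (simp add: \<eta>_def power_mult_distrib)
      also have "\<eta> * real q = \<epsilon> * real q * u" by (simp add: \<eta>_def)
      finally show "2 * \<epsilon>\<^sup>2 * real (totient q) * f q t = 2 / (1 + t\<^sup>2) * g q" by (simp add: f_def u_def)
    qed
    then have "H t - m * (1 / (1 + t\<^sup>2)) = (2 / (1 + t\<^sup>2)) * (((\<Sum>q=1..Q. g q) - 6 / pi\<^sup>2 * free_path_moment r) - g 1)"
      unfolding sp by (simp add: m_def algebra_simps)
    also have "\<bar>\<dots>\<bar> \<le> 2 * (14 * 4 powr r * (\<eta> * (1 + ln (real Q))) + \<eta>)"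
      unfolding abs_mult
    proof (intro mult_mono)
      have "2 / (1 + t\<^sup>2) \<le> 2 / 1" by (intro divide_left_mono) (auto intro: add_pos_nonneg)
      then show "\<bar>2 / (1 + t\<^sup>2)\<bar> \<le> 2" by simp
      show "\<bar>((\<Sum>q=1..Q. g q) - 6 / pi\<^sup>2 * free_path_moment r) - g 1\<bar> \<le> 14 * 4 powr r * (\<eta> * (1 + ln (real Q))) + \<eta>"
        by (rule order_trans[OF abs_triangle_ineq4], rule add_mono[OF s]) (use g1 in simp)
    qed auto
    also have "\<dots> \<le> 2 * (14 * 4 powr r * ((2 * \<epsilon>) * (1 + ln (real Q))) + (2 * \<epsilon>) * (1 + ln (real Q)))"
    proof -
      have l: "0 \<le> ln (real Q)" using Q4 by simp
      have "\<eta> * 1 \<le> (2 * \<epsilon>) * (1 + ln (real Q))" using \<eta> l \<epsilon> by (intro mult_mono) auto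
      moreover have "14 * 4 powr r * (\<eta> * (1 + ln (real Q))) \<le> 14 * 4 powr r * ((2 * \<epsilon>) * (1 + ln (real Q)))"
        using \<eta> l by (intro mult_left_mono mult_right_mono) auto
      ultimately show ?thesis by (intro mult_left_mono add_mono) auto
    qed
    also have "\<dots> = B" by (simp add: B_def algebra_simps)
    finally show ?thesis .
  qed
  have H: "(H has_integral (\<Sum>q=2..Q. 2 * \<epsilon>\<^sup>2 * real (totient q) * integral {t1..t2} (f q))) {t1..t2}"
    unfolding H_def by (intro has_integral_sum has_integral_mult_right integrable_integral int) auto
  have A: "((\<lambda>t. m * (1 / (1 + t\<^sup>2))) has_integral m * (arctan t2 - arctan t1)) {t1..t2}"
    by (intro has_integral_mult_right has_integral_arctan t)
  have "((\<lambda>t. H t - m * (1 / (1 + t\<^sup>2))) has_integral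
     ((\<Sum>q=2..Q. 2 * \<epsilon>\<^sup>2 * real (totient q) * integral {t1..t2} (f q)) - m * (arctan t2 - arctan t1))) {t1..t2}"
    by (rule has_integral_diff[OF H A])
  moreover have B0: "0 \<le> B" using \<epsilon> Q4 by (simp add: B_def)
  ultimately have "norm ((\<Sum>q=2..Q. 2 * \<epsilon>\<^sup>2 * real (totient q) * integral {t1..t2} (f q)) - m * (arctan t2 - arctan t1))
     \<le> B * measure lborel {t1..t2}"
    using pt by (intro has_integral_bound_real[OF B0 finite.emptyI]) (auto simp: real_norm_def)
  also have "\<dots> \<le> B * 1" using t B0 by (intro mult_left_mono) auto
  finally show ?thesis by (simp add: B_def m_def)
qed

lemma powr_divide_eq:
  fixes a \<epsilon> x :: real
  assumes "\<epsilon> > 0"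
  shows "(2 / \<epsilon>) powr x = 2 powr x * \<epsilon> powr (- x)"
proof -
  have "(2 / \<epsilon>) powr x = 2 powr x / \<epsilon> powr x" by (simp only: powr_divide)
  also have "\<dots> = 2 powr x * \<epsilon> powr (- x)" by (simp add: powr_minus divide_inverse)
  finally show ?thesis .
qed

lemma eps_times_log_le:
  fixes \<epsilon> :: real
  assumes \<epsilon>: "0 < \<epsilon>" "\<epsilon> \<le> 1/4"
  shows "\<epsilon> * (1 + ln (real (nat \<lceil>1/\<epsilon>\<rceil>))) \<le> (1 + 1 / (3/4)) * 2 powr (3/4) * \<epsilon> powr (1/4)"
proof -
  define Q where "Q = nat \<lceil>1/\<epsilon>\<rceil>"
  have e4: "4 \<le> 1 / \<epsilon>" using \<epsilon> by (simp add: field_simps)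
  have Q: "real Q \<le> 2 / \<epsilon>" "real Q \<ge> 1" using e4 unfolding Q_def by linarith+
  have "1 + ln (real Q) \<le> (1 + 1 / (3/4)) * real Q powr (3/4)" by (rule one_plus_ln_le_powr) (use Q in auto)
  also have "\<dots> \<le> (1 + 1 / (3/4)) * (2 / \<epsilon>) powr (3/4)" using Q by (intro mult_left_mono powr_mono2) auto
  also have "(2 / \<epsilon>) powr (3/4) = 2 powr (3/4) * \<epsilon> powr (- (3/4))" by (rule powr_divide_eq[OF \<epsilon>(1)])
  finally have "\<epsilon> * (1 + ln (real Q)) \<le> \<epsilon> * ((1 + 1 / (3/4)) * (2 powr (3/4) * \<epsilon> powr (- (3/4))))"
    using \<epsilon> by (intro mult_left_mono) auto
  also have "\<dots> = (1 + 1 / (3/4)) * 2 powr (3/4) * (\<epsilon> * \<epsilon> powr (- (3/4)))" by (simp only: mult_ac)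
  also have "\<epsilon> * \<epsilon> powr (- (3/4)) = \<epsilon> powr (1/4)" using \<epsilon> powr_add[of \<epsilon> 1 "- (3/4)"] by simp
  finally show ?thesis by (simp add: Q_def)
qed

text \<open>
  The errors of the rows are \<open>\<epsilon> powr (r + 1) * q powr (r - 1/4 + \<delta>)\<close> up to a constant, and their
  sum over \<open>q \<le> 2 / \<epsilon>\<close> is of order \<open>\<epsilon> powr (1/4 - \<delta>)\<close>.
\<close>

lemma lattice_sum_asymptotics:
  fixes r \<delta> :: real
  assumes r: "r > 0" and \<delta>: "\<delta> > 0"
  obtains C where "C > 0" "\<And>\<epsilon> t1 t2. \<lbrakk>0 < \<epsilon>; \<epsilon> \<le> 1/4; 0 \<le> t1; t1 \<le> t2; t2 \<le> 1\<rbrakk> \<Longrightarrow>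
     \<bar>(\<Sum>q=2..nat \<lceil>1/\<epsilon>\<rceil>. lattice_row \<epsilon> r t1 t2 q) - 12 / pi\<^sup>2 * free_path_moment r * (arctan t2 - arctan t1)\<bar>
       \<le> C * \<epsilon> powr (1/4 - \<delta>)"
proof -
  obtain C1 where C1: "C1 > 0" "\<And>q a b c d. \<lbrakk>q \<ge> 2; 0 \<le> a; b \<le> int q; 0 \<le> c; d \<le> int q\<rbrakk> \<Longrightarrow>
    inverse_box_discrepancy q a b c d \<le> C1 * real q powr (3/4 + \<delta> / 2)"
    using inverse_pairs_discrepancy[of "\<delta> / 2"] \<delta> by auto
  \<comment> \<open>the discrepancy and the logarithm of summation by parts each take half of \<open>\<delta>\<close>\<close>
  define C2 where "C2 = 1 + 1 / (\<delta> / 2)"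
  define K where "K = 24 * C1 * C2 + 10"
  define s where "s = r - 1/4 + \<delta>"
  define C3 where "C3 = max 1 (1 / (s + 1))"
  have C2: "C2 > 0" using \<delta> by (simp add: C2_def add_pos_pos)
  have K: "K > 0" using C1 C2 by (simp add: K_def add_pos_pos)
  have s: "s > -1" using r \<delta> by (simp add: s_def)
  have C3: "C3 \<ge> 1" by (simp add: C3_def)
  define D1 where "D1 = 2 powr \<bar>r - 1\<bar> * K * C3 * 2 powr (s + 1)"
  define D2 where "D2 = (56 * 4 powr r + 4) * ((1 + 1 / (3/4)) * 2 powr (3/4))"
  have D: "D1 > 0" "D2 > 0" using K C3 by (auto simp: D1_def D2_def add_pos_pos)
  show ?thesis
  proof
    show "D1 + D2 > 0" using D by simp
    fix \<epsilon> t1 t2 :: real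
    assume \<epsilon>: "0 < \<epsilon>" "\<epsilon> \<le> 1/4" and t: "0 \<le> t1" "t1 \<le> t2" "t2 \<le> 1"
    define Q where "Q = nat \<lceil>1/\<epsilon>\<rceil>"
    have e4: "4 \<le> 1 / \<epsilon>" using \<epsilon> by (simp add: field_simps)
    have Q: "1 / \<epsilon> \<le> real Q" "real Q \<le> 1 / \<epsilon> + 1" using e4 unfolding Q_def by linarith+
    have Q2: "real Q \<le> 2 / \<epsilon>" using Q e4 by linarith
    have Q1: "real Q \<ge> 1" using Q e4 by linarith
    define f where "f q t = (\<epsilon> * real q * sqrt (1 + t\<^sup>2)) powr (r - 1) * profile (\<epsilon> * real q * sqrt (1 + t\<^sup>2))" for q :: nat and t
    have rows: "f q integrable_on {t1..t2}"
      "\<bar>lattice_row \<epsilon> r t1 t2 q - 2 * \<epsilon>\<^sup>2 * real (totient q) * integral {t1..t2} (f q)\<bar>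
       \<le> 2 powr \<bar>r - 1\<bar> * K * \<epsilon> powr (r + 1) * real q powr s" if q: "q \<in> {2..Q}" for q
    proof -
      have q2: "q \<ge> 2" using q by simp
      have q1: "real q \<ge> 1" using q by simp
      note R = lattice_terms_row[OF \<epsilon>(1) q2 t C1(2)[OF q2], of r]
      show "f q integrable_on {t1..t2}" using R(1) unfolding f_def[abs_def] .
      have "\<bar>lattice_row \<epsilon> r t1 t2 q - 2 * \<epsilon>\<^sup>2 * real (totient q) * integral {t1..t2} (f q)\<bar>
       \<le> \<epsilon>\<^sup>2 * (2 powr \<bar>r - 1\<bar> * (\<epsilon> * real q) powr (r - 1)) * (24 * (C1 * real q powr (3/4 + \<delta> / 2)) * (1 + ln (real q)) + 10)"
        using R(2) unfolding f_def[abs_def] lattice_row_def .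
      also have "\<dots> \<le> \<epsilon>\<^sup>2 * (2 powr \<bar>r - 1\<bar> * (\<epsilon> * real q) powr (r - 1)) * (K * real q powr (3/4 + \<delta>))"
      proof (rule mult_left_mono)
        have "24 * (C1 * real q powr (3/4 + \<delta> / 2)) * (1 + ln (real q)) \<le> 24 * (C1 * real q powr (3/4 + \<delta> / 2)) * (C2 * real q powr (\<delta> / 2))"
          unfolding C2_def using C1 \<delta> q1 by (intro mult_left_mono one_plus_ln_le_powr) auto
        also have "\<dots> = 24 * C1 * C2 * real q powr (3/4 + \<delta>)"
          by (simp add: powr_add[symmetric] add.assoc)
        finally have "24 * (C1 * real q powr (3/4 + \<delta> / 2)) * (1 + ln (real q)) \<le> 24 * C1 * C2 * real q powr (3/4 + \<delta>)" .
        moreover have "1 \<le> real q powr (3/4 + \<delta>)" using q1 \<delta> by (intro ge_one_powr_ge_zero) auto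
        ultimately show "24 * (C1 * real q powr (3/4 + \<delta> / 2)) * (1 + ln (real q)) + 10 \<le> K * real q powr (3/4 + \<delta>)"
          by (simp add: K_def algebra_simps)
      qed simp
      also have "\<dots> = 2 powr \<bar>r - 1\<bar> * K * \<epsilon> powr (r + 1) * real q powr s"
      proof -
        have "\<epsilon>\<^sup>2 * \<epsilon> powr (r - 1) = \<epsilon> powr (r + 1)" using \<epsilon> by (simp add: powr_add[symmetric] add.commute flip: powr_numeral)
        moreover have "real q powr (r - 1) * real q powr (3/4 + \<delta>) = real q powr s"
          by (simp add: powr_add[symmetric] s_def algebra_simps)
        moreover have "\<epsilon>\<^sup>2 * (2 powr \<bar>r - 1\<bar> * (\<epsilon> * real q) powr (r - 1)) * (K * real q powr (3/4 + \<delta>))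
            = 2 powr \<bar>r - 1\<bar> * K * (\<epsilon>\<^sup>2 * \<epsilon> powr (r - 1)) * (real q powr (r - 1) * real q powr (3/4 + \<delta>))"
          using \<epsilon> by (simp only: powr_mult mult_ac)
        ultimately show ?thesis by simp
      qed
      finally show "\<bar>lattice_row \<epsilon> r t1 t2 q - 2 * \<epsilon>\<^sup>2 * real (totient q) * integral {t1..t2} (f q)\<bar>
       \<le> 2 powr \<bar>r - 1\<bar> * K * \<epsilon> powr (r + 1) * real q powr s" .
    qed
    have "\<bar>(\<Sum>q=2..Q. lattice_row \<epsilon> r t1 t2 q) - (\<Sum>q=2..Q. 2 * \<epsilon>\<^sup>2 * real (totient q) * integral {t1..t2} (f q))\<bar>
       \<le> (\<Sum>q=2..Q. 2 powr \<bar>r - 1\<bar> * K * \<epsilon> powr (r + 1) * real q powr s)"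
      unfolding sum_subtractf[symmetric] by (rule order_trans[OF sum_abs], rule sum_mono) (rule rows(2))
    also have "\<dots> \<le> 2 powr \<bar>r - 1\<bar> * K * \<epsilon> powr (r + 1) * (\<Sum>q=1..Q. real q powr s)"
      unfolding sum_distrib_left[symmetric] using K by (intro mult_left_mono sum_mono2) auto
    also have "\<dots> \<le> 2 powr \<bar>r - 1\<bar> * K * \<epsilon> powr (r + 1) * (C3 * real Q powr (s + 1))"
      unfolding C3_def using K by (intro mult_left_mono sum_powr_le s) auto
    also have "\<dots> \<le> 2 powr \<bar>r - 1\<bar> * K * \<epsilon> powr (r + 1) * (C3 * (2 / \<epsilon>) powr (s + 1))"
      using K C3 Q2 s by (intro mult_left_mono powr_mono2) auto
    also have "\<dots> = D1 * \<epsilon> powr (1/4 - \<delta>)"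
    proof -
      have "(2 / \<epsilon>) powr (s + 1) = 2 powr (s + 1) * \<epsilon> powr (- (s + 1))" by (rule powr_divide_eq[OF \<epsilon>(1)])
      moreover have "\<epsilon> powr (r + 1) * \<epsilon> powr (- (s + 1)) = \<epsilon> powr (1/4 - \<delta>)"
        by (simp add: powr_add[symmetric] s_def)
      moreover have "2 powr \<bar>r - 1\<bar> * K * \<epsilon> powr (r + 1) * (C3 * (2 powr (s + 1) * \<epsilon> powr (- (s + 1))))
         = D1 * (\<epsilon> powr (r + 1) * \<epsilon> powr (- (s + 1)))" unfolding D1_def by (simp only: mult_ac)
      ultimately show ?thesis by simp
    qed
    finally have 1: "\<bar>(\<Sum>q=2..Q. lattice_row \<epsilon> r t1 t2 q) - (\<Sum>q=2..Q. 2 * \<epsilon>\<^sup>2 * real (totient q) * integral {t1..t2} (f q))\<bar> \<le> D1 * \<epsilon> powr (1/4 - \<delta>)" .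
    have "\<bar>(\<Sum>q=2..Q. 2 * \<epsilon>\<^sup>2 * real (totient q) * integral {t1..t2} (f q))
     - 12 / pi\<^sup>2 * free_path_moment r * (arctan t2 - arctan t1)\<bar> \<le> (56 * 4 powr r + 4) * (\<epsilon> * (1 + ln (real Q)))"
      using lattice_sum_main_term[OF r \<epsilon> t Q] rows(1) unfolding f_def[abs_def] by simp
    also have "\<dots> \<le> (56 * 4 powr r + 4) * ((1 + 1 / (3/4)) * 2 powr (3/4) * \<epsilon> powr (1/4))"
      unfolding Q_def by (intro mult_left_mono eps_times_log_le \<epsilon>) auto
    also have "\<dots> = D2 * \<epsilon> powr (1/4)" by (simp only: D2_def mult.assoc)
    also have "\<dots> \<le> D2 * \<epsilon> powr (1/4 - \<delta>)"
      using \<epsilon> \<delta> D by (intro mult_left_mono powr_mono') auto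
    finally have 2: "\<bar>(\<Sum>q=2..Q. 2 * \<epsilon>\<^sup>2 * real (totient q) * integral {t1..t2} (f q))
     - 12 / pi\<^sup>2 * free_path_moment r * (arctan t2 - arctan t1)\<bar> \<le> D2 * \<epsilon> powr (1/4 - \<delta>)" .
    show "\<bar>(\<Sum>q=2..nat \<lceil>1/\<epsilon>\<rceil>. lattice_row \<epsilon> r t1 t2 q) - 12 / pi\<^sup>2 * free_path_moment r * (arctan t2 - arctan t1)\<bar>
       \<le> (D1 + D2) * \<epsilon> powr (1/4 - \<delta>)"
      using abs_diff_triangle[OF 1 2] unfolding Q_def by (simp add: ring_distribs)
  qed
qed

section \<open>The first scatterer on a ray\<close>

text \<open>
  The signed distance of the lattice point \<open>(q, a)\<close> from the line of direction \<open>\<omega>\<close> through the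
  origin.
\<close>

definition offset :: "real \<Rightarrow> nat \<Rightarrow> int \<Rightarrow> real" where
  "offset \<omega> q a = real q * sin \<omega> - of_int a * cos \<omega>"

definition first_hit :: "real \<Rightarrow> nat \<Rightarrow> int \<Rightarrow> real set" where
  "first_hit \<epsilon> q a = {\<omega>. 0 \<le> \<omega> \<and> \<omega> \<le> pi/4 \<and> \<bar>offset \<omega> q a\<bar> \<le> \<epsilon> \<and>
     (\<forall>q'\<in>{1..<q}. \<forall>a'. \<epsilon> < \<bar>offset \<omega> q' a'\<bar>)}"

lemma sector_bounds:
  assumes "0 \<le> \<omega>" "\<omega> \<le> pi/4"
  shows "1/2 \<le> cos \<omega>" "0 \<le> sin \<omega>" "sin \<omega> \<le> cos \<omega>" "cos \<omega> \<le> 1" "sin \<omega> \<le> 1"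
proof -
  have c: "cos (pi/4) \<le> cos \<omega>" using assms by (intro cos_monotone_0_pi_le) auto
  have "1 \<le> sqrt 2" by simp
  then have "1/2 \<le> cos (pi/4)" unfolding cos_45 by simp
  then show "1/2 \<le> cos \<omega>" using c by simp
  show "0 \<le> sin \<omega>" using assms by (intro sin_ge_zero) auto
  have "sin \<omega> \<le> sin (pi/4)" using assms by (intro sin_monotone_2pi_le) auto
  then show "sin \<omega> \<le> cos \<omega>" using c by (simp add: cos_45 sin_45)
qed auto

lemma scatterer_translates:
  "(x, y) \<in> scatterer \<epsilon> + (\<int> \<times> \<int> - {(0, 0)}) \<longleftrightarrow>
    (\<exists>m n :: int. (m, n) \<noteq> (0, 0) \<and> (x - of_int m)\<^sup>2 + (y - of_int n)\<^sup>2 = \<epsilon>\<^sup>2)"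
proof
  assume "(x, y) \<in> scatterer \<epsilon> + (\<int> \<times> \<int> - {(0, 0)})"
  then obtain P P' where PP: "(x, y) = P + P'" "P \<in> scatterer \<epsilon>" "P' \<in> \<int> \<times> \<int> - {(0, 0)}"
    by (rule set_plus_elim)
  obtain u v w z where "P = (u, v)" "P' = (w, z)" by (cases P, cases P') blast
  with PP have *: "(u, v) \<in> scatterer \<epsilon>" "(w, z) \<in> \<int> \<times> \<int> - {(0, 0)}" "(x, y) = (u, v) + (w, z)" by auto
  then obtain m n :: int where "w = of_int m" "z = of_int n" by (auto elim!: Ints_cases)
  with * show "\<exists>m n :: int. (m, n) \<noteq> (0, 0) \<and> (x - of_int m)\<^sup>2 + (y - of_int n)\<^sup>2 = \<epsilon>\<^sup>2"
    by (intro exI[of _ m] exI[of _ n]) (auto simp: scatterer_def)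
next
  assume "\<exists>m n :: int. (m, n) \<noteq> (0, 0) \<and> (x - of_int m)\<^sup>2 + (y - of_int n)\<^sup>2 = \<epsilon>\<^sup>2"
  then obtain m n :: int where *: "(m, n) \<noteq> (0, 0)" "(x - of_int m)\<^sup>2 + (y - of_int n)\<^sup>2 = \<epsilon>\<^sup>2" by blast
  have "(x, y) = (x - of_int m, y - of_int n) + (of_int m, of_int n)" by simp
  also have "\<dots> \<in> scatterer \<epsilon> + (\<int> \<times> \<int> - {(0, 0)})"
    by (rule set_plus_intro) (use * in \<open>auto simp: scatterer_def\<close>)
  finally show "(x, y) \<in> scatterer \<epsilon> + (\<int> \<times> \<int> - {(0, 0)})" .
qed

text \<open>
  The exit time is the smaller root of the quadratic equation for the circle around \<open>(q, a)\<close>. The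
  centre of any circle met by the ray has an abscissa at least \<open>q\<close>; if it is larger, the centre
  projects to a point at least \<open>1 - 2 \<epsilon>\<close> further along the ray, and if it is \<open>q\<close>, the ordinate is
  \<open>a\<close>.
\<close>

lemma free_path_length_first_hit:
  assumes \<epsilon>: "0 < \<epsilon>" "\<epsilon> \<le> 1/8" and q: "q \<ge> 1" and h: "\<omega> \<in> first_hit \<epsilon> q a"
  defines "p \<equiv> real q * cos \<omega> + of_int a * sin \<omega>"
  shows "free_path_length \<epsilon> \<omega> = p - sqrt (\<epsilon>\<^sup>2 - (offset \<omega> q a)\<^sup>2)" "\<epsilon> < p"
proof -
  have w: "0 \<le> \<omega>" "\<omega> \<le> pi/4" "\<bar>offset \<omega> q a\<bar> \<le> \<epsilon>"
    "\<And>q' a'. 1 \<le> q' \<Longrightarrow> q' < q \<Longrightarrow> \<epsilon> < \<bar>offset \<omega> q' a'\<bar>" using h by (auto simp: first_hit_def)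
  note cs = sector_bounds[OF w(1,2)]
  have sc: "(sin \<omega>)\<^sup>2 + (cos \<omega>)\<^sup>2 = 1" by simp
  have ident: "(\<tau> * cos \<omega> - m)\<^sup>2 + (\<tau> * sin \<omega> - n)\<^sup>2 = (\<tau> - (m * cos \<omega> + n * sin \<omega>))\<^sup>2 + (m * sin \<omega> - n * cos \<omega>)\<^sup>2" for \<tau> m n :: real
    using sc by algebra
  have mdecomp: "m = (m * cos \<omega> + n * sin \<omega>) * cos \<omega> + (m * sin \<omega> - n * cos \<omega>) * sin \<omega>" for m n :: real
    using sc by algebra
  have Xs: "\<bar>x * sin \<omega>\<bar> \<le> \<epsilon>" if "\<bar>x\<bar> \<le> \<epsilon>" for x
    unfolding abs_mult using that cs mult_mono[of "\<bar>x\<bar>" \<epsilon> "\<bar>sin \<omega>\<bar>" 1] \<epsilon> by simp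
  have p_big: "1 - \<epsilon> \<le> p"
  proof -
    have "1 \<le> p * cos \<omega> + offset \<omega> q a * sin \<omega>" using mdecomp[of "real q" "of_int a"] q by (simp add: p_def offset_def)
    then have 1: "1 - \<epsilon> \<le> p * cos \<omega>" using Xs[OF w(3)] by linarith
    then have "0 < p * cos \<omega>" using \<epsilon> by linarith
    then have "0 < p" using cs by (simp add: zero_less_mult_iff)
    then have "p * cos \<omega> \<le> p * 1" using cs by (intro mult_left_mono) auto
    then show ?thesis using 1 by simp
  qed
  then show pe: "\<epsilon> < p" using \<epsilon> by linarith
  have X2: "(offset \<omega> q a)\<^sup>2 \<le> \<epsilon>\<^sup>2" using w(3) by (metis abs_ge_zero power2_abs power_mono)
  define S where "S = {\<tau>. \<tau> > 0 \<and> (\<tau> * cos \<omega>, \<tau> * sin \<omega>) \<in> scatterer \<epsilon> + (\<int> \<times> \<int> - {(0, 0)})}"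
  define \<tau>0 where "\<tau>0 = p - sqrt (\<epsilon>\<^sup>2 - (offset \<omega> q a)\<^sup>2)"
  have "Inf S = \<tau>0"
  proof (rule cInf_eq_minimum)
    have "sqrt (\<epsilon>\<^sup>2 - (offset \<omega> q a)\<^sup>2) \<le> sqrt (\<epsilon>\<^sup>2)" by (intro real_sqrt_le_mono) simp
    then have "\<tau>0 > 0" using pe \<epsilon> by (simp add: \<tau>0_def)
    moreover have "(\<tau>0 * cos \<omega> - real q)\<^sup>2 + (\<tau>0 * sin \<omega> - of_int a)\<^sup>2 = \<epsilon>\<^sup>2"
      unfolding ident using X2 by (simp add: \<tau>0_def p_def offset_def)
    ultimately show "\<tau>0 \<in> S" unfolding S_def scatterer_translates mem_Collect_eq
      by (intro conjI, simp, rule_tac x = "int q" in exI, rule_tac x = a in exI) (use q in auto)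
  next
    fix \<tau> assume "\<tau> \<in> S"
    then obtain m n :: int where mn: "\<tau> > 0" "(m, n) \<noteq> (0, 0)" "(\<tau> * cos \<omega> - of_int m)\<^sup>2 + (\<tau> * sin \<omega> - of_int n)\<^sup>2 = \<epsilon>\<^sup>2"
      unfolding S_def scatterer_translates by auto
    define p' where "p' = of_int m * cos \<omega> + of_int n * sin \<omega>"
    define X' where "X' = of_int m * sin \<omega> - of_int n * cos \<omega>"
    have id: "(\<tau> - p')\<^sup>2 + X'\<^sup>2 = \<epsilon>\<^sup>2" using mn(3) unfolding ident p'_def X'_def .
    have "X'\<^sup>2 \<le> \<epsilon>\<^sup>2" "(\<tau> - p')\<^sup>2 \<le> \<epsilon>\<^sup>2"
      using id zero_le_power2[of X'] zero_le_power2[of "\<tau> - p'"] by linarith+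
    then have "\<bar>X'\<bar> \<le> \<bar>\<epsilon>\<bar>" "\<bar>\<tau> - p'\<bar> \<le> \<bar>\<epsilon>\<bar>" by (simp_all only: abs_le_square_iff)
    then have X': "\<bar>X'\<bar> \<le> \<epsilon>" and t': "\<bar>\<tau> - p'\<bar> \<le> \<epsilon>" using \<epsilon> by auto
    have md: "of_int m = p' * cos \<omega> + X' * sin \<omega>" using mdecomp[of "of_int m" "of_int n"] by (simp add: p'_def X'_def)
    have "m \<ge> 0"
    proof -
      have "- \<epsilon> \<le> p'" using t' mn(1) by linarith
      have "- \<epsilon> \<le> p' * cos \<omega>"
      proof (cases "p' \<ge> 0")
        case True
        then have "0 \<le> p' * cos \<omega>" using cs by simp
        then show ?thesis using \<epsilon> by linarith
      next
        case False
        then have "p' * 1 \<le> p' * cos \<omega>" using cs by (intro mult_left_mono_neg) auto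
        then show ?thesis using \<open>- \<epsilon> \<le> p'\<close> by simp
      qed
      then have "of_int m \<ge> - (2 * \<epsilon>)" using md Xs[OF X'] by linarith
      then show ?thesis using \<epsilon> by linarith
    qed
    have uniq: "n = n'" if "\<bar>of_int n * cos \<omega> - of_int n' * cos \<omega>\<bar> \<le> 2 * \<epsilon>" for n'
    proof (rule ccontr)
      assume "n \<noteq> n'"
      then have "1 \<le> \<bar>n - n'\<bar>" by linarith
      then have "(1::real) \<le> \<bar>of_int (n - n')\<bar>" by linarith
      then have "1 * cos \<omega> \<le> \<bar>of_int (n - n')\<bar> * cos \<omega>" using cs by (intro mult_right_mono) auto
      also have "\<dots> = \<bar>of_int n * cos \<omega> - of_int n' * cos \<omega>\<bar>"
        using cs by (simp add: left_diff_distrib[symmetric] abs_mult)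
      finally show False using that cs \<epsilon> by linarith
    qed
    have "m \<noteq> 0"
    proof
      assume "m = 0"
      then have "\<bar>of_int n * cos \<omega> - of_int 0 * cos \<omega>\<bar> \<le> 2 * \<epsilon>" using X' \<epsilon> by (simp add: X'_def)
      then have "n = 0" by (rule uniq)
      then show False using mn \<open>m = 0\<close> by simp
    qed
    with \<open>m \<ge> 0\<close> have m1: "m \<ge> 1" by simp
    have mo: "X' = offset \<omega> (nat m) n" using m1 by (simp add: X'_def offset_def)
    have "nat m \<ge> q"
    proof (rule ccontr)
      assume "\<not> q \<le> nat m"
      then have "\<epsilon> < \<bar>offset \<omega> (nat m) n\<bar>" using m1 by (intro w(4)) auto
      then show False using X' mo by simp
    qed
    then have "int q \<le> m" using m1 by (simp add: le_nat_iff)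
    then consider "m = int q" | "m \<ge> int q + 1" by linarith
    then show "\<tau>0 \<le> \<tau>"
    proof cases
      case 1
      have "\<bar>of_int n * cos \<omega> - of_int a * cos \<omega>\<bar> = \<bar>offset \<omega> q a - X'\<bar>" by (simp add: 1 X'_def offset_def)
      also have "\<dots> \<le> 2 * \<epsilon>" using X' w(3) by linarith
      finally have n: "n = a" by (rule uniq)
      then have eq: "p' = p" "X' = offset \<omega> q a" using 1 by (auto simp: p'_def p_def X'_def offset_def)
      have "(\<tau> - p)\<^sup>2 = \<epsilon>\<^sup>2 - (offset \<omega> q a)\<^sup>2" using id by (simp add: eq)
      then have "\<bar>\<tau> - p\<bar> = sqrt (\<epsilon>\<^sup>2 - (offset \<omega> q a)\<^sup>2)" by (metis real_sqrt_abs)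
      then show ?thesis by (simp add: \<tau>0_def)
    next
      case 2
      have qd: "real q = p * cos \<omega> + offset \<omega> q a * sin \<omega>" using mdecomp[of "real q" "of_int a"] by (simp add: p_def offset_def)
      have "real q + 1 \<le> of_int m" using 2 by linarith
      then have "1 \<le> (p' * cos \<omega> - p * cos \<omega>) + (X' * sin \<omega> - offset \<omega> q a * sin \<omega>)" using md qd by linarith
      then have d: "1 - 2 * \<epsilon> \<le> (p' - p) * cos \<omega>" using Xs[OF X'] Xs[OF w(3)] by (simp add: left_diff_distrib)
      then have "0 < (p' - p) * cos \<omega>" using \<epsilon> by linarith
      then have "0 < p' - p" using cs by (simp add: zero_less_mult_iff)
      then have "(p' - p) * cos \<omega> \<le> (p' - p) * 1" using cs by (intro mult_left_mono) auto
      from order_trans[OF d this] have "1 - 2 * \<epsilon> \<le> p' - p" by simp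
      then have "\<tau> \<ge> p" using t' \<epsilon> by linarith
      moreover have "\<tau>0 \<le> p" using X2 by (simp add: \<tau>0_def)
      ultimately show ?thesis by linarith
    qed
  qed
  then show "free_path_length \<epsilon> \<omega> = p - sqrt (\<epsilon>\<^sup>2 - (offset \<omega> q a)\<^sup>2)"
    by (simp add: free_path_length_def S_def \<tau>0_def)
qed

lemma first_hit_numerator_bounds:
  assumes "0 < \<epsilon>" "\<epsilon> \<le> 1/8" "0 \<le> \<omega>" "\<omega> \<le> pi/4" "\<bar>offset \<omega> q a\<bar> \<le> \<epsilon>"
  shows "0 \<le> a" "a \<le> int q"
proof -
  note cs = sector_bounds[OF assms(3,4)]
  show "0 \<le> a"
  proof (rule ccontr)
    assume "\<not> 0 \<le> a"
    then have "of_int a \<le> (-1 :: real)" by linarith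
    then have "of_int a * cos \<omega> \<le> -1 * cos \<omega>" using cs by (intro mult_right_mono) auto
    moreover have "0 \<le> real q * sin \<omega>" using cs by simp
    ultimately show False using assms cs unfolding offset_def by linarith
  qed
  show "a \<le> int q"
  proof (rule ccontr)
    assume "\<not> a \<le> int q"
    then have "of_int a \<ge> real q + 1" by linarith
    then have "(real q + 1) * cos \<omega> \<le> of_int a * cos \<omega>" using cs by (intro mult_right_mono) auto
    moreover have "real q * sin \<omega> \<le> real q * cos \<omega>" using cs by (intro mult_left_mono) auto
    ultimately have "offset \<omega> q a \<le> - cos \<omega>" unfolding offset_def by (simp add: algebra_simps)
    then show False using assms cs by linarith
  qed
qed

text \<open>
  Dirichlet's theorem for \<open>tan \<omega>\<close> gives some scatterer of abscissa at most \<open>1/\<epsilon> + 1\<close> on the ray.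
\<close>

lemma first_hit_exists:
  assumes \<epsilon>: "0 < \<epsilon>" "\<epsilon> \<le> 1/8" and w: "0 \<le> \<omega>" "\<omega> \<le> pi/4"
  obtains q a where "1 \<le> q" "q \<le> nat \<lceil>1/\<epsilon>\<rceil>" "0 \<le> a" "a \<le> int q" "\<omega> \<in> first_hit \<epsilon> q a"
proof -
  note cs = sector_bounds[OF w]
  define N where "N = nat \<lceil>1/\<epsilon>\<rceil>"
  have inv: "1 / \<epsilon> \<ge> 8" using \<epsilon> by (simp add: field_simps)
  have N: "1 / \<epsilon> \<le> real N" unfolding N_def by linarith
  then have "real N > 0" using inv by linarith
  then have N0: "N > 0" by simp
  obtain h k where hk: "0 < k" "k \<le> int N" "\<bar>of_int k * tan \<omega> - of_int h\<bar> < 1 / N"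
    using Dirichlet_approx[OF N0, of "tan \<omega>"] by blast
  have "1 / N \<le> \<epsilon>" using N \<epsilon> N0 by (simp add: field_simps)
  have "offset \<omega> (nat k) h = cos \<omega> * (of_int k * tan \<omega> - of_int h)"
    using hk(1) cs by (simp add: offset_def tan_def algebra_simps)
  also have "\<bar>\<dots>\<bar> \<le> 1 * \<epsilon>" unfolding abs_mult using hk(3) \<open>1 / N \<le> \<epsilon>\<close> cs by (intro mult_mono) auto
  finally have "\<bar>offset \<omega> (nat k) h\<bar> \<le> \<epsilon>" by simp
  then have ex: "\<exists>q. 1 \<le> q \<and> (\<exists>a. \<bar>offset \<omega> q a\<bar> \<le> \<epsilon>)" using hk(1) by (intro exI[of _ "nat k"]) auto
  define q where "q = (LEAST q. 1 \<le> q \<and> (\<exists>a. \<bar>offset \<omega> q a\<bar> \<le> \<epsilon>))"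
  have q: "1 \<le> q" "\<exists>a. \<bar>offset \<omega> q a\<bar> \<le> \<epsilon>" using LeastI_ex[OF ex] by (auto simp: q_def)
  then obtain a where a: "\<bar>offset \<omega> q a\<bar> \<le> \<epsilon>" by blast
  have "q \<le> nat k" unfolding q_def using \<open>\<bar>offset \<omega> (nat k) h\<bar> \<le> \<epsilon>\<close> hk(1) by (intro Least_le) auto
  then have "q \<le> N" using hk by linarith
  have "\<omega> \<in> first_hit \<epsilon> q a" unfolding first_hit_def
  proof (safe)
    fix q' a' assume q': "q' \<in> {1..<q}"
    then show "\<epsilon> < \<bar>offset \<omega> q' a'\<bar>" using not_less_Least[of q' "\<lambda>q. 1 \<le> q \<and> (\<exists>a. \<bar>offset \<omega> q a\<bar> \<le> \<epsilon>)"]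
      by (auto simp: q_def not_le)
  qed (use w a in auto)
  then show ?thesis using that[of q a] q(1) \<open>q \<le> N\<close> first_hit_numerator_bounds[OF \<epsilon> w a] by (simp add: N_def)
qed

lemma first_hit_unique:
  assumes \<epsilon>: "0 < \<epsilon>" "\<epsilon> \<le> 1/8" and q: "1 \<le> q" "1 \<le> q'"
    and w: "\<omega> \<in> first_hit \<epsilon> q a" "\<omega> \<in> first_hit \<epsilon> q' a'"
  shows "q = q'" "a = a'"
proof -
  have "\<not> q < q'" using w q by (auto simp: first_hit_def not_le[symmetric])
  moreover have "\<not> q' < q" using w q by (auto simp: first_hit_def not_le[symmetric])
  ultimately show qq: "q = q'" by simp
  have w': "0 \<le> \<omega>" "\<omega> \<le> pi/4" "\<bar>offset \<omega> q a\<bar> \<le> \<epsilon>" "\<bar>offset \<omega> q a'\<bar> \<le> \<epsilon>" using w qq by (auto simp: first_hit_def)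
  note cs = sector_bounds[OF w'(1,2)]
  show "a = a'"
  proof (rule ccontr)
    assume "a \<noteq> a'"
    then have "(1::real) \<le> \<bar>of_int (a - a')\<bar>" by linarith
    then have "1 * cos \<omega> \<le> \<bar>of_int (a - a')\<bar> * cos \<omega>" using cs by (intro mult_right_mono) auto
    also have "\<dots> = \<bar>offset \<omega> q a' - offset \<omega> q a\<bar>"
      using cs by (simp add: offset_def left_diff_distrib[symmetric] abs_mult)
    finally show False using w' cs \<epsilon> by linarith
  qed
qed

text \<open>
  A non-primitive point is hidden by the primitive one in the same direction, whose offset is not larger.
\<close>

lemma first_hit_not_coprime:
  assumes q: "q \<ge> 1" and g: "\<not> coprime a (int q)" and \<epsilon>: "0 < \<epsilon>"
  shows "first_hit \<epsilon> q a = {}"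
proof (rule ccontr)
  assume "first_hit \<epsilon> q a \<noteq> {}"
  then obtain \<omega> where w: "\<omega> \<in> first_hit \<epsilon> q a" by blast
  define d where "d = gcd a (int q)"
  have d: "d > 1"
  proof -
    have "d > 0" using q by (simp add: d_def)
    moreover have "d \<noteq> 1" using g by (simp add: d_def coprime_iff_gcd_eq_1)
    ultimately show ?thesis by linarith
  qed
  obtain a' q' where a': "a = d * a'" and q': "int q = d * q'" unfolding d_def by (metis dvdE gcd_dvd1 gcd_dvd2)
  have "0 < d * q'" using q' q by linarith
  then have q'0: "q' > 0" using d by (simp add: zero_less_mult_iff)
  have "q' < int q" unfolding q' using d q'0 by simp
  have e: "offset \<omega> q a = of_int d * offset \<omega> (nat q') a'"
  proof -
    have "real q = of_int d * of_int q'" using q' by (metis of_int_mult of_int_of_nat_eq)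
    then show ?thesis using q'0 a' by (simp add: offset_def algebra_simps)
  qed
  have "nat q' \<in> {1..<q}" using \<open>q' < int q\<close> q'0 by auto
  then have "\<epsilon> < \<bar>offset \<omega> (nat q') a'\<bar>" using w unfolding first_hit_def by blast
  also have "\<dots> \<le> \<bar>offset \<omega> q a\<bar>" unfolding e abs_mult using d mult_right_mono[of 1 "\<bar>of_int d\<bar>" "\<bar>offset \<omega> (nat q') a'\<bar>"] by simp
  also have "\<dots> \<le> \<epsilon>" using w by (simp add: first_hit_def)
  finally show False by simp
qed

text \<open>
  The parents \<open>v1 = (b, k)\<close> and \<open>v2 = (q - b, a - k)\<close> form a basis of the lattice and add up to
  \<open>(q, a)\<close>. If the disc of \<open>(q, a)\<close> is met and neither parent is, then the offsets \<open>X1\<close>, \<open>X2\<close> have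
  opposite signs because their sum is small. A point \<open>\<alpha> v1 + \<beta> v2\<close> of positive abscissa below \<open>q\<close>
  has \<open>\<alpha>\<close> and \<open>\<beta>\<close> of opposite signs, one of them possibly zero, so its offset \<open>\<alpha> X1 + \<beta> X2\<close> is too
  large for a hit: the parents alone decide whether the disc of \<open>(q, a)\<close> is visible.
\<close>

lemma first_hit_iff:
  fixes q :: nat and a b k :: int
  assumes \<epsilon>: "0 < \<epsilon>" and b: "1 \<le> b" "b < int q" and k: "a * b = 1 + int q * k"
    and w: "0 \<le> \<omega>" "\<omega> \<le> pi/4"
  defines "X1 \<equiv> of_int b * sin \<omega> - of_int k * cos \<omega>"
    and "X2 \<equiv> of_int (int q - b) * sin \<omega> - of_int (a - k) * cos \<omega>"
  shows "\<omega> \<in> first_hit \<epsilon> q a \<longleftrightarrow> \<bar>offset \<omega> q a\<bar> \<le> \<epsilon> \<and> \<epsilon> < X1 \<and> X2 < - \<epsilon>"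
proof
  note cs = sector_bounds[OF w]
  have sum: "X1 + X2 = offset \<omega> q a" by (simp add: X1_def X2_def offset_def algebra_simps)
  show "\<bar>offset \<omega> q a\<bar> \<le> \<epsilon> \<and> \<epsilon> < X1 \<and> X2 < - \<epsilon>" if h: "\<omega> \<in> first_hit \<epsilon> q a"
  proof -
    have X: "\<bar>offset \<omega> q a\<bar> \<le> \<epsilon>" using h by (simp add: first_hit_def)
    have "X1 = offset \<omega> (nat b) k" "X2 = offset \<omega> (nat (int q - b)) (a - k)"
      using b by (auto simp: X1_def X2_def offset_def)
    moreover have "nat b \<in> {1..<q}" "nat (int q - b) \<in> {1..<q}" using b by auto
    then have "\<epsilon> < \<bar>offset \<omega> (nat b) k\<bar>" "\<epsilon> < \<bar>offset \<omega> (nat (int q - b)) (a - k)\<bar>"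
      using h unfolding first_hit_def by blast+
    ultimately have 12: "\<epsilon> < \<bar>X1\<bar>" "\<epsilon> < \<bar>X2\<bar>" by auto
    have kr: "of_int a * of_int b = 1 + real q * of_int k"
      using arg_cong[OF k, of "of_int :: int \<Rightarrow> real"] by simp
    have "of_int b * X2 - of_int (int q - b) * X1 = (real q * of_int k - of_int a * of_int b) * cos \<omega>"
      by (simp add: X1_def X2_def algebra_simps)
    also have "\<dots> = - cos \<omega>" using kr by simp
    \<comment> \<open>this excludes that the ray passes on the far sides of both parents\<close>
    finally have det: "of_int b * X2 - of_int (int q - b) * X1 < 0" using cs by simp
    have "\<not> (X1 < 0 \<and> 0 < X2)"
    proof
      assume "X1 < 0 \<and> 0 < X2"
      then have "0 \<le> of_int b * X2" "of_int (int q - b) * X1 \<le> 0" using b by (auto simp: mult_le_0_iff)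
      then show False using det by linarith
    qed
    then show ?thesis using 12 X sum \<epsilon> by linarith
  qed
  show "\<omega> \<in> first_hit \<epsilon> q a" if h: "\<bar>offset \<omega> q a\<bar> \<le> \<epsilon> \<and> \<epsilon> < X1 \<and> X2 < - \<epsilon>"
    unfolding first_hit_def
  proof (safe)
    fix q' a' assume q': "q' \<in> {1..<q}"
    \<comment> \<open>coordinates of \<open>(q', a')\<close> in the basis \<open>v1\<close>, \<open>v2\<close>, by Cramer's rule\<close>
    define \<alpha> where "\<alpha> = int q' * (a - k) - a' * (int q - b)"
    define \<beta> where "\<beta> = b * a' - k * int q'"
    have q'eq: "int q' = \<alpha> * b + \<beta> * (int q - b)"
    proof -
      have "\<alpha> * b + \<beta> * (int q - b) = int q' * (a * b - int q * k)" by (simp add: \<alpha>_def \<beta>_def algebra_simps)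
      then show ?thesis using k by simp
    qed
    have a'eq: "a' = \<alpha> * k + \<beta> * (a - k)"
    proof -
      have "\<alpha> * k + \<beta> * (a - k) = a' * (a * b - int q * k)" by (simp add: \<alpha>_def \<beta>_def algebra_simps)
      then show ?thesis using k by simp
    qed
    have off: "offset \<omega> q' a' = of_int \<alpha> * X1 + of_int \<beta> * X2"
    proof -
      have e1: "real q' = of_int \<alpha> * of_int b + of_int \<beta> * of_int (int q - b)"
        using q'eq by (metis of_int_add of_int_mult of_int_of_nat_eq)
      have e2: "(of_int a' :: real) = of_int \<alpha> * of_int k + of_int \<beta> * of_int (a - k)"
        using a'eq by (metis of_int_add of_int_mult)
      show ?thesis unfolding offset_def e1 e2 X1_def X2_def by (simp add: algebra_simps)
    qed
    consider "\<alpha> \<ge> 1" "\<beta> \<ge> 1" | "\<alpha> \<le> 0" "\<beta> \<le> 0" | "\<alpha> \<ge> 1" "\<beta> \<le> 0" | "\<alpha> \<le> 0" "\<beta> \<ge> 1" by linarith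
    then show "\<epsilon> < \<bar>offset \<omega> q' a'\<bar>"
    proof cases
      case 1
      then have "1 * b \<le> \<alpha> * b" "1 * (int q - b) \<le> \<beta> * (int q - b)" using b by (intro mult_right_mono; simp)+
      then show ?thesis using q'eq q' by simp
    next
      case 2
      then have "\<alpha> * b \<le> 0" "\<beta> * (int q - b) \<le> 0" using b by (auto simp: mult_le_0_iff)
      then show ?thesis using q'eq q' by simp
    next
      case 3
      have "1 * X1 \<le> of_int \<alpha> * X1" using 3 h \<epsilon> by (intro mult_right_mono) auto
      moreover have "0 \<le> of_int \<beta> * X2" using 3 h \<epsilon> by (intro mult_nonpos_nonpos) auto
      ultimately show ?thesis unfolding off using h by linarith
    next
      case 4
      have "of_int \<beta> * X2 \<le> 1 * X2" using 4 h \<epsilon> by (intro mult_right_mono_neg) auto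
      moreover have "of_int \<alpha> * X1 \<le> 0" using 4 h \<epsilon> by (intro mult_nonpos_nonneg) auto
      ultimately show ?thesis unfolding off using h by linarith
    qed
  qed (use w h in auto)
qed

lemma first_hit_measurable [measurable]: "first_hit \<epsilon> q a \<in> sets borel"
proof -
  have [measurable]: "(\<lambda>\<omega>. offset \<omega> q a) \<in> borel_measurable borel" for q a unfolding offset_def by measurable
  have "{\<omega> \<in> space borel. 0 \<le> \<omega> \<and> \<omega> \<le> pi/4 \<and> \<bar>offset \<omega> q a\<bar> \<le> \<epsilon> \<and>
     (\<forall>q'\<in>{1..<q}. \<forall>a'. \<epsilon> < \<bar>offset \<omega> q' a'\<bar>)} \<in> sets borel" by measurable
  then show ?thesis by (simp add: first_hit_def)
qed

section \<open>The visible part of a scatterer\<close>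

lemma arcsin_bounds_cubic:
  assumes x: "0 \<le> x" "x \<le> 1/2"
  shows "x \<le> arcsin x" "arcsin x \<le> x + x ^ 3"
proof -
  have pi2: "x \<le> pi / 2" "x + x ^ 3 \<le> pi / 2"
  proof -
    have "x ^ 3 \<le> (1/2) ^ 3" using x by (intro power_mono) auto
    then show "x + x ^ 3 \<le> pi / 2" "x \<le> pi / 2" using x pi_gt3 by (auto simp: power3_eq_cube)
  qed
  have "arcsin (sin x) \<le> arcsin x"
    using x sin_x_le_x[of x] by (intro arcsin_le_arcsin) auto
  then show "x \<le> arcsin x" using x pi2 by (simp add: arcsin_sin)
  define s where "s = x + x ^ 3"
  have s0: "s \<ge> 0" using x by (simp add: s_def)
  have "s ^ 3 = x ^ 3 * (1 + x\<^sup>2) ^ 3" by (simp add: s_def power_mult_distrib[symmetric] algebra_simps power2_eq_square power3_eq_cube)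
  also have "\<dots> \<le> x ^ 3 * (1 + (1/2)\<^sup>2) ^ 3" using x by (intro mult_left_mono power_mono add_left_mono) auto
  also have "\<dots> \<le> x ^ 3 * 6" using x by (intro mult_left_mono) (auto simp: power3_eq_cube power2_eq_square)
  finally have "x \<le> s - s ^ 3 / 6" by (simp add: s_def)
  also have "\<dots> \<le> sin s" by (rule sin_lower_bound_cubic[OF s0])
  finally have "arcsin x \<le> arcsin (sin s)" using x by (intro arcsin_le_arcsin) auto
  then show "arcsin x \<le> x + x ^ 3" using s0 pi2 by (simp add: arcsin_sin s_def)
qed

lemma trunc_ratio_lipschitz:
  fixes b b' c :: real
  assumes b: "1 \<le> b" "1 \<le> b'"
  shows "\<bar>trunc_ratio c b - trunc_ratio c b'\<bar> \<le> \<bar>b - b'\<bar>"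
proof -
  have *: "\<bar>trunc_ratio c b - trunc_ratio c b'\<bar> \<le> b' - b" if b: "1 \<le> b" "b \<le> b'" for b b' :: real
  proof -
    consider "c \<le> 0" | "0 < c" "c \<le> b" | "b < c" "c \<le> b'" | "b' < c" by linarith
    then show ?thesis
    proof cases
      case 1
      then have "c / b \<le> 0" "c / b' \<le> 0" using b by (auto simp: divide_le_0_iff)
      then show ?thesis using b by (simp add: trunc_ratio_def)
    next
      case 2
      have d: "c / b - c / b' = (c / b) * ((b' - b) / b')" using b by (simp add: field_simps)
      have "(b' - b) / b' \<le> (b' - b) / 1" using b by (intro divide_left_mono) auto
      then have "0 \<le> (c / b) * ((b' - b) / b')" "(c / b) * ((b' - b) / b') \<le> 1 * (b' - b)"
        using 2 b by (simp, intro mult_mono) (auto simp: divide_le_eq)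
      moreover have "trunc_ratio c b = c / b" "trunc_ratio c b' = c / b'" using 2 b by (auto simp: trunc_ratio_def)
      ultimately show ?thesis using d by simp
    next
      case 3
      have "trunc_ratio c b = 1" "trunc_ratio c b' = c / b'" using 3 b by (auto simp: trunc_ratio_def)
      moreover have "1 - c / b' = (b' - c) / b'" using b by (simp add: field_simps)
      moreover have "(b' - c) / b' \<le> (b' - c) / 1" by (rule divide_left_mono) (use 3 b in auto)
      moreover have "0 \<le> (b' - c) / b'" using 3 b by simp
      ultimately show ?thesis using 3 by simp
    next
      case 4
      then have "trunc_ratio c b = 1" "trunc_ratio c b' = 1" using b by (auto simp: trunc_ratio_def)
      then show ?thesis using b by simp
    qed
  qed
  show ?thesis using *[of b b'] *[of b' b] b by (cases "b \<le> b'") (auto simp: abs_minus_commute)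
qed

text \<open>
  The arcs are replaced by their sines. An arc \<open>1 / (n n')\<close> between two lattice directions need not
  be short compared with \<open>\<epsilon>\<close>; but when it is long the minimum is the half arc \<open>\<epsilon> / n\<close>, and otherwise
  \<open>1 / n \<le> 3 \<epsilon>\<close>, so that the cubic error is again of order \<open>\<epsilon>\<^sup>3\<close>.
\<close>

lemma visible_side_approx:
  fixes \<epsilon> n n' :: real
  assumes \<epsilon>: "0 < \<epsilon>" "\<epsilon> \<le> 1/8" and n: "2 \<le> n" "n \<le> 3 / \<epsilon>" "1 \<le> n'" "n' \<le> n"
  shows "\<bar>min (arcsin (\<epsilon> / n)) (arcsin (1 / (n * n')) - arcsin (\<epsilon> / n')) - min (\<epsilon> / n) (1 / (n * n') - \<epsilon> / n')\<bar> \<le> 28 * \<epsilon> ^ 3"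
proof -
  have np: "n > 0" "n' > 0" using n by auto
  have e1: "0 \<le> \<epsilon> / n" "\<epsilon> / n \<le> \<epsilon>" "\<epsilon> / n \<le> 1/2"
    using \<epsilon> n by (auto simp: divide_le_eq mult_le_cancel_left1 intro: order_trans[of _ \<epsilon>])
  have e2: "0 \<le> \<epsilon> / n'" "\<epsilon> / n' \<le> \<epsilon>" "\<epsilon> / n' \<le> 1/2"
    using \<epsilon> n by (auto simp: divide_le_eq mult_le_cancel_left1 intro: order_trans[of _ \<epsilon>])
  have nn: "2 * 1 \<le> n * n'" using n by (intro mult_mono) auto
  have e3: "0 \<le> 1 / (n * n')" "1 / (n * n') \<le> 1/2" using nn by (auto simp: divide_le_eq)
  have c1: "(\<epsilon> / n) ^ 3 \<le> \<epsilon> ^ 3" "(\<epsilon> / n') ^ 3 \<le> \<epsilon> ^ 3" using e1 e2 by (intro power_mono; simp)+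
  note a1 = arcsin_bounds_cubic[OF e1(1,3)] and a2 = arcsin_bounds_cubic[OF e2(1,3)] and a3 = arcsin_bounds_cubic[OF e3]
  have ep: "\<epsilon> ^ 3 > 0" using \<epsilon> by simp
  have A: "\<bar>arcsin (\<epsilon> / n) - \<epsilon> / n\<bar> \<le> \<epsilon> ^ 3" using a1 c1 by linarith
  define D where "D = arcsin (1 / (n * n')) - arcsin (\<epsilon> / n')"
  define D0 where "D0 = 1 / (n * n') - \<epsilon> / n'"
  show ?thesis
  proof (cases "2 * (\<epsilon> / n) \<le> D0")
    case True
    have small: "2 * \<epsilon> ^ 3 \<le> \<epsilon> / n"
    proof -
      have "2 * \<epsilon> ^ 3 = \<epsilon> * (2 * \<epsilon> * \<epsilon>)" by (simp add: power3_eq_cube)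
      also have "\<dots> \<le> \<epsilon> * (1 / 4 * \<epsilon>)" using \<epsilon> by (intro mult_left_mono mult_right_mono) auto
      also have "\<dots> \<le> \<epsilon> * (1 / n)"
      proof (rule mult_left_mono)
        have "n * \<epsilon> \<le> 3" using n(2) \<epsilon> by (simp add: le_divide_eq)
        then show "1 / 4 * \<epsilon> \<le> 1 / n" using np by (simp add: field_simps)
      qed (use \<epsilon> in simp)
      finally show ?thesis by simp
    qed
    have "D \<ge> D0 - \<epsilon> ^ 3" using a2 a3 c1 unfolding D_def D0_def by linarith
    then have "D \<ge> arcsin (\<epsilon> / n)" using True small A by linarith
    moreover have "D0 \<ge> \<epsilon> / n" using True e1 by linarith
    ultimately have "min (arcsin (\<epsilon> / n)) D = arcsin (\<epsilon> / n)" "min (\<epsilon> / n) D0 = \<epsilon> / n" by auto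
    then show ?thesis using A ep unfolding D_def[symmetric] D0_def[symmetric] by simp
  next
    case False
    have "1 / n \<le> 3 * \<epsilon>"
    proof -
      have "n * n' * D0 < n * n' * (2 * (\<epsilon> / n))" using False np by (intro mult_strict_left_mono) auto
      moreover have "n * n' * D0 = 1 - n * \<epsilon>" using np by (simp add: D0_def field_simps)
      moreover have "n * n' * (2 * (\<epsilon> / n)) = 2 * (n' * \<epsilon>)" using np by simp
      moreover have "n' * \<epsilon> \<le> n * \<epsilon>" using n \<epsilon> by simp
      ultimately have "1 \<le> 3 * (n * \<epsilon>)" by linarith
      then show ?thesis using np by (simp add: field_simps)
    qed
    have "1 / (n * n') \<le> 1 / n" using n by (intro divide_left_mono) (auto simp: mult_le_cancel_left1)
    then have "1 / (n * n') \<le> 3 * \<epsilon>" using \<open>1 / n \<le> 3 * \<epsilon>\<close> by simp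
    then have "(1 / (n * n')) ^ 3 \<le> (3 * \<epsilon>) ^ 3" using e3 by (intro power_mono) auto
    then have c3: "(1 / (n * n')) ^ 3 \<le> 27 * \<epsilon> ^ 3" by (simp add: power_mult_distrib)
    have "\<bar>D - D0\<bar> \<le> 27 * \<epsilon> ^ 3" using a2 a3 c1 c3 ep unfolding D_def D0_def by linarith
    then show ?thesis using A ep unfolding D_def[symmetric] D0_def[symmetric] by (auto simp: min_def)
  qed
qed

lemma polar_slope:
  fixes c d :: real
  assumes "c > 0" "d \<ge> 0"
  defines "n \<equiv> sqrt (c\<^sup>2 + d\<^sup>2)" and "\<theta> \<equiv> arctan (d / c)"
  shows "c = n * cos \<theta>" "d = n * sin \<theta>" "0 \<le> \<theta>" "\<theta> < pi/2" "n > 0"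
    "c * sin \<omega> - d * cos \<omega> = n * sin (\<omega> - \<theta>)"
proof -
  show n: "n > 0" using assms by (simp add: n_def add_pos_nonneg)
  have e: "sqrt (1 + (d / c)\<^sup>2) = n / c"
  proof -
    have "1 + (d / c)\<^sup>2 = (c\<^sup>2 + d\<^sup>2) / c\<^sup>2" using assms by (simp add: field_simps)
    then show ?thesis using assms by (simp add: n_def real_sqrt_divide)
  qed
  show c: "c = n * cos \<theta>" using assms n by (simp add: \<theta>_def cos_arctan e)
  show d: "d = n * sin \<theta>" using assms n by (simp add: \<theta>_def sin_arctan e)
  show "0 \<le> \<theta>" using assms by (simp add: \<theta>_def)
  show "\<theta> < pi/2" unfolding \<theta>_def by (rule arctan_ubound)
  have "c * sin \<omega> - d * cos \<omega> = n * cos \<theta> * sin \<omega> - n * sin \<theta> * cos \<omega>" using c d by simp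
  also have "\<dots> = n * sin (\<omega> - \<theta>)" by (simp add: sin_diff algebra_simps)
  finally show "c * sin \<omega> - d * cos \<omega> = n * sin (\<omega> - \<theta>)" .
qed

lemma measure_between_Icc_Ioo:
  fixes S :: "real set"
  assumes "S \<in> sets borel" "{lo<..<hi} \<subseteq> S" "S \<subseteq> {lo..hi}"
  shows "measure lborel S = max 0 (hi - lo)"
proof (cases "lo \<le> hi")
  case True
  have Icc: "{lo..hi} \<in> fmeasurable lborel"
    by (rule fmeasurableI) (auto simp: emeasure_lborel_Icc_eq)
  have S: "S \<in> fmeasurable lborel"
    by (rule fmeasurableI2[OF Icc assms(3)]) (use assms(1) in simp)
  have "measure lborel {lo<..<hi} \<le> measure lborel S"
    by (rule measure_mono_fmeasurable[OF assms(2) _ S]) simp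
  moreover have "measure lborel S \<le> measure lborel {lo..hi}"
    by (rule measure_mono_fmeasurable[OF assms(3) _ Icc]) (use assms(1) in simp)
  ultimately show ?thesis using True by simp
next
  case False
  then have "S = {}" using assms(3) by auto
  then show ?thesis using False by simp
qed

lemma arcsin_le_diff_iff:
  fixes y t :: real
  assumes "\<bar>y\<bar> \<le> 1" "-(pi/2) \<le> t" "t \<le> pi/2"
  shows "y \<le> sin t \<longleftrightarrow> arcsin y \<le> t" "sin t \<le> y \<longleftrightarrow> t \<le> arcsin y" "y < sin t \<longleftrightarrow> arcsin y < t" "sin t < y \<longleftrightarrow> t < arcsin y"
proof -
  show 1: "y \<le> sin t \<longleftrightarrow> arcsin y \<le> t" using assms by (intro arcsin_le_iff[symmetric]) auto
  show 2: "sin t \<le> y \<longleftrightarrow> t \<le> arcsin y" using assms by (intro le_arcsin_iff[symmetric]) auto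
  show "y < sin t \<longleftrightarrow> arcsin y < t" using 2 by (simp add: not_le[symmetric])
  show "sin t < y \<longleftrightarrow> t < arcsin y" using 1 by (simp add: not_le[symmetric])
qed

text \<open>
  The directions seen form an interval with centre \<open>\<theta>\<close>, the direction of \<open>(q, a)\<close>. On each
  side it extends to the edge of the disc of \<open>(q, a)\<close> or to the edge of the disc of the parent,
  whichever is closer, and the angle to the parent has sine \<open>1 / (n n1)\<close> or \<open>1 / (n n2)\<close> since the
  determinant is \<open>1\<close>. The two contributions are added; a negative sum means that the disc is hidden.
\<close>

lemma measure_first_hit:
  fixes q :: nat and a b k :: int
  assumes \<epsilon>: "0 < \<epsilon>" "\<epsilon> \<le> 1/8" and ab: "1 \<le> a" "a < int q" "1 \<le> b" "b < int q" and k: "a * b = 1 + int q * k"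
  defines "n \<equiv> sqrt ((real q)\<^sup>2 + (of_int a)\<^sup>2)" and "n1 \<equiv> sqrt ((of_int b)\<^sup>2 + (of_int k)\<^sup>2)"
    and "n2 \<equiv> sqrt ((of_int (int q - b))\<^sup>2 + (of_int (a - k))\<^sup>2)"
  shows "measure lborel (first_hit \<epsilon> q a) = max 0 (
     min (arcsin (\<epsilon> / n)) (arcsin (1 / (n * n1)) - arcsin (\<epsilon> / n1)) +
     min (arcsin (\<epsilon> / n)) (arcsin (1 / (n * n2)) - arcsin (\<epsilon> / n2)))"
    "1 \<le> n1" "n1 \<le> n" "1 \<le> n2" "n2 \<le> n"
proof -
  have q0: "real q > 0" using ab by simp
  have k0: "0 \<le> k"
  proof -
    have "1 * 1 \<le> a * b" using ab by (intro mult_mono) auto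
    then have "0 \<le> int q * k" using k by simp
    then show ?thesis using ab by (simp add: zero_le_mult_iff)
  qed
  have ka: "k < a"
  proof -
    have "int q * k < a * b" using k by simp
    also have "\<dots> \<le> a * int q" using ab by (intro mult_left_mono) auto
    finally show ?thesis using ab by (simp add: mult.commute)
  qed
  define \<theta> \<theta>1 \<theta>2 where "\<theta> = arctan (of_int a / real q)" and "\<theta>1 = arctan (of_int k / of_int b)"
    and "\<theta>2 = arctan (of_int (a - k) / of_int (int q - b))"
  have pos: "(of_int b :: real) > 0" "(of_int (int q - b) :: real) > 0" "(0::real) \<le> of_int k" "(0::real) \<le> of_int (a - k)" "(0::real) \<le> of_int a"
    using ab k0 ka by auto
  note P = polar_slope[OF q0 pos(5), folded n_def \<theta>_def]
  note P1 = polar_slope[OF pos(1,3), folded n1_def \<theta>1_def]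
  note P2 = polar_slope[OF pos(2,4), folded n2_def \<theta>2_def]
  have bq: "(1::real) \<le> of_int b" "(1::real) \<le> of_int (int q - b)" using ab by auto
  show n1: "1 \<le> n1" unfolding n1_def using bq(1) by (intro real_le_rsqrt) (auto intro!: add_increasing2 simp: one_le_power)
  show n2: "1 \<le> n2" unfolding n2_def using bq(2) by (intro real_le_rsqrt) (auto intro!: add_increasing2 simp: one_le_power)
  show "n1 \<le> n" unfolding n1_def n_def using ab k0 ka
    by (intro real_sqrt_le_mono add_mono power_mono) auto
  show "n2 \<le> n" unfolding n2_def n_def using ab k0 ka
    by (intro real_sqrt_le_mono add_mono power_mono) auto
  have n: "1 \<le> n" using n1 \<open>n1 \<le> n\<close> by simp
  have kr: "of_int a * of_int b = 1 + real q * (of_int k :: real)"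
    using arg_cong[OF k, of "of_int :: int \<Rightarrow> real"] by simp
  have "sin (\<theta> - \<theta>1) = 1 / (n * n1)"
  proof -
    have "n * n1 * sin (\<theta> - \<theta>1) = (n * sin \<theta>) * (n1 * cos \<theta>1) - (n * cos \<theta>) * (n1 * sin \<theta>1)"
      by (simp add: sin_diff algebra_simps)
    also have "\<dots> = 1" using kr unfolding P(1,2)[symmetric] P1(1,2)[symmetric] by simp
    finally show ?thesis using n n1 by (simp add: field_simps)
  qed
  then have \<Delta>1: "\<theta> - \<theta>1 = arcsin (1 / (n * n1))"
    using P(3,4) P1(3,4) arcsin_sin[of "\<theta> - \<theta>1"] by simp
  have "sin (\<theta>2 - \<theta>) = 1 / (n * n2)"
  proof -
    have "n * n2 * sin (\<theta>2 - \<theta>) = (n2 * sin \<theta>2) * (n * cos \<theta>) - (n2 * cos \<theta>2) * (n * sin \<theta>)"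
      by (simp add: sin_diff algebra_simps)
    also have "\<dots> = of_int (a - k) * real q - of_int (int q - b) * of_int a"
      unfolding P(1,2)[symmetric] P2(1,2)[symmetric] by simp
    also have "\<dots> = 1" using kr by (simp add: algebra_simps)
    finally show ?thesis using n n2 by (simp add: field_simps)
  qed
  then have \<Delta>2: "\<theta>2 - \<theta> = arcsin (1 / (n * n2))"
    using P(3,4) P2(3,4) arcsin_sin[of "\<theta>2 - \<theta>"] by simp
  define \<alpha> \<alpha>1 \<alpha>2 where "\<alpha> = arcsin (\<epsilon> / n)" and "\<alpha>1 = arcsin (\<epsilon> / n1)" and "\<alpha>2 = arcsin (\<epsilon> / n2)"
  have y: "\<bar>\<epsilon> / n\<bar> \<le> 1" "\<bar>\<epsilon> / n1\<bar> \<le> 1" "\<bar>\<epsilon> / n2\<bar> \<le> 1" "\<bar>- (\<epsilon> / n)\<bar> \<le> 1" "\<bar>- (\<epsilon> / n2)\<bar> \<le> 1"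
    using n n1 n2 \<epsilon> by (auto simp: divide_le_eq)
  have neg: "arcsin (- (\<epsilon> / n)) = - \<alpha>" "arcsin (- (\<epsilon> / n2)) = - \<alpha>2"
    unfolding \<alpha>_def \<alpha>2_def using y(1,3) by (intro arcsin_minus; linarith)+
  define lo hi where "lo = max (\<theta> - \<alpha>) (\<theta>1 + \<alpha>1)" and "hi = min (\<theta> + \<alpha>) (\<theta>2 - \<alpha>2)"
  have iff: "\<omega> \<in> first_hit \<epsilon> q a \<longleftrightarrow> (\<theta> - \<alpha> \<le> \<omega> \<and> \<omega> \<le> \<theta> + \<alpha> \<and> \<theta>1 + \<alpha>1 < \<omega> \<and> \<omega> < \<theta>2 - \<alpha>2)"
    if w: "0 \<le> \<omega>" "\<omega> \<le> pi/4" for \<omega>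
  proof -
    have r: "-(pi/2) \<le> \<omega> - \<theta>" "\<omega> - \<theta> \<le> pi/2" "-(pi/2) \<le> \<omega> - \<theta>1" "\<omega> - \<theta>1 \<le> pi/2" "-(pi/2) \<le> \<omega> - \<theta>2" "\<omega> - \<theta>2 \<le> pi/2"
      using w P(3,4) P1(3,4) P2(3,4) by auto
    have o: "offset \<omega> q a = n * sin (\<omega> - \<theta>)" unfolding offset_def by (rule P(6))
    have "\<bar>offset \<omega> q a\<bar> \<le> \<epsilon> \<longleftrightarrow> - (\<epsilon> / n) \<le> sin (\<omega> - \<theta>) \<and> sin (\<omega> - \<theta>) \<le> \<epsilon> / n"
      unfolding o using n by (auto simp: abs_le_iff field_simps)
    also have "\<dots> \<longleftrightarrow> \<theta> - \<alpha> \<le> \<omega> \<and> \<omega> \<le> \<theta> + \<alpha>"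
      unfolding arcsin_le_diff_iff(1)[OF y(4) r(1,2)] arcsin_le_diff_iff(2)[OF y(1) r(1,2)]
      unfolding neg \<alpha>_def[symmetric] by auto
    finally have 1: "\<bar>offset \<omega> q a\<bar> \<le> \<epsilon> \<longleftrightarrow> \<theta> - \<alpha> \<le> \<omega> \<and> \<omega> \<le> \<theta> + \<alpha>" .
    have "\<epsilon> < of_int b * sin \<omega> - of_int k * cos \<omega> \<longleftrightarrow> \<epsilon> / n1 < sin (\<omega> - \<theta>1)"
      unfolding P1(6) using n1 by (auto simp: field_simps)
    also have "\<dots> \<longleftrightarrow> \<theta>1 + \<alpha>1 < \<omega>"
      unfolding arcsin_le_diff_iff(3)[OF y(2) r(3,4)] by (auto simp: \<alpha>1_def)
    finally have 2: "\<epsilon> < of_int b * sin \<omega> - of_int k * cos \<omega> \<longleftrightarrow> \<theta>1 + \<alpha>1 < \<omega>" .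
    have "of_int (int q - b) * sin \<omega> - of_int (a - k) * cos \<omega> < - \<epsilon> \<longleftrightarrow> sin (\<omega> - \<theta>2) < - (\<epsilon> / n2)"
      unfolding P2(6) using n2 by (auto simp: field_simps)
    also have "\<dots> \<longleftrightarrow> \<omega> < \<theta>2 - \<alpha>2"
      unfolding arcsin_le_diff_iff(4)[OF y(5) r(5,6)] neg by auto
    finally have 3: "of_int (int q - b) * sin \<omega> - of_int (a - k) * cos \<omega> < - \<epsilon> \<longleftrightarrow> \<omega> < \<theta>2 - \<alpha>2" .
    show ?thesis unfolding first_hit_iff[OF \<epsilon>(1) ab(3,4) k w] 1 2 3 by blast
  qed
  \<comment> \<open>the whole arc lies inside the sector, because \<open>1 \<le> a\<close> and \<open>a + 1 \<le> q\<close>\<close>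
  have ymono: "arcsin (\<epsilon> / n) \<le> \<theta>"
  proof -
    have "\<epsilon> / n \<le> sin \<theta>"
    proof -
      have "\<epsilon> \<le> n * sin \<theta>" using P(2) ab \<epsilon> by linarith
      then show ?thesis using n by (simp add: divide_le_eq mult.commute)
    qed
    then show ?thesis using arcsin_le_diff_iff(1)[OF y(1), of \<theta>] P(3,4) by simp
  qed
  have ymono': "arcsin (\<epsilon> / n) \<le> pi/4 - \<theta>"
  proof -
    have "\<epsilon> / n \<le> sin (pi/4 - \<theta>)"
    proof -
      have "n * sin (pi/4 - \<theta>) = sqrt 2 / 2 * (n * cos \<theta> - n * sin \<theta>)"
        by (simp add: sin_diff sin_45 cos_45 algebra_simps)
      also have "\<dots> = sqrt 2 / 2 * (real q - of_int a)" using P(1,2) by simp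
      finally have e: "n * sin (pi/4 - \<theta>) = sqrt 2 / 2 * (real q - of_int a)" .
      have "1 \<le> sqrt 2" by simp
      then have "1/2 * 1 \<le> sqrt 2 / 2 * (real q - of_int a)" using ab by (intro mult_mono) auto
      then have "\<epsilon> \<le> n * sin (pi/4 - \<theta>)" using e \<epsilon> by linarith
      then show ?thesis using n by (simp add: divide_le_eq mult.commute)
    qed
    then show ?thesis using arcsin_le_diff_iff(1)[OF y(1), of "pi/4 - \<theta>"] P(3,4) by simp
  qed
  have sub: "{lo<..<hi} \<subseteq> first_hit \<epsilon> q a"
  proof
    fix \<omega> assume "\<omega> \<in> {lo<..<hi}"
    then have h: "\<theta> - \<alpha> < \<omega>" "\<omega> < \<theta> + \<alpha>" "\<theta>1 + \<alpha>1 < \<omega>" "\<omega> < \<theta>2 - \<alpha>2" by (auto simp: lo_def hi_def)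
    then have "0 \<le> \<omega>" "\<omega> \<le> pi/4" using ymono ymono' unfolding \<alpha>_def by linarith+
    then show "\<omega> \<in> first_hit \<epsilon> q a" using iff h by auto
  qed
  have sup: "first_hit \<epsilon> q a \<subseteq> {lo..hi}"
  proof
    fix \<omega> assume w: "\<omega> \<in> first_hit \<epsilon> q a"
    then have "0 \<le> \<omega>" "\<omega> \<le> pi/4" by (auto simp: first_hit_def)
    then show "\<omega> \<in> {lo..hi}" using iff w by (auto simp: lo_def hi_def)
  qed
  have "measure lborel (first_hit \<epsilon> q a) = max 0 (hi - lo)"
    by (rule measure_between_Icc_Ioo[OF first_hit_measurable sub sup])
  also have "hi - lo = min \<alpha> (\<theta> - \<theta>1 - \<alpha>1) + min \<alpha> (\<theta>2 - \<theta> - \<alpha>2)"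
    unfolding hi_def lo_def by (auto simp: min_def max_def)
  finally show "measure lborel (first_hit \<epsilon> q a) = max 0 (
     min (arcsin (\<epsilon> / n)) (arcsin (1 / (n * n1)) - arcsin (\<epsilon> / n1)) +
     min (arcsin (\<epsilon> / n)) (arcsin (1 / (n * n2)) - arcsin (\<epsilon> / n2)))"
    unfolding \<Delta>1 \<Delta>2 \<alpha>_def \<alpha>1_def \<alpha>2_def .
qed

lemma sqrt_sum_squares_diff_le:
  fixes x y z :: real
  shows "\<bar>sqrt (z\<^sup>2 + x\<^sup>2) - sqrt (z\<^sup>2 + y\<^sup>2)\<bar> \<le> \<bar>x - y\<bar>"
proof -
  have "\<bar>norm (Complex z x) - norm (Complex z y)\<bar> \<le> norm (Complex z x - Complex z y)"
    by (rule norm_triangle_ineq3)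
  then show ?thesis by (simp add: cmod_def)
qed

lemma lattice_norm_le:
  fixes a :: int and q :: nat
  assumes "0 \<le> a" "a \<le> int q"
  shows "sqrt ((real q)\<^sup>2 + (of_int a)\<^sup>2) \<le> 2 * real q"
proof -
  have "(of_int a :: real)\<^sup>2 \<le> (real q)\<^sup>2" using assms by (intro power_mono) auto
  moreover have "(2 * real q)\<^sup>2 = 4 * (real q)\<^sup>2" by (simp add: power_mult_distrib)
  moreover have "0 \<le> (real q)\<^sup>2" by simp
  ultimately have "(real q)\<^sup>2 + (of_int a)\<^sup>2 \<le> (2 * real q)\<^sup>2" by linarith
  then show ?thesis by (intro real_le_lsqrt) auto
qed

lemma nat_ceiling_inverse_le:
  fixes \<epsilon> :: real
  assumes "0 < \<epsilon>" "\<epsilon> \<le> 1/8"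
  shows "real (nat \<lceil>1/\<epsilon>\<rceil>) \<le> 9 / (8 * \<epsilon>)"
proof -
  have "8 \<le> 1 / \<epsilon>" using assms by (simp add: field_simps)
  then have "real (nat \<lceil>1/\<epsilon>\<rceil>) \<le> 9/8 * (1 / \<epsilon>)" by linarith
  then show ?thesis by simp
qed

text \<open>
  After the replacement of arcs by sines, each half arc is \<open>\<epsilon> / n\<close> times a truncated ratio with the
  length \<open>n1\<close> or \<open>n'\<close> of the parent in place of its abscissa. The slope of a parent differs from
  \<open>a / q\<close> by \<open>1 / q\<close> divided by its abscissa, so its length is its abscissa times \<open>n / q\<close> up to
  \<open>1 / q\<close>, and the ratio is Lipschitz in this length.
\<close>

lemma first_hit_weight_approx:
  fixes \<epsilon> r :: real and q :: nat
  assumes \<epsilon>: "0 < \<epsilon>" "\<epsilon> \<le> 1/8" and r: "r > 0" and q: "2 \<le> q" "q \<le> nat \<lceil>1/\<epsilon>\<rceil>" and P: "(a, b) \<in> inverse_pairs q"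
  defines "n \<equiv> sqrt ((real q)\<^sup>2 + (of_int a)\<^sup>2)"
  shows "\<bar>(\<epsilon> * n) powr r * measure lborel (first_hit \<epsilon> q a) - lattice_term \<epsilon> r q a b\<bar> \<le> 3 powr r * (56 * \<epsilon> ^ 3 + 2 * \<epsilon> / real q ^ 2)"
proof -
  have ab: "0 \<le> a" "a < int q" "0 \<le> b" "b < int q" "[a * b = 1] (mod int q)" using P by (auto simp: inverse_pairs_def)
  have "a \<noteq> 0" "b \<noteq> 0" using ab(5) q by (auto simp: cong_def)
  then have ab1: "1 \<le> a" "1 \<le> b" using ab by auto
  have "int q dvd a * b - 1" using ab(5) by (simp add: cong_iff_dvd_diff)
  then obtain k where "a * b - 1 = int q * k" by blast
  then have k: "a * b = 1 + int q * k" by simp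
  have q0: "real q \<ge> 2" using q by simp
  have nq: "real q \<le> n" unfolding n_def by (rule real_le_rsqrt) simp
  have n2q: "n \<le> 2 * real q" unfolding n_def by (rule lattice_norm_le) (use ab in auto)
  have n2: "2 \<le> n" "n > 0" using nq q0 by auto
  have qe: "real q \<le> 9 / (8 * \<epsilon>)" using q(2) nat_ceiling_inverse_le[OF \<epsilon>] by linarith
  have n3: "n \<le> 3 / \<epsilon>"
  proof -
    have "n \<le> 2 * (9 / (8 * \<epsilon>))" using n2q qe by linarith
    also have "\<dots> \<le> 3 / \<epsilon>" using \<epsilon> by (simp add: field_simps)
    finally show ?thesis .
  qed
  define n1 where "n1 = sqrt ((of_int b)\<^sup>2 + (of_int k)\<^sup>2 :: real)"
  define n' where "n' = sqrt ((of_int (int q - b))\<^sup>2 + (of_int (a - k))\<^sup>2 :: real)"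
  note M = measure_first_hit[OF \<epsilon> ab1(1) ab(2) ab1(2) ab(4) k, folded n_def n1_def n'_def]
  define X where "X = measure lborel (first_hit \<epsilon> q a)"
  define c where "c = real q / (\<epsilon> * n) - real q"
  define C where "C = 1 / \<epsilon> - n"
  define x1 where "x1 = min (arcsin (\<epsilon> / n)) (arcsin (1 / (n * n1)) - arcsin (\<epsilon> / n1))"
  define x2 where "x2 = min (arcsin (\<epsilon> / n)) (arcsin (1 / (n * n')) - arcsin (\<epsilon> / n'))"
  define m1 where "m1 = min (\<epsilon> / n) (1 / (n * n1) - \<epsilon> / n1)"
  define m2 where "m2 = min (\<epsilon> / n) (1 / (n * n') - \<epsilon> / n')"
  have "\<bar>x1 - m1\<bar> \<le> 28 * \<epsilon> ^ 3" unfolding x1_def m1_def by (rule visible_side_approx[OF \<epsilon> n2(1) n3 M(2,3)])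
  moreover have "\<bar>x2 - m2\<bar> \<le> 28 * \<epsilon> ^ 3" unfolding x2_def m2_def by (rule visible_side_approx[OF \<epsilon> n2(1) n3 M(4,5)])
  moreover have "X = max 0 (x1 + x2)" unfolding X_def M(1) x1_def x2_def ..
  ultimately have e1: "\<bar>X - max 0 (m1 + m2)\<bar> \<le> 56 * \<epsilon> ^ 3" by linarith
  have e2: "max 0 (m1 + m2) = (\<epsilon> / n) * (trunc_ratio C n1 + trunc_ratio C n')"
  proof -
    have n1p: "n1 > 0" "n' > 0" using M by auto
    have q1: "1 / (n * n1) - \<epsilon> / n1 = (\<epsilon> / n) * (C / n1)" and q2: "1 / (n * n') - \<epsilon> / n' = (\<epsilon> / n) * (C / n')"
      using n1p n2 \<epsilon> by (auto simp: C_def field_simps)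
    have mm: "min (\<epsilon> / n) ((\<epsilon> / n) * t) = (\<epsilon> / n) * min 1 t" for t
      using n2 \<epsilon> by (simp add: min_mult_distrib_left)
    have m: "m1 = (\<epsilon> / n) * min 1 (C / n1)" "m2 = (\<epsilon> / n) * min 1 (C / n')"
      unfolding m1_def m2_def q1 q2 mm by (rule refl)+
    have en: "\<epsilon> / n \<ge> 0" using n2 \<epsilon> by simp
    show ?thesis
    proof (cases "C \<ge> 0")
      case True
      then have "0 \<le> C / n1" "0 \<le> C / n'" using n1p by auto
      then have "trunc_ratio C n1 = min 1 (C / n1)" "trunc_ratio C n' = min 1 (C / n')"
        by (auto simp: trunc_ratio_def)
      moreover have "m1 \<ge> 0" "m2 \<ge> 0"
        unfolding m using en \<open>0 \<le> C / n1\<close> \<open>0 \<le> C / n'\<close> by (intro mult_nonneg_nonneg; simp)+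
      ultimately show ?thesis using m by (simp add: algebra_simps)
    next
      case False
      then have neg: "C / n1 \<le> 0" "C / n' \<le> 0" using n1p by (auto simp: divide_le_0_iff)
      then have "trunc_ratio C n1 = 0" "trunc_ratio C n' = 0" by (auto simp: trunc_ratio_def)
      moreover have "m1 \<le> 0" "m2 \<le> 0"
        unfolding m using en neg by (intro mult_nonneg_nonpos; simp)+
      ultimately show ?thesis by simp
    qed
  qed
  have scale: "trunc_ratio C (y * (n / real q)) = trunc_ratio c y" if "y \<ge> 1" for y
  proof -
    have "C / (y * (n / real q)) = c / y" using that n2 q0 \<epsilon> by (simp add: C_def c_def field_simps)
    then show ?thesis by (simp add: trunc_ratio_def)
  qed
  have side: "\<bar>trunc_ratio C (sqrt (y\<^sup>2 + x\<^sup>2)) - trunc_ratio c y\<bar> \<le> 1 / real q"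
    if y: "y \<ge> 1" and x: "\<bar>x - y * of_int a / real q\<bar> = 1 / real q" for x y
  proof -
    have "y * (n / real q) = sqrt (y\<^sup>2 * (((real q)\<^sup>2 + (of_int a)\<^sup>2) / (real q)\<^sup>2))"
      using y q0 by (simp add: n_def real_sqrt_mult real_sqrt_divide)
    also have "y\<^sup>2 * (((real q)\<^sup>2 + (of_int a)\<^sup>2) / (real q)\<^sup>2) = y\<^sup>2 + (y * of_int a / real q)\<^sup>2"
      using q0 by (simp add: field_simps)
    finally have yn: "y * (n / real q) = sqrt (y\<^sup>2 + (y * of_int a / real q)\<^sup>2)" .
    have "1 * 1 \<le> y * (n / real q)" using y nq q0 by (intro mult_mono) auto
    then have yn1: "1 \<le> y * (n / real q)" by simp
    have "1 \<le> sqrt (y\<^sup>2 + x\<^sup>2)" using y by (intro real_le_rsqrt) (auto intro!: add_increasing2 simp: one_le_power)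
    then have "\<bar>trunc_ratio C (sqrt (y\<^sup>2 + x\<^sup>2)) - trunc_ratio C (y * (n / real q))\<bar> \<le> \<bar>sqrt (y\<^sup>2 + x\<^sup>2) - y * (n / real q)\<bar>"
      using yn1 by (rule trunc_ratio_lipschitz)
    also have "\<dots> \<le> \<bar>x - y * of_int a / real q\<bar>" unfolding yn by (rule sqrt_sum_squares_diff_le)
    finally show ?thesis using x scale[OF y] by simp
  qed
  have kr: "of_int a * of_int b = 1 + real q * (of_int k :: real)"
    using arg_cong[OF k, of "of_int :: int \<Rightarrow> real"] by simp
  have s1: "\<bar>trunc_ratio C n1 - trunc_ratio c (of_int b)\<bar> \<le> 1 / real q"
    unfolding n1_def
  proof (rule side)
    have "of_int k - of_int b * of_int a / real q = - (1 / real q)" using kr q0 by (simp add: field_simps)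
    then show "\<bar>of_int k - of_int b * of_int a / real q\<bar> = 1 / real q" by simp
  qed (use ab1 in simp)
  have s2: "\<bar>trunc_ratio C n' - trunc_ratio c (real q - of_int b)\<bar> \<le> 1 / real q"
  proof -
    have "\<bar>trunc_ratio C n' - trunc_ratio c (of_int (int q - b))\<bar> \<le> 1 / real q"
      unfolding n'_def
    proof (rule side)
      have "of_int (a - k) - of_int (int q - b) * of_int a / real q = 1 / real q" using kr q0 by (simp add: field_simps)
      then show "\<bar>of_int (a - k) - of_int (int q - b) * of_int a / real q\<bar> = 1 / real q" by simp
    qed (use ab in linarith)
    then show ?thesis by simp
  qed
  define T where "T = trunc_ratio c (of_int b) + trunc_ratio c (real q - of_int b)"
  have "\<bar>(\<epsilon> / n) * (trunc_ratio C n1 + trunc_ratio C n') - (\<epsilon> / n) * T\<bar> \<le> (\<epsilon> / n) * (2 * (1 / real q))"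
    unfolding right_diff_distrib[symmetric] abs_mult
  proof (intro mult_mono)
    show "\<bar>trunc_ratio C n1 + trunc_ratio C n' - T\<bar> \<le> 2 * (1 / real q)" using s1 s2 unfolding T_def by linarith
  qed (use \<epsilon> n2 in auto)
  also have "\<dots> \<le> (\<epsilon> / real q) * (2 * (1 / real q))"
    using nq q0 \<epsilon> by (intro mult_right_mono divide_left_mono) auto
  also have "\<dots> = 2 * \<epsilon> / real q ^ 2" by (simp add: power2_eq_square)
  finally have e3: "\<bar>X - (\<epsilon> / n) * T\<bar> \<le> 56 * \<epsilon> ^ 3 + 2 * \<epsilon> / real q ^ 2"
    by (rule abs_diff_triangle[OF e1[unfolded e2]])
  have en3: "0 < \<epsilon> * n" "\<epsilon> * n \<le> 3" using \<epsilon> n2 n3 by (auto simp: field_simps)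
  have lt: "lattice_term \<epsilon> r q a b = (\<epsilon> * n) powr r * ((\<epsilon> / n) * T)"
  proof -
    have "(\<epsilon> * n) powr (r - 1) = (\<epsilon> * n) powr r / (\<epsilon> * n)" using en3 by (simp add: powr_diff)
    moreover have "lattice_term \<epsilon> r q a b = \<epsilon>\<^sup>2 * (\<epsilon> * n) powr (r - 1) * T"
      unfolding lattice_term_def Let_def T_def c_def n_def by (rule refl)
    moreover have "\<epsilon>\<^sup>2 * ((\<epsilon> * n) powr r / (\<epsilon> * n)) * T = (\<epsilon> * n) powr r * ((\<epsilon> / n) * T)"
      using \<epsilon> n2 by (simp add: power2_eq_square)
    ultimately show ?thesis by simp
  qed
  have "\<bar>(\<epsilon> * n) powr r * X - lattice_term \<epsilon> r q a b\<bar> = (\<epsilon> * n) powr r * \<bar>X - (\<epsilon> / n) * T\<bar>"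
    unfolding lt right_diff_distrib[symmetric] abs_mult by simp
  also have "\<dots> \<le> 3 powr r * (56 * \<epsilon> ^ 3 + 2 * \<epsilon> / real q ^ 2)"
    using en3 r e3 by (intro mult_mono powr_mono2) auto
  finally show ?thesis by (simp add: X_def)
qed

definition hit_weight :: "real \<Rightarrow> real \<Rightarrow> nat \<Rightarrow> int \<Rightarrow> real" where
  "hit_weight \<epsilon> r q a = (\<epsilon> * sqrt ((real q)\<^sup>2 + (of_int a)\<^sup>2)) powr r"

definition slope_window :: "real \<Rightarrow> real \<Rightarrow> nat \<Rightarrow> int set" where
  "slope_window t1 t2 q = {a \<in> {0..int q}. t1 \<le> of_int a / real q \<and> of_int a / real q \<le> t2}"

lemma first_hit_row_approx:
  assumes \<epsilon>: "0 < \<epsilon>" "\<epsilon> \<le> 1/8" and r: "r > 0" and q: "2 \<le> q" "q \<le> nat \<lceil>1/\<epsilon>\<rceil>"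
  shows "\<bar>(\<Sum>a\<in>slope_window t1 t2 q. hit_weight \<epsilon> r q a * measure lborel (first_hit \<epsilon> q a)) - lattice_row \<epsilon> r t1 t2 q\<bar>
    \<le> 3 powr r * (56 * \<epsilon> ^ 3 * real q + 2 * \<epsilon> * (1 / real q))"
proof -
  define R where "R = {(a, b) \<in> inverse_pairs q. t1 \<le> of_int a / real q \<and> of_int a / real q \<le> t2}"
  have row: "lattice_row \<epsilon> r t1 t2 q = (\<Sum>p\<in>R. lattice_term \<epsilon> r q (fst p) (snd p))"
    unfolding lattice_row_def R_def by (intro sum.cong refl) auto
  have finR: "finite R" unfolding R_def by (rule finite_subset[OF _ finite_inverse_pairs[of q]]) auto
  have inj: "inj_on fst R" unfolding R_def inj_on_def using inverse_pairs_unique by auto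
  have sub: "fst ` R \<subseteq> slope_window t1 t2 q" by (auto simp: R_def slope_window_def inverse_pairs_def)
  have "(\<Sum>a\<in>slope_window t1 t2 q. hit_weight \<epsilon> r q a * measure lborel (first_hit \<epsilon> q a))
     = (\<Sum>a\<in>fst ` R. hit_weight \<epsilon> r q a * measure lborel (first_hit \<epsilon> q a))"
  proof (rule sum.mono_neutral_right[OF _ sub])
    show "finite (slope_window t1 t2 q)" by (rule finite_subset[of _ "{0..int q}"]) (auto simp: slope_window_def)
    show "\<forall>a\<in>slope_window t1 t2 q - fst ` R. hit_weight \<epsilon> r q a * measure lborel (first_hit \<epsilon> q a) = 0"
    proof
      fix a assume a: "a \<in> slope_window t1 t2 q - fst ` R"
      have "\<not> coprime a (int q)"
      proof
        assume c: "coprime a (int q)"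
        have "a \<noteq> int q" using c q by auto
        then have "a \<in> {0..<int q}" using a by (auto simp: slope_window_def)
        then obtain b where "(a, b) \<in> inverse_pairs q" using c inverse_pairs_exists by blast
        then have "(a, b) \<in> R" using a by (auto simp: R_def slope_window_def)
        then show False using a by force
      qed
      then have "first_hit \<epsilon> q a = {}" using q by (intro first_hit_not_coprime \<epsilon>) auto
      then show "hit_weight \<epsilon> r q a * measure lborel (first_hit \<epsilon> q a) = 0" by simp
    qed
  qed
  also have "\<dots> = (\<Sum>p\<in>R. hit_weight \<epsilon> r q (fst p) * measure lborel (first_hit \<epsilon> q (fst p)))"
    by (simp add: sum.reindex[OF inj])
  finally have "\<bar>(\<Sum>a\<in>slope_window t1 t2 q. hit_weight \<epsilon> r q a * measure lborel (first_hit \<epsilon> q a)) - lattice_row \<epsilon> r t1 t2 q\<bar>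
     = \<bar>\<Sum>p\<in>R. hit_weight \<epsilon> r q (fst p) * measure lborel (first_hit \<epsilon> q (fst p)) - lattice_term \<epsilon> r q (fst p) (snd p)\<bar>"
    by (simp add: row sum_subtractf)
  also have "\<dots> \<le> (\<Sum>p\<in>R. 3 powr r * (56 * \<epsilon> ^ 3 + 2 * \<epsilon> / real q ^ 2))"
  proof (rule order_trans[OF sum_abs], rule sum_mono)
    fix p assume "p \<in> R"
    then have "(fst p, snd p) \<in> inverse_pairs q" by (auto simp: R_def)
    then show "\<bar>hit_weight \<epsilon> r q (fst p) * measure lborel (first_hit \<epsilon> q (fst p)) - lattice_term \<epsilon> r q (fst p) (snd p)\<bar>
      \<le> 3 powr r * (56 * \<epsilon> ^ 3 + 2 * \<epsilon> / real q ^ 2)"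
      unfolding hit_weight_def by (rule first_hit_weight_approx[OF \<epsilon> r q])
  qed
  also have "\<dots> = real (card R) * (3 powr r * (56 * \<epsilon> ^ 3 + 2 * \<epsilon> / real q ^ 2))" by simp
  also have "\<dots> \<le> real q * (3 powr r * (56 * \<epsilon> ^ 3 + 2 * \<epsilon> / real q ^ 2))"
  proof (rule mult_right_mono)
    have "card R \<le> card (inverse_pairs q)" by (rule card_mono) (auto simp: R_def)
    also have "\<dots> \<le> q" using q by (simp add: card_inverse_pairs totient_le)
    finally show "real (card R) \<le> real q" by simp
  qed (use \<epsilon> in auto)
  also have "\<dots> = 3 powr r * (56 * \<epsilon> ^ 3 * real q + 2 * \<epsilon> * (1 / real q))"
    using q by (simp add: field_simps power2_eq_square)
  finally show ?thesis .
qed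

lemma first_hit_sum_approx:
  assumes \<epsilon>: "0 < \<epsilon>" "\<epsilon> \<le> 1/8" and r: "r > 0"
  defines "Q \<equiv> nat \<lceil>1/\<epsilon>\<rceil>"
  shows "\<bar>(\<Sum>q=2..Q. \<Sum>a\<in>slope_window t1 t2 q. hit_weight \<epsilon> r q a * measure lborel (first_hit \<epsilon> q a)) - (\<Sum>q=2..Q. lattice_row \<epsilon> r t1 t2 q)\<bar>
    \<le> 3 powr r * 226 * (\<epsilon> * (1 + ln (real Q)))"
proof -
  have e8: "8 \<le> 1 / \<epsilon>" using \<epsilon> by (simp add: field_simps)
  have Q: "real Q \<le> 2 / \<epsilon>" "real Q \<ge> 1" "Q \<ge> 1" using e8 unfolding Q_def by linarith+
  have "\<bar>(\<Sum>q=2..Q. \<Sum>a\<in>slope_window t1 t2 q. hit_weight \<epsilon> r q a * measure lborel (first_hit \<epsilon> q a)) - (\<Sum>q=2..Q. lattice_row \<epsilon> r t1 t2 q)\<bar>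
     \<le> (\<Sum>q=2..Q. 3 powr r * (56 * \<epsilon> ^ 3 * real q + 2 * \<epsilon> * (1 / real q)))"
    unfolding sum_subtractf[symmetric]
    by (rule order_trans[OF sum_abs], rule sum_mono, rule first_hit_row_approx[OF \<epsilon> r]) (auto simp: Q_def)
  also have "\<dots> \<le> (\<Sum>q=1..Q. 3 powr r * (56 * \<epsilon> ^ 3 * real Q + 2 * \<epsilon> * (1 / real q)))"
  proof (rule order_trans[OF sum_mono sum_mono2])
    show "3 powr r * (56 * \<epsilon> ^ 3 * real q + 2 * \<epsilon> * (1 / real q)) \<le> 3 powr r * (56 * \<epsilon> ^ 3 * real Q + 2 * \<epsilon> * (1 / real q))"
      if "q \<in> {2..Q}" for q using that \<epsilon> by (intro mult_left_mono add_right_mono) auto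
  qed (use \<epsilon> in auto)
  also have "\<dots> = 3 powr r * (56 * \<epsilon> ^ 3 * (real Q * real Q) + 2 * \<epsilon> * (\<Sum>q=1..Q. 1 / real q))"
    by (simp only: sum.distrib sum_distrib_left[symmetric] sum_constant) (simp add: algebra_simps)
  also have "\<dots> \<le> 3 powr r * (56 * \<epsilon> ^ 3 * ((2 / \<epsilon>) * (2 / \<epsilon>)) + 2 * \<epsilon> * (1 + ln (real Q)))"
    using \<epsilon> Q by (intro mult_left_mono add_mono mult_mono sum_le_harm_ln) auto
  also have "56 * \<epsilon> ^ 3 * ((2 / \<epsilon>) * (2 / \<epsilon>)) = 224 * (\<epsilon> * 1)" using \<epsilon> by (simp add: power3_eq_cube)
  also have "3 powr r * (224 * (\<epsilon> * 1) + 2 * \<epsilon> * (1 + ln (real Q))) \<le> 3 powr r * (224 * (\<epsilon> * (1 + ln (real Q))) + 2 * \<epsilon> * (1 + ln (real Q)))"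
    using \<epsilon> Q by (intro mult_left_mono add_right_mono) auto
  also have "\<dots> = 3 powr r * 226 * (\<epsilon> * (1 + ln (real Q)))" by (simp add: algebra_simps)
  finally show ?thesis .
qed

lemma powr_relative_error:
  fixes r s :: real
  assumes r: "r > 0" and s: "\<bar>s - 1\<bar> \<le> 1/2"
  shows "\<bar>s powr r - 1\<bar> \<le> r * 2 powr \<bar>r - 1\<bar> * \<bar>s - 1\<bar>"
proof -
  have bd: "z powr (r - 1) \<le> 2 powr \<bar>r - 1\<bar>" if z: "1/2 \<le> z" "z \<le> 3/2" for z
  proof (cases "r \<ge> 1")
    case True
    then show ?thesis using z by (auto intro!: powr_mono2)
  next
    case False
    have "z powr (r - 1) \<le> (1/2) powr (r - 1)" using False z by (intro powr_mono2') auto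
    also have "\<dots> = 2 powr (1 - r)" by (simp add: powr_divide powr_diff)
    finally show ?thesis using False by simp
  qed
  have mvt: "\<bar>v powr r - u powr r\<bar> \<le> r * 2 powr \<bar>r - 1\<bar> * (v - u)" if uv: "1/2 \<le> u" "u < v" "v \<le> 3/2" for u v
  proof -
    have "\<exists>z>u. z < v \<and> v powr r - u powr r = (v - u) * (r * z powr (r - 1))"
      by (rule MVT2) (use uv in \<open>auto intro!: derivative_eq_intros simp: powr_diff\<close>)
    then obtain z where z: "u < z" "z < v" "v powr r - u powr r = (v - u) * (r * z powr (r - 1))" by blast
    have "\<bar>v powr r - u powr r\<bar> = (v - u) * (r * z powr (r - 1))" unfolding z(3) using uv r by simp
    also have "\<dots> \<le> (v - u) * (r * 2 powr \<bar>r - 1\<bar>)" using uv r z by (intro mult_left_mono bd) auto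
    finally show ?thesis by (simp add: mult_ac)
  qed
  consider "s = 1" | "s < 1" | "s > 1" by linarith
  then show ?thesis
  proof cases
    case 2
    then show ?thesis using mvt[of s 1] s by (simp add: abs_minus_commute)
  next
    case 3
    then show ?thesis using mvt[of 1 s] s by simp
  qed simp
qed

text \<open>
  The length \<open>n\<close>, the projection \<open>p\<close> of \<open>(q, a)\<close> on the ray and the offset satisfy
  \<open>n\<^sup>2 = p\<^sup>2 + offset\<^sup>2\<close>, so \<open>p\<close> is within \<open>\<epsilon>\<^sup>2\<close> of \<open>n\<close>.
\<close>

lemma free_path_near_lattice_norm:
  assumes \<epsilon>: "0 < \<epsilon>" "\<epsilon> \<le> 1/8" and q: "q \<ge> 1" and h: "\<omega> \<in> first_hit \<epsilon> q a"
  defines "n \<equiv> sqrt ((real q)\<^sup>2 + (of_int a)\<^sup>2)"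
  shows "\<bar>free_path_length \<epsilon> \<omega> - n\<bar> \<le> 2 * \<epsilon>" "\<bar>\<omega> - arctan (of_int a / real q)\<bar> \<le> 2 * \<epsilon>" "1 \<le> n"
proof -
  have w: "0 \<le> \<omega>" "\<omega> \<le> pi/4" "\<bar>offset \<omega> q a\<bar> \<le> \<epsilon>" using h by (auto simp: first_hit_def)
  have a: "0 \<le> a" by (rule first_hit_numerator_bounds(1)[OF \<epsilon> w])
  define p where "p = real q * cos \<omega> + of_int a * sin \<omega>"
  define X where "X = offset \<omega> q a"
  note F = free_path_length_first_hit[OF \<epsilon> q h, folded p_def X_def]
  have nq: "real q \<le> n" unfolding n_def by (rule real_le_rsqrt) simp
  then show n1: "1 \<le> n" using q by simp
  have n2: "n\<^sup>2 = p\<^sup>2 + X\<^sup>2"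
  proof -
    have "p\<^sup>2 + X\<^sup>2 = ((real q)\<^sup>2 + (of_int a)\<^sup>2) * ((sin \<omega>)\<^sup>2 + (cos \<omega>)\<^sup>2)"
      unfolding p_def X_def offset_def by algebra
    then show ?thesis by (simp add: n_def)
  qed
  have pn: "p \<le> n" using n2 n1 by (intro power2_le_imp_le[of p n]) auto
  have X2: "X\<^sup>2 \<le> \<epsilon>\<^sup>2" using w(3) \<epsilon> by (simp add: X_def abs_le_square_iff[symmetric])
  have "(n - p) * 1 \<le> (n - p) * (n + p)" using pn n1 F(2) \<epsilon> by (intro mult_left_mono) auto
  also have "\<dots> = X\<^sup>2" using n2 by (simp add: power2_eq_square algebra_simps)
  also have "\<dots> \<le> \<epsilon>\<^sup>2" by (rule X2)
  also have "\<dots> \<le> \<epsilon> * 1" unfolding power2_eq_square using \<epsilon> by (intro mult_left_mono) auto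
  finally have np: "n - p \<le> \<epsilon>" by simp
  have s0: "0 \<le> sqrt (\<epsilon>\<^sup>2 - X\<^sup>2)" using X2 by simp
  have "sqrt (\<epsilon>\<^sup>2 - X\<^sup>2) \<le> sqrt (\<epsilon>\<^sup>2)" by (intro real_sqrt_le_mono) simp
  then have "sqrt (\<epsilon>\<^sup>2 - X\<^sup>2) \<le> \<epsilon>" using \<epsilon> by simp
  then show "\<bar>free_path_length \<epsilon> \<omega> - n\<bar> \<le> 2 * \<epsilon>" unfolding F(1) using s0 np pn by linarith
  have q0: "real q > 0" using q by simp
  have a0: "(0::real) \<le> of_int a" using a by simp
  note P = polar_slope[OF q0 a0, folded n_def]
  define \<theta> where "\<theta> = arctan (of_int a / real q)"
  have "0 \<le> \<theta>" unfolding \<theta>_def by (rule P(3))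
  moreover have "\<theta> < pi/2" unfolding \<theta>_def by (rule P(4))
  ultimately have t: "-(pi/2) \<le> \<omega> - \<theta>" "\<omega> - \<theta> \<le> pi/2" using w pi_gt_zero by linarith+
  have "\<bar>n * sin (\<omega> - \<theta>)\<bar> \<le> \<epsilon>" using w(3) P(6)[of \<omega>] by (simp add: offset_def \<theta>_def)
  moreover have "1 * \<bar>sin (\<omega> - \<theta>)\<bar> \<le> n * \<bar>sin (\<omega> - \<theta>)\<bar>" using n1 by (intro mult_right_mono) auto
  ultimately have s: "\<bar>sin (\<omega> - \<theta>)\<bar> \<le> \<epsilon>" using n1 by (simp add: abs_mult)
  have "\<bar>\<epsilon>\<bar> \<le> 1" "\<bar>- \<epsilon>\<bar> \<le> 1" using \<epsilon> by auto
  then have "arcsin (- \<epsilon>) \<le> \<omega> - \<theta>" "\<omega> - \<theta> \<le> arcsin \<epsilon>"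
    using s t arcsin_le_diff_iff(1)[of "- \<epsilon>" "\<omega> - \<theta>"] arcsin_le_diff_iff(2)[of "\<epsilon>" "\<omega> - \<theta>"] by auto
  moreover have "arcsin (- \<epsilon>) = - arcsin \<epsilon>" using \<epsilon> by (intro arcsin_minus) auto
  moreover have "arcsin \<epsilon> \<le> 2 * \<epsilon>"
  proof -
    have "\<epsilon> ^ 3 \<le> \<epsilon> ^ 1" using \<epsilon> by (intro power_decreasing) auto
    then show ?thesis using arcsin_bounds_cubic(2)[of \<epsilon>] \<epsilon> by simp
  qed
  ultimately show "\<bar>\<omega> - arctan (of_int a / real q)\<bar> \<le> 2 * \<epsilon>" unfolding \<theta>_def by linarith
qed

section \<open>Averaging over directions\<close>

lemma arctan_tan_sector: "0 \<le> x \<Longrightarrow> x \<le> pi/4 \<Longrightarrow> arctan (tan x) = x"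
  using pi_gt_zero by (intro arctan_tan) linarith+

text \<open>
  The sector is a finite disjoint union of \<open>first_hit\<close> sets, and on each of them the exit time has the
  closed form of \<open>free_path_length_first_hit\<close>.
\<close>

lemma free_path_power_measurable:
  assumes \<epsilon>: "0 < \<epsilon>" "\<epsilon> \<le> 1/8"
  obtains T where "T \<in> borel_measurable borel" "\<And>\<omega>. \<omega> \<in> {0..pi/4} \<Longrightarrow> T \<omega> = free_path_length \<epsilon> \<omega> powr r"
proof -
  define Q where "Q = nat \<lceil>1/\<epsilon>\<rceil>"
  define J where "J = (SIGMA q:{1..Q}. {0..int q})"
  define v where "v q a \<omega> = (real q * cos \<omega> + of_int a * sin \<omega> - sqrt (\<epsilon>\<^sup>2 - (offset \<omega> q a)\<^sup>2)) powr r" for q a \<omega>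
  define T where "T \<omega> = (\<Sum>(q, a)\<in>J. indicator (first_hit \<epsilon> q a) \<omega> * v q a \<omega>)" for \<omega>
  have finJ: "finite J" by (auto simp: J_def)
  have "T \<in> borel_measurable borel"
    unfolding T_def v_def offset_def case_prod_unfold by measurable
  moreover have "T \<omega> = free_path_length \<epsilon> \<omega> powr r" if w: "\<omega> \<in> {0..pi/4}" for \<omega>
  proof -
    obtain q0 a0 where h: "1 \<le> q0" "q0 \<le> Q" "0 \<le> a0" "a0 \<le> int q0" "\<omega> \<in> first_hit \<epsilon> q0 a0"
      using first_hit_exists[OF \<epsilon>, of \<omega>] w unfolding Q_def by auto
    have "T \<omega> = (\<Sum>p\<in>J. if p = (q0, a0) then v q0 a0 \<omega> else 0)"
      unfolding T_def
    proof (rule sum.cong[OF refl])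
      fix p assume p: "p \<in> J"
      obtain q a where qa: "p = (q, a)" by (cases p)
      then have "1 \<le> q" using p by (simp add: J_def)
      then have "\<omega> \<in> first_hit \<epsilon> q a \<longleftrightarrow> q = q0 \<and> a = a0"
        using first_hit_unique[OF \<epsilon> _ h(1) _ h(5), of q a] h(5) by auto
      then show "(case p of (q, a) \<Rightarrow> indicator (first_hit \<epsilon> q a) \<omega> * v q a \<omega>) = (if p = (q0, a0) then v q0 a0 \<omega> else 0)"
        by (simp add: qa indicator_def)
    qed
    also have "\<dots> = v q0 a0 \<omega>" using h finJ by (simp add: J_def)
    also have "\<dots> = free_path_length \<epsilon> \<omega> powr r"
      unfolding v_def using free_path_length_first_hit(1)[OF \<epsilon> h(1,5)] by simp
    finally show ?thesis .
  qed
  ultimately show ?thesis by (rule that)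
qed

text \<open>
  The scaled integrand \<open>F\<close> and the step function \<open>G\<close> whose integral is the sum use the same lattice
  point and differ by \<open>O(\<epsilon>)\<close>, except within \<open>2 \<epsilon>\<close> of an endpoint of the interval, where \<open>a / q\<close> and
  \<open>tan \<omega>\<close> may lie on different sides of the endpoint, and within \<open>2 \<epsilon>\<close> of an end of the sector,
  where \<open>q = 1\<close> may occur. There both functions are bounded.
\<close>

lemma first_hit_integral_approx:
  fixes \<epsilon> r e1 e2 :: real
  assumes \<epsilon>: "0 < \<epsilon>" "\<epsilon> \<le> 1/8" and r: "r > 0" and e: "0 \<le> e1" "e1 \<le> e2" "e2 \<le> pi/4"
  defines "Q \<equiv> nat \<lceil>1/\<epsilon>\<rceil>"
  shows "\<bar>\<epsilon> powr r * (LINT \<omega>:{e1..e2}|lborel. free_path_length \<epsilon> \<omega> powr r)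
     - (\<Sum>q=2..Q. \<Sum>a\<in>slope_window (tan e1) (tan e2) q. hit_weight \<epsilon> r q a * measure lborel (first_hit \<epsilon> q a))\<bar>
    \<le> (2 * (3 powr r * (r * 2 powr \<bar>r - 1\<bar>)) + 16 * 4 powr r) * \<epsilon>"
proof -
  define C where "C = 3 powr r * (r * 2 powr \<bar>r - 1\<bar> * (2 * \<epsilon>))"
  have C0: "C \<ge> 0" using r \<epsilon> by (simp add: C_def)
  obtain T where T[measurable]: "T \<in> borel_measurable borel"
    and Teq: "\<And>\<omega>. \<omega> \<in> {0..pi/4} \<Longrightarrow> T \<omega> = free_path_length \<epsilon> \<omega> powr r"
    using free_path_power_measurable[OF \<epsilon>] by blast
  define F where "F \<omega> = indicator {e1..e2} \<omega> * (\<epsilon> powr r * T \<omega>)" for \<omega> :: real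
  define A where "A = slope_window (tan e1) (tan e2)"
  define J where "J = (SIGMA q:{2..Q}. A q)"
  define G where "G \<omega> = (\<Sum>p\<in>J. hit_weight \<epsilon> r (fst p) (snd p) * indicator (first_hit \<epsilon> (fst p) (snd p)) \<omega>)" for \<omega> :: real
  \<comment> \<open>both functions are at most \<open>4 powr r\<close>, since \<open>n \<le> 3 / \<epsilon>\<close>\<close>
  define I where "I p \<omega> = 4 powr r * (indicator {p - 2 * \<epsilon>..p + 2 * \<epsilon>} \<omega> :: real)" for p \<omega> :: real
  define H where "H \<omega> = C * indicator {0..pi/4} \<omega> + (I 0 \<omega> + I (pi/4) \<omega> + I e1 \<omega> + I e2 \<omega>)" for \<omega> :: real
  have finA: "finite (A q)" for q unfolding A_def slope_window_def by (rule finite_subset[of _ "{0..int q}"]) auto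
  have finJ: "finite J" using finA by (auto simp: J_def)
  have Ipos: "0 \<le> I p \<omega>" for p \<omega> by (simp add: I_def indicator_def)
  have Q: "real Q \<le> 9 / (8 * \<epsilon>)" unfolding Q_def by (rule nat_ceiling_inverse_le[OF \<epsilon>])
  have bound: "\<bar>F \<omega> - G \<omega>\<bar> \<le> H \<omega>" for \<omega>
  proof (cases "\<omega> \<in> {0..pi/4}")
    case False
    then have "F \<omega> = 0" using e by (auto simp: F_def indicator_def)
    moreover have "G \<omega> = 0" unfolding G_def using False
      by (intro sum.neutral) (auto simp: first_hit_def indicator_def)
    moreover have "0 \<le> H \<omega>" unfolding H_def by (intro add_nonneg_nonneg mult_nonneg_nonneg Ipos C0) (simp add: indicator_def)
    ultimately show ?thesis by simp
  next
    case True
    obtain q a where h: "1 \<le> q" "q \<le> Q" "0 \<le> a" "a \<le> int q" "\<omega> \<in> first_hit \<epsilon> q a"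
      using first_hit_exists[OF \<epsilon>, of \<omega>] True unfolding Q_def by auto
    define n where "n = sqrt ((real q)\<^sup>2 + (of_int a)\<^sup>2)"
    define \<theta> where "\<theta> = arctan (of_int a / real q)"
    define \<tau> where "\<tau> = free_path_length \<epsilon> \<omega>"
    note N = free_path_near_lattice_norm[OF \<epsilon> h(1,5), folded n_def \<theta>_def \<tau>_def]
    have w: "hit_weight \<epsilon> r q a = (\<epsilon> * n) powr r" by (simp add: hit_weight_def n_def)
    have n2q: "n \<le> 2 * real q" unfolding n_def by (rule lattice_norm_le) (use h in auto)
    have "real q \<le> real Q" using h by simp
    then have "n \<le> 9 / (4 * \<epsilon>)" using n2q Q by linarith
    then have en: "0 < \<epsilon> * n" "\<epsilon> * n \<le> 3" using \<epsilon> N(3) by (auto simp: field_simps)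
    have tp: "\<tau> \<ge> 0" using N(1,3) \<epsilon> by linarith
    have Fv: "F \<omega> = indicator {e1..e2} \<omega> * (\<epsilon> * \<tau>) powr r"
      using Teq[OF True] \<epsilon> tp by (simp add: F_def \<tau>_def powr_mult)
    have Gv: "G \<omega> = (if (q, a) \<in> J then (\<epsilon> * n) powr r else 0)"
    proof -
      have "G \<omega> = (\<Sum>p\<in>J. if p = (q, a) then (\<epsilon> * n) powr r else 0)"
        unfolding G_def
      proof (rule sum.cong[OF refl])
        fix p assume p: "p \<in> J"
        then have "1 \<le> fst p" by (auto simp: J_def)
        then have "\<omega> \<in> first_hit \<epsilon> (fst p) (snd p) \<longleftrightarrow> p = (q, a)"
          using first_hit_unique[OF \<epsilon> _ h(1) _ h(5), of "fst p" "snd p"] h(5) by (cases p) auto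
        then show "hit_weight \<epsilon> r (fst p) (snd p) * indicator (first_hit \<epsilon> (fst p) (snd p)) \<omega> = (if p = (q, a) then (\<epsilon> * n) powr r else 0)"
          by (simp add: indicator_def w)
      qed
      then show ?thesis using finJ by simp
    qed
    have close: "\<bar>(\<epsilon> * \<tau>) powr r - (\<epsilon> * n) powr r\<bar> \<le> C"
    proof -
      define s where "s = \<tau> / n"
      have n0: "n > 0" using N(3) by simp
      have s1: "\<bar>s - 1\<bar> \<le> 2 * \<epsilon>"
      proof -
        have "\<bar>s - 1\<bar> = \<bar>\<tau> - n\<bar> / n" using n0 by (simp add: s_def field_simps abs_divide[symmetric])
        also have "\<dots> \<le> (2 * \<epsilon>) / 1" using N \<epsilon> by (intro frac_le) auto
        finally show ?thesis by simp
      qed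
      have st: "(\<epsilon> * \<tau>) powr r = (\<epsilon> * n) powr r * s powr r"
      proof -
        have "\<epsilon> * \<tau> = (\<epsilon> * n) * s" using n0 by (simp add: s_def)
        moreover have "((\<epsilon> * n) * s) powr r = (\<epsilon> * n) powr r * s powr r"
          by (rule powr_mult; use en tp n0 in \<open>simp add: s_def\<close>)
        ultimately show ?thesis by (simp only:)
      qed
      have "\<bar>(\<epsilon> * \<tau>) powr r - (\<epsilon> * n) powr r\<bar> = (\<epsilon> * n) powr r * \<bar>s powr r - 1\<bar>"
      proof -
        have "(\<epsilon> * \<tau>) powr r - (\<epsilon> * n) powr r = (\<epsilon> * n) powr r * (s powr r - 1)"
          unfolding st by (simp add: right_diff_distrib)
        then show ?thesis by (simp only: abs_mult abs_of_nonneg[OF powr_ge_zero])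
      qed
      also have "\<dots> \<le> 3 powr r * (r * 2 powr \<bar>r - 1\<bar> * (2 * \<epsilon>))"
      proof (intro mult_mono)
        have "\<bar>s powr r - 1\<bar> \<le> r * 2 powr \<bar>r - 1\<bar> * \<bar>s - 1\<bar>" using s1 \<epsilon> by (intro powr_relative_error r) auto
        also have "\<dots> \<le> r * 2 powr \<bar>r - 1\<bar> * (2 * \<epsilon>)" using s1 r by (intro mult_left_mono) auto
        finally show "\<bar>s powr r - 1\<bar> \<le> r * 2 powr \<bar>r - 1\<bar> * (2 * \<epsilon>)" .
      qed (use en r in \<open>auto intro!: powr_mono2\<close>)
      finally show ?thesis by (simp add: C_def)
    qed
    have b1: "0 \<le> (\<epsilon> * n) powr r" "(\<epsilon> * n) powr r \<le> 4 powr r" using en r by (auto intro!: powr_mono2)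
    have b2: "0 \<le> (\<epsilon> * \<tau>) powr r" "(\<epsilon> * \<tau>) powr r \<le> 4 powr r"
    proof -
      have "\<epsilon> * \<tau> \<le> \<epsilon> * (n + 2 * \<epsilon>)" using N(1) \<epsilon> by (intro mult_left_mono) auto
      also have "\<dots> \<le> 3 + 1 * 1" unfolding distrib_left using en \<epsilon> by (intro add_mono mult_mono) auto
      finally show "(\<epsilon> * \<tau>) powr r \<le> 4 powr r" using \<epsilon> tp r by (intro powr_mono2) auto
    qed simp
    show ?thesis
    proof (cases "\<exists>p\<in>{0, pi/4, e1, e2}. \<bar>\<omega> - p\<bar> \<le> 2 * \<epsilon>")
      case True
      then obtain p where p: "p \<in> {0, pi/4, e1, e2}" "\<bar>\<omega> - p\<bar> \<le> 2 * \<epsilon>" by blast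
      then have Ip: "I p \<omega> = 4 powr r" by (auto simp: I_def indicator_def)
      have "I 0 \<omega> = 4 powr r \<or> I (pi/4) \<omega> = 4 powr r \<or> I e1 \<omega> = 4 powr r \<or> I e2 \<omega> = 4 powr r"
        using p(1) Ip by blast
      then have "4 powr r \<le> I 0 \<omega> + I (pi/4) \<omega> + I e1 \<omega> + I e2 \<omega>"
        using Ipos[of 0 \<omega>] Ipos[of "pi/4" \<omega>] Ipos[of e1 \<omega>] Ipos[of e2 \<omega>] by auto
      moreover have "\<bar>(\<epsilon> * \<tau>) powr r - (\<epsilon> * n) powr r\<bar> \<le> 4 powr r" using b1 b2 by linarith
      then have "\<bar>F \<omega> - G \<omega>\<bar> \<le> 4 powr r" unfolding Fv Gv using b1 b2 by (auto simp: indicator_def)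
      moreover have "0 \<le> C * indicator {0..pi/4} \<omega>" using C0 by (simp add: indicator_def)
      ultimately show ?thesis unfolding H_def by linarith
    next
      case False
      \<comment> \<open>away from the four exceptional points nothing is lost at the ends\<close>
      then have far: "2 * \<epsilon> < \<bar>\<omega> - 0\<bar>" "2 * \<epsilon> < \<bar>\<omega> - pi/4\<bar>" "2 * \<epsilon> < \<bar>\<omega> - e1\<bar>" "2 * \<epsilon> < \<bar>\<omega> - e2\<bar>" by auto
      have "q \<noteq> 1"
      proof
        assume "q = 1"
        then have "a = 0 \<or> a = 1" using h by auto
        then have "\<theta> = 0 \<or> \<theta> = pi/4" using \<open>q = 1\<close> by (auto simp: \<theta>_def arctan_one)
        then show False using far N(2) by auto
      qed
      then have q2: "2 \<le> q" using h by simp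
      have ee: "arctan (tan e1) = e1" "arctan (tan e2) = e2" using e by (auto intro!: arctan_tan_sector)
      have "tan e1 \<le> of_int a / real q \<longleftrightarrow> e1 \<le> \<theta>" "of_int a / real q \<le> tan e2 \<longleftrightarrow> \<theta> \<le> e2"
        unfolding \<theta>_def using arctan_le_iff[of "tan e1" "of_int a / real q"] arctan_le_iff[of "of_int a / real q" "tan e2"] by (simp_all add: ee)
      then have "(q, a) \<in> J \<longleftrightarrow> e1 \<le> \<theta> \<and> \<theta> \<le> e2" using h q2 by (auto simp: J_def A_def slope_window_def)
      moreover have "e1 \<le> \<theta> \<longleftrightarrow> e1 \<le> \<omega>" "\<theta> \<le> e2 \<longleftrightarrow> \<omega> \<le> e2" using far N(2) by linarith+
      ultimately have "(q, a) \<in> J \<longleftrightarrow> \<omega> \<in> {e1..e2}" by auto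
      then have "\<bar>F \<omega> - G \<omega>\<bar> \<le> C" unfolding Fv Gv using close C0 by (auto simp: indicator_def)
      moreover have "C * indicator {0..pi/4} \<omega> = C" using True by (simp add: indicator_def)
      ultimately show ?thesis unfolding H_def using Ipos[of 0 \<omega>] Ipos[of "pi/4" \<omega>] Ipos[of e1 \<omega>] Ipos[of e2 \<omega>] by linarith
    qed
  qed
  have int_ind: "integrable lborel (indicator {x..y} :: real \<Rightarrow> real)" for x y :: real
    by (simp add: integrable_real_indicator emeasure_lborel_Icc_eq)
  have intI: "integrable lborel (I p)" for p unfolding I_def by (intro integrable_mult_right int_ind)
  have intH: "integrable lborel H" unfolding H_def by (intro Bochner_Integration.integrable_add integrable_mult_right int_ind intI)
  have fin_hit: "emeasure lborel (first_hit \<epsilon> q a) < \<infinity>" for q a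
  proof -
    have "emeasure lborel (first_hit \<epsilon> q a) \<le> emeasure lborel {0..pi/4}"
      by (rule emeasure_mono) (auto simp: first_hit_def)
    also have "\<dots> < \<infinity>" by (simp add: emeasure_lborel_Icc_eq)
    finally show ?thesis .
  qed
  have int_hit: "integrable lborel (indicator (first_hit \<epsilon> q a) :: real \<Rightarrow> real)" for q a
    using fin_hit by (intro integrable_real_indicator) auto
  have intG: "integrable lborel G" unfolding G_def
    by (intro Bochner_Integration.integrable_sum integrable_mult_right int_hit)
  have Fm[measurable]: "F \<in> borel_measurable borel" unfolding F_def by measurable
  have intF: "integrable lborel F"
  proof (rule Bochner_Integration.integrable_bound[where f = "\<lambda>\<omega>. H \<omega> + \<bar>G \<omega>\<bar>"])
    show "integrable lborel (\<lambda>\<omega>. H \<omega> + \<bar>G \<omega>\<bar>)" using intH intG by auto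
    show "F \<in> borel_measurable lborel" using Fm by simp
    show "AE \<omega> in lborel. norm (F \<omega>) \<le> norm (H \<omega> + \<bar>G \<omega>\<bar>)"
    proof (rule AE_I2)
      fix \<omega>
      show "norm (F \<omega>) \<le> norm (H \<omega> + \<bar>G \<omega>\<bar>)" using bound[of \<omega>] unfolding real_norm_def by linarith
    qed
  qed
  have "\<bar>integral\<^sup>L lborel F - integral\<^sup>L lborel G\<bar> = \<bar>\<integral>\<omega>. F \<omega> - G \<omega> \<partial>lborel\<bar>"
    using intF intG by simp
  also have "\<dots> \<le> (\<integral>\<omega>. H \<omega> \<partial>lborel)"
    using bound intF intG intH by (intro integral_abs_bound[THEN order_trans] integral_mono) auto
  also have "\<dots> = C * (pi/4) + (4 powr r * (4 * \<epsilon>) + 4 powr r * (4 * \<epsilon>) + 4 powr r * (4 * \<epsilon>) + 4 powr r * (4 * \<epsilon>))"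
  proof -
    have II: "(\<integral>\<omega>. I p \<omega> \<partial>lborel) = 4 powr r * (4 * \<epsilon>)" for p
      using \<epsilon> by (simp add: I_def)
    have "(\<integral>\<omega>. H \<omega> \<partial>lborel) = C * (\<integral>\<omega>. indicator {0..pi/4} \<omega> \<partial>lborel) + (integral\<^sup>L lborel (I 0) + integral\<^sup>L lborel (I (pi/4)) + integral\<^sup>L lborel (I e1) + integral\<^sup>L lborel (I e2))"
      unfolding H_def using intI int_ind by (simp add: Bochner_Integration.integral_add integrable_mult_right)
    also have "(\<integral>\<omega>. indicator {0..pi/4} \<omega> \<partial>lborel) = pi/4" by simp
    finally show ?thesis by (simp add: II)
  qed
  also have "\<dots> \<le> C * 1 + 16 * 4 powr r * \<epsilon>"
    using C0 pi_less_4 by (intro add_mono mult_left_mono) auto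
  also have "\<dots> = (2 * (3 powr r * (r * 2 powr \<bar>r - 1\<bar>)) + 16 * 4 powr r) * \<epsilon>"
    by (simp add: C_def algebra_simps)
  finally have res: "\<bar>integral\<^sup>L lborel F - integral\<^sup>L lborel G\<bar> \<le> (2 * (3 powr r * (r * 2 powr \<bar>r - 1\<bar>)) + 16 * 4 powr r) * \<epsilon>" .
  have Fint: "integral\<^sup>L lborel F = \<epsilon> powr r * (LINT \<omega>:{e1..e2}|lborel. free_path_length \<epsilon> \<omega> powr r)"
  proof -
    have "F = (\<lambda>\<omega>. \<epsilon> powr r * (indicator {e1..e2} \<omega> *\<^sub>R (free_path_length \<epsilon> \<omega> powr r)))"
      using Teq e by (auto simp: F_def indicator_def)
    then show ?thesis by (simp add: set_lebesgue_integral_def)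
  qed
  have Gint: "integral\<^sup>L lborel G = (\<Sum>q=2..Q. \<Sum>a\<in>A q. hit_weight \<epsilon> r q a * measure lborel (first_hit \<epsilon> q a))"
  proof -
    have "integral\<^sup>L lborel G = (\<Sum>p\<in>J. hit_weight \<epsilon> r (fst p) (snd p) * measure lborel (first_hit \<epsilon> (fst p) (snd p)))"
      unfolding G_def using int_hit by (subst Bochner_Integration.integral_sum) auto
    then show ?thesis unfolding J_def using finA by (simp add: sum.Sigma case_prod_unfold)
  qed
  show ?thesis using res unfolding Fint Gint A_def .
qed

section \<open>The limiting constant\<close>

text \<open>
  The primitive of \<open>x * (1 - x) powr (r - 1)\<close> that vanishes at \<open>0\<close>.
\<close>

definition tail_primitive :: "real \<Rightarrow> real \<Rightarrow> real" where
  "tail_primitive r x = (1 - (1 - x) powr r) / r - (1 - (1 - x) powr (r + 1)) / (r + 1)"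

lemma tail_primitive_deriv:
  assumes r: "r > 0" and x: "x < 1"
  shows "(tail_primitive r has_real_derivative x * (1 - x) powr (r - 1)) (at x)"
proof -
  have d: "((\<lambda>x. (1 - (1 - x) powr s) / s) has_real_derivative (1 - x) powr (s - 1)) (at x)" if s: "s > 0" for s
  proof -
    have "((\<lambda>x. (1 - x) powr s) has_real_derivative (s * (1 - x) powr (s - 1)) * (0 - 1)) (at x)"
      by (rule DERIV_chain2[OF has_real_derivative_powr]) (use x in \<open>auto intro!: derivative_eq_intros\<close>)
    then have "((\<lambda>x. (1 - (1 - x) powr s) / s) has_real_derivative (0 - (s * (1 - x) powr (s - 1)) * (0 - 1)) / s) (at x)"
      by (intro DERIV_cdivide DERIV_diff DERIV_const)
    then show ?thesis using s by simp
  qed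
  have "(tail_primitive r has_real_derivative (1 - x) powr (r - 1) - (1 - x) powr (r + 1 - 1)) (at x)"
    unfolding tail_primitive_def using r by (intro DERIV_diff d) auto
  then have "(tail_primitive r has_real_derivative (1 - x) powr (r - 1) - (1 - x) powr r) (at x)" by simp
  moreover have "(1 - x) powr r = (1 - x) * (1 - x) powr (r - 1)" using x by (simp add: powr_diff)
  ultimately show ?thesis by (simp add: algebra_simps)
qed

lemma one_minus_powr_le:
  fixes r x :: real
  assumes "0 \<le> x" "x \<le> 1/2"
  shows "(1 - x) powr (r - 1) \<le> 2 powr \<bar>r - 1\<bar>"
proof (cases "r \<ge> 1")
  case True
  have "(1 - x) powr (r - 1) \<le> 2 powr (r - 1)" using assms True by (intro powr_mono2) auto
  then show ?thesis using True by simp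
next
  case False
  have "(1 - x) powr (r - 1) \<le> (1/2) powr (r - 1)" using assms False by (intro powr_mono2') auto
  also have "\<dots> = 2 powr (1 - r)" by (simp add: powr_divide powr_diff)
  finally show ?thesis using False by simp
qed

lemma tail_primitive_bounds:
  assumes r: "r > 0" and x: "0 \<le> x" "x \<le> 1/2"
  shows "0 \<le> tail_primitive r x" "tail_primitive r x \<le> 2 powr \<bar>r - 1\<bar> * x"
proof -
  have z: "tail_primitive r 0 = 0" by (simp add: tail_primitive_def)
  have "tail_primitive r 0 \<le> tail_primitive r x"
  proof (rule DERIV_nonneg_imp_nondecreasing[OF x(1)])
    fix t assume "0 \<le> t" "t \<le> x"
    then show "\<exists>y. (tail_primitive r has_real_derivative y) (at t) \<and> 0 \<le> y"
      using tail_primitive_deriv[OF r, of t] x by (intro exI[of _ "t * (1 - t) powr (r - 1)"]) auto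
  qed
  then show "0 \<le> tail_primitive r x" using z by simp
  have "(\<lambda>t. 2 powr \<bar>r - 1\<bar> * t - tail_primitive r t) 0 \<le> (\<lambda>t. 2 powr \<bar>r - 1\<bar> * t - tail_primitive r t) x"
  proof (rule DERIV_nonneg_imp_nondecreasing[OF x(1)])
    fix t assume t: "0 \<le> t" "t \<le> x"
    have "((\<lambda>t. 2 powr \<bar>r - 1\<bar> * t - tail_primitive r t) has_real_derivative (2 powr \<bar>r - 1\<bar> * 1 - t * (1 - t) powr (r - 1))) (at t)"
      using t x by (intro DERIV_diff DERIV_cmult DERIV_ident tail_primitive_deriv r) auto
    moreover have "t * (1 - t) powr (r - 1) \<le> 1 * 2 powr \<bar>r - 1\<bar>"
      using t x by (intro mult_mono one_minus_powr_le) auto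
    ultimately show "\<exists>y. ((\<lambda>t. 2 powr \<bar>r - 1\<bar> * t - tail_primitive r t) has_real_derivative y) (at t) \<and> 0 \<le> y"
      by (intro exI conjI) auto
  qed
  then show "tail_primitive r x \<le> 2 powr \<bar>r - 1\<bar> * x" using z by simp
qed

text \<open>
  On \<open>{0..1/2}\<close> the profile is \<open>1\<close>; on \<open>{1/2..1}\<close> it is \<open>z - z * ln z\<close> with \<open>z = (1 - x) / x\<close>, and
  the reflection \<open>x \<mapsto> 1 - x\<close> moves this half to \<open>{0..1/2}\<close>.
\<close>

lemma free_path_moment_halves:
  assumes r: "r > 0"
  shows "((\<lambda>x. x powr r + x * (1 - x) powr (r - 1) * (1 + ln ((1 - x) / x))) has_integral free_path_moment r) {0..1/2}"
proof -
  define f where "f x = x powr r * profile x" for x :: real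
  have I: "f integrable_on {0..1}" using powr_profile_integrable(2)[OF r, of 1] unfolding f_def[abs_def] by simp
  have I1: "(f has_integral integral {0..1/2} f) {0..1/2}" and I2: "(f has_integral integral {1/2..1} f) {1/2..1}"
    using I by (intro integrable_integral integrable_on_subinterval[OF I]; simp)+
  have tot: "integral {0..1/2} f + integral {1/2..1} f = free_path_moment r"
    using Henstock_Kurzweil_Integration.integral_combine[of 0 "1/2" 1 f] I
    by (simp add: free_path_moment_def f_def[abs_def])
  have A: "((\<lambda>x. x powr r) has_integral integral {0..1/2} f) {0..1/2}"
  proof (rule has_integral_eq[OF _ I1])
    fix x :: real assume x: "x \<in> {0..1/2}"
    show "f x = x powr r"
    proof (cases "x = 0")
      case False
      then have "1 / x - 1 \<ge> 1" using x by (simp add: le_divide_eq)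
      then show ?thesis using x False by (simp add: f_def profile_def trunc_mean_def)
    qed (use r in \<open>simp add: f_def\<close>)
  qed
  have img: "(\<lambda>x::real. (1 / - 1) *\<^sub>R x + - ((1 / - 1) *\<^sub>R 1)) ` cbox (1/2) 1 = {0..1/2}"
  proof (intro equalityI subsetI)
    fix y :: real assume "y \<in> {0..1/2}"
    then have "1 - y \<in> cbox (1/2) 1" "y = (1 / - 1) *\<^sub>R (1 - y) + - ((1 / - 1) *\<^sub>R 1)" by auto
    then show "y \<in> (\<lambda>x::real. (1 / - 1) *\<^sub>R x + - ((1 / - 1) *\<^sub>R 1)) ` cbox (1/2) 1" by (rule image_eqI[rotated])
  qed auto
  have "((\<lambda>x. f ((-1) *\<^sub>R x + 1)) has_integral (1 / (\<bar>- 1\<bar> ^ DIM(real))) *\<^sub>R integral {1/2..1} f) ((\<lambda>x. (1 / - 1) *\<^sub>R x + - ((1 / - 1) *\<^sub>R 1)) ` cbox (1/2) 1)"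
    by (rule has_integral_affinity) (use I2 in auto)
  then have "((\<lambda>x. f (1 - x)) has_integral integral {1/2..1} f) {0..1/2}" unfolding img by simp
  then have B: "((\<lambda>x. x * (1 - x) powr (r - 1) * (1 + ln ((1 - x) / x))) has_integral integral {1/2..1} f) {0..1/2}"
  proof (rule has_integral_eq[rotated])
    fix x :: real assume x: "x \<in> {0..1/2}"
    show "f (1 - x) = x * (1 - x) powr (r - 1) * (1 + ln ((1 - x) / x))"
    proof (cases "x = 0")
      case True
      then show ?thesis by (simp add: f_def profile_eq_0)
    next
      case False
      then have x0: "0 < x" "x \<le> 1/2" "1 - x > 0" using x by auto
      have z: "1 / (1 - x) - 1 = x / (1 - x)" using x0 by (simp add: field_simps)
      have tm: "trunc_mean y = y - y * ln y" if "0 < y" "y \<le> 1" for y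
        using that by (cases "y = 1") (auto simp: trunc_mean_def)
      have "x / (1 - x) > 0" "x / (1 - x) \<le> 1" using x0 by (auto simp: divide_le_eq)
      from tm[OF this] have "profile (1 - x) = x / (1 - x) - x / (1 - x) * ln (x / (1 - x))"
        using x0 by (simp add: profile_def z)
      also have "ln (x / (1 - x)) = - ln ((1 - x) / x)" using x0 by (simp add: ln_div)
      finally have "f (1 - x) = (1 - x) powr r / (1 - x) * x * (1 + ln ((1 - x) / x))"
        by (simp add: f_def algebra_simps add_divide_distrib)
      also have "(1 - x) powr r / (1 - x) = (1 - x) powr (r - 1)" using x0 by (simp add: powr_diff)
      finally show ?thesis by (simp add: mult_ac)
    qed
  qed
  show ?thesis using has_integral_add[OF A B] tot by simp
qed

text \<open>
  The integrands \<open>g\<close> of \<open>moment_const\<close> and \<open>h\<close> of \<open>free_path_moment_halves\<close> differ by the derivative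
  of \<open>- tail_primitive r x * ln ((1 - x) / x)\<close>. This function vanishes at \<open>1/2\<close>, where the logarithm is
  \<open>0\<close>, and at \<open>0\<close>, where the primitive is \<open>O(x)\<close>.
\<close>

lemma moment_const_eq_free_path_moment:
  assumes r: "r > 0"
  shows "moment_const r = 12 / pi\<^sup>2 * free_path_moment r"
proof -
  define g where "g x = x * (x powr (r - 1) + (1 - x) powr (r - 1))
      + (1 - (1 - x) powr r) / (r * x * (1 - x))
      - (1 - (1 - x) powr (r + 1)) / ((r + 1) * x * (1 - x))" for x :: real
  define h where "h x = x powr r + x * (1 - x) powr (r - 1) * (1 + ln ((1 - x) / x))" for x :: real
  define L where "L x = ln ((1 - x) / x)" for x :: real
  define K where "K = 2 powr \<bar>r - 1\<bar>"
  have frac: "(1 - (1 - x) powr r) / (r * x * (1 - x)) - (1 - (1 - x) powr (r + 1)) / ((r + 1) * x * (1 - x))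
     = tail_primitive r x / (x * (1 - x))" if "0 < x" "x < 1" for x
    using that r by (simp add: tail_primitive_def diff_divide_distrib)
  have g_eq: "g x = x powr r + x * (1 - x) powr (r - 1) + tail_primitive r x / (x * (1 - x))" if x: "0 < x" "x < 1" for x
    using frac[OF x] x unfolding g_def by (simp add: distrib_left powr_mult_base)
  have bound: "\<bar>g x\<bar> \<le> 1 + K + 2 * K" if x: "x \<in> {0..1/2}" for x
  proof (cases "x = 0")
    case True
    then show ?thesis by (simp add: g_def K_def)
  next
    case False
    then have x0: "0 < x" "x \<le> 1/2" using x by auto
    have gx: "g x = x powr r + x * (1 - x) powr (r - 1) + tail_primitive r x / (x * (1 - x))"
      using x0 by (intro g_eq) auto
    have "0 \<le> x powr r" "x powr r \<le> 1" using x0 r by (auto intro: powr_le1)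
    moreover have "0 \<le> x * (1 - x) powr (r - 1)" "x * (1 - x) powr (r - 1) \<le> 1 * K"
      unfolding K_def using x0 by (simp, intro mult_mono one_minus_powr_le) auto
    moreover have "0 \<le> tail_primitive r x / (x * (1 - x))" using tail_primitive_bounds[OF r, of x] x0 by simp
    moreover have "tail_primitive r x / (x * (1 - x)) \<le> 2 * K"
    proof -
      have "tail_primitive r x / (x * (1 - x)) \<le> K * x / (x * (1 - x))"
        unfolding K_def using tail_primitive_bounds[OF r, of x] x0 by (intro divide_right_mono) auto
      also have "\<dots> = K * (1 / (1 - x))" using x0 by simp
      also have "\<dots> \<le> K * 2" using x0 by (intro mult_left_mono) (auto simp: K_def divide_le_eq)
      finally show ?thesis by simp
    qed
    ultimately show ?thesis unfolding gx by linarith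
  qed
  have gm: "g \<in> borel_measurable borel" unfolding g_def by measurable
  note G = bounded_measurable_integrable_on[OF gm bound]
  define \<Phi> where "\<Phi> x = - (tail_primitive r x * L x)" for x
  have \<Phi>0: "((\<lambda>x. \<Phi> x) \<longlongrightarrow> 0) (at_right 0)"
  proof (rule Lim_null_comparison)
    show "\<forall>\<^sub>F x in at_right 0. norm (\<Phi> x) \<le> K * \<bar>x * L x\<bar>"
    proof (rule eventually_at_rightI[of 0 "1/2"])
      fix x :: real assume x: "x \<in> {0<..<1/2}"
      have "norm (\<Phi> x) = tail_primitive r x * \<bar>L x\<bar>"
        using tail_primitive_bounds(1)[OF r, of x] x by (simp add: \<Phi>_def abs_mult)
      also have "\<dots> \<le> (K * x) * \<bar>L x\<bar>"
        unfolding K_def using tail_primitive_bounds(2)[OF r, of x] x by (intro mult_right_mono) auto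
      finally show "norm (\<Phi> x) \<le> K * \<bar>x * L x\<bar>" using x by (simp add: abs_mult)
    qed simp
    have "((\<lambda>x::real. x * ln ((1 - x) / x)) \<longlongrightarrow> 0) (at_right 0)" by real_asymp
    then show "((\<lambda>x. K * \<bar>x * L x\<bar>) \<longlongrightarrow> 0) (at_right 0)"
      unfolding L_def by (intro tendsto_mult_right_zero tendsto_rabs_zero)
  qed
  have \<Phi>00: "\<Phi> 0 = 0" by (simp add: \<Phi>_def tail_primitive_def)
  have \<Phi>h: "\<Phi> (1/2) = 0" by (simp add: \<Phi>_def L_def)
  have deriv: "(\<Phi> has_real_derivative g x - h x) (at x)" if x: "0 < x" "x \<le> 1/2" for x
  proof -
    have dL: "(L has_real_derivative - (1 / (x * (1 - x)))) (at x)"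
      unfolding L_def using x by (auto intro!: derivative_eq_intros simp: field_simps)
    have "((\<lambda>x. - (tail_primitive r x * L x)) has_real_derivative
       - (x * (1 - x) powr (r - 1) * L x + - (1 / (x * (1 - x))) * tail_primitive r x)) (at x)"
      using x by (intro DERIV_minus DERIV_mult dL tail_primitive_deriv r) auto
    moreover have "- (x * (1 - x) powr (r - 1) * L x + - (1 / (x * (1 - x))) * tail_primitive r x) = g x - h x"
      using x by (subst g_eq) (auto simp: h_def L_def distrib_left)
    ultimately show ?thesis by (simp add: \<Phi>_def[abs_def])
  qed
  have "((\<lambda>x. g x - h x) has_integral \<Phi> (1/2) - \<Phi> 0) {0..1/2}"
  proof (rule fundamental_theorem_of_calculus_interior)
    show "(\<Phi> has_vector_derivative g x - h x) (at x)" if "x \<in> {0<..<1/2}" for x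
      using deriv[of x] that by (simp add: has_real_derivative_iff_has_vector_derivative)
    show "continuous_on {0..1/2} \<Phi>"
      unfolding continuous_on_eq_continuous_within
    proof
      fix x :: real assume x: "x \<in> {0..1/2}"
      show "continuous (at x within {0..1/2}) \<Phi>"
      proof (cases "x = 0")
        case True
        have "(\<Phi> \<longlongrightarrow> \<Phi> 0) (at 0 within {0..1/2})"
          using \<Phi>0 by (simp add: \<Phi>00 at_within_Icc_at_right)
        then show ?thesis using True by (simp add: continuous_within)
      next
        case False
        then have "isCont \<Phi> x" using x by (intro DERIV_isCont[OF deriv]) auto
        then show ?thesis by (rule continuous_at_imp_continuous_at_within)
      qed
    qed
  qed simp
  then have "((\<lambda>x. (g x - h x) + h x) has_integral 0 + free_path_moment r) {0..1/2}"
    using free_path_moment_halves[OF r] unfolding \<Phi>00 \<Phi>h h_def by (intro has_integral_add) auto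
  then have "integral {0..1/2} g = free_path_moment r" by (simp add: integral_unique)
  then have "(LINT x:{0..1/2}|lborel. g x) = free_path_moment r"
    using set_borel_integral_eq_integral(2)[OF G(1)] by simp
  then show ?thesis by (simp add: moment_const_def g_def)
qed

section \<open>Asymptotics of the moments\<close>

lemma moment_asymptotics_Icc:
  fixes r \<delta> :: real
  assumes r: "r > 0" and \<delta>: "\<delta> > 0"
  obtains C where "C > 0" "\<And>\<epsilon> e1 e2. \<lbrakk>0 < \<epsilon>; \<epsilon> \<le> 1/8; 0 \<le> e1; e1 \<le> e2; e2 \<le> pi/4\<rbrakk> \<Longrightarrow>
    \<bar>\<epsilon> powr r * (LINT \<omega>:{e1..e2}|lborel. free_path_length \<epsilon> \<omega> powr r) - moment_const r * (e2 - e1)\<bar>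
      \<le> C * \<epsilon> powr (1/4 - \<delta>)"
proof -
  obtain C where C: "C > 0" "\<And>\<epsilon> t1 t2. \<lbrakk>0 < \<epsilon>; \<epsilon> \<le> 1/4; 0 \<le> t1; t1 \<le> t2; t2 \<le> 1\<rbrakk> \<Longrightarrow>
     \<bar>(\<Sum>q=2..nat \<lceil>1/\<epsilon>\<rceil>. lattice_row \<epsilon> r t1 t2 q) - 12 / pi\<^sup>2 * free_path_moment r * (arctan t2 - arctan t1)\<bar>
       \<le> C * \<epsilon> powr (1/4 - \<delta>)"
    using lattice_sum_asymptotics[OF r \<delta>] by blast
  define K1 where "K1 = 2 * (3 powr r * (r * 2 powr \<bar>r - 1\<bar>)) + 16 * 4 powr r"
  define K2 :: real where "K2 = 3 powr r * 226 * ((1 + 1 / (3/4)) * 2 powr (3/4))"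
  have K: "K1 \<ge> 0" "K2 \<ge> 0" using r by (auto simp: K1_def K2_def)
  show ?thesis
  proof
    show "K1 + K2 + C > 0" using K C by simp
    fix \<epsilon> e1 e2 :: real
    assume \<epsilon>: "0 < \<epsilon>" "\<epsilon> \<le> 1/8" and e: "0 \<le> e1" "e1 \<le> e2" "e2 \<le> pi/4"
    define Q where "Q = nat \<lceil>1/\<epsilon>\<rceil>"
    define M where "M = (\<Sum>q=2..Q. \<Sum>a\<in>slope_window (tan e1) (tan e2) q. hit_weight \<epsilon> r q a * measure lborel (first_hit \<epsilon> q a))"
    define R where "R = (\<Sum>q=2..Q. lattice_row \<epsilon> r (tan e1) (tan e2) q)"
    define p where "p = \<epsilon> powr (1/4 - \<delta>)"
    have p4: "\<epsilon> powr (1/4) \<le> p" unfolding p_def using \<epsilon> \<delta> by (intro powr_mono') auto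
    have "\<epsilon> powr 1 \<le> \<epsilon> powr (1/4)" using \<epsilon> by (intro powr_mono') auto
    then have ep: "\<epsilon> \<le> p" using \<epsilon> p4 by simp
    have ee: "arctan (tan e1) = e1" "arctan (tan e2) = e2" using e by (auto intro!: arctan_tan_sector)
    have t: "0 \<le> tan e1" "tan e1 \<le> tan e2" "tan e2 \<le> 1"
      using arctan_le_iff[of 0 "tan e1"] arctan_le_iff[of "tan e1" "tan e2"] arctan_le_iff[of "tan e2" 1] e
      by (auto simp: ee arctan_one)
    have 1: "\<bar>\<epsilon> powr r * (LINT \<omega>:{e1..e2}|lborel. free_path_length \<epsilon> \<omega> powr r) - M\<bar> \<le> K1 * p"
      using first_hit_integral_approx[OF \<epsilon> r e] mult_left_mono[OF ep K(1)] unfolding M_def Q_def K1_def by linarith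
    have 2: "\<bar>M - R\<bar> \<le> K2 * p"
    proof -
      have "\<bar>M - R\<bar> \<le> 3 powr r * 226 * (\<epsilon> * (1 + ln (real Q)))"
        unfolding M_def R_def Q_def by (rule first_hit_sum_approx[OF \<epsilon> r])
      also have "\<dots> \<le> 3 powr r * 226 * ((1 + 1 / (3/4)) * 2 powr (3/4) * \<epsilon> powr (1/4))"
        unfolding Q_def using \<epsilon> by (intro mult_left_mono eps_times_log_le) auto
      also have "\<dots> = K2 * \<epsilon> powr (1/4)" by (simp only: K2_def mult.assoc)
      also have "\<dots> \<le> K2 * p" by (intro mult_left_mono p4 K)
      finally show ?thesis .
    qed
    have 3: "\<bar>R - moment_const r * (e2 - e1)\<bar> \<le> C * p"
      using C(2)[OF \<epsilon>(1) _ t] \<epsilon> unfolding R_def Q_def p_def moment_const_eq_free_path_moment[OF r] ee by simp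
    show "\<bar>\<epsilon> powr r * (LINT \<omega>:{e1..e2}|lborel. free_path_length \<epsilon> \<omega> powr r) - moment_const r * (e2 - e1)\<bar>
      \<le> (K1 + K2 + C) * \<epsilon> powr (1/4 - \<delta>)"
      using abs_diff_triangle[OF abs_diff_triangle[OF 1 2] 3] by (simp only: p_def[symmetric] distrib_right)
  qed
qed

lemma interval_eq_Icc_ae:
  fixes I :: "real set"
  assumes I: "is_interval I" "I \<noteq> {}" "I \<subseteq> {a..b}"
  obtains e1 e2 where "a \<le> e1" "e1 \<le> e2" "e2 \<le> b" "I \<in> sets borel" "{e1<..<e2} \<subseteq> I" "I \<subseteq> {e1..e2}"
proof -
  have bdd: "bdd_below I" "bdd_above I" using I(3) by (auto intro: bdd_below_mono bdd_above_mono)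
  define e1 e2 where "e1 = Inf I" and "e2 = Sup I"
  have sub: "I \<subseteq> {e1..e2}" using bdd by (auto simp: e1_def e2_def intro: cInf_lower cSup_upper)
  have sup: "{e1<..<e2} \<subseteq> I"
  proof
    fix x assume x: "x \<in> {e1<..<e2}"
    obtain y where y: "y \<in> I" "y < x" using x cInf_less_iff[OF I(2) bdd(1)] by (auto simp: e1_def)
    obtain z where z: "z \<in> I" "x < z" using x less_cSup_iff[OF I(2) bdd(2)] by (auto simp: e2_def)
    show "x \<in> I" using mem_is_interval_1_I[OF I(1) y(1) z(1)] y z by simp
  qed
  have I_eq: "I = {e1<..<e2} \<union> (I \<inter> {e1, e2})" using sub sup by (auto simp: less_le)
  have "I \<inter> {e1, e2} \<in> sets borel" by (intro borel_closed finite_imp_closed) auto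
  then have "{e1<..<e2} \<union> (I \<inter> {e1, e2}) \<in> sets borel" by (intro sets.Un) auto
  then have "I \<in> sets borel" unfolding I_eq[symmetric] .
  moreover have "a \<le> e1" "e2 \<le> b" using I(2,3) by (auto simp: e1_def e2_def intro!: cInf_greatest cSup_least)
  moreover have "e1 \<le> e2" using sub I(2) by fastforce
  ultimately show ?thesis using that sub sup by blast
qed

theorem theorem1p1:
  fixes r \<delta> :: real
  assumes "r > 0" and "\<delta> > 0"
  shows "\<exists>C::real. \<forall>\<^sub>F \<epsilon> in at_right 0. \<forall>I::real set.
    is_interval I \<and> I \<subseteq> {0..pi/4} \<longrightarrow>
    \<bar>\<epsilon> powr r * (LINT \<omega>:I|lborel. free_path_length \<epsilon> \<omega> powr r)
       - moment_const r * measure lborel I\<bar>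
    \<le> C * (if r \<noteq> 2 then \<epsilon> powr (1/8 - \<delta>) else \<epsilon> powr (1/4 - \<delta>))"
proof -
  obtain C where C: "C > 0" "\<And>\<epsilon> e1 e2. \<lbrakk>0 < \<epsilon>; \<epsilon> \<le> 1/8; 0 \<le> e1; e1 \<le> e2; e2 \<le> pi/4\<rbrakk> \<Longrightarrow>
    \<bar>\<epsilon> powr r * (LINT \<omega>:{e1..e2}|lborel. free_path_length \<epsilon> \<omega> powr r) - moment_const r * (e2 - e1)\<bar>
      \<le> C * \<epsilon> powr (1/4 - \<delta>)"
    using moment_asymptotics_Icc[OF assms] by blast
  show ?thesis
  proof (rule exI[of _ C], rule eventually_at_rightI[of 0 "1/8"], intro allI impI)
    fix \<epsilon> :: real and I :: "real set"
    assume e: "\<epsilon> \<in> {0<..<1/8}" and I: "is_interval I \<and> I \<subseteq> {0..pi/4}"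
    have \<epsilon>: "0 < \<epsilon>" "\<epsilon> \<le> 1/8" using e by auto
    have "\<epsilon> powr (1/4 - \<delta>) \<le> \<epsilon> powr (1/8 - \<delta>)" using \<epsilon> by (intro powr_mono') auto
    then have rhs: "C * \<epsilon> powr (1/4 - \<delta>) \<le> C * (if r \<noteq> 2 then \<epsilon> powr (1/8 - \<delta>) else \<epsilon> powr (1/4 - \<delta>))"
      using C(1) by simp
    show "\<bar>\<epsilon> powr r * (LINT \<omega>:I|lborel. free_path_length \<epsilon> \<omega> powr r) - moment_const r * measure lborel I\<bar>
       \<le> C * (if r \<noteq> 2 then \<epsilon> powr (1/8 - \<delta>) else \<epsilon> powr (1/4 - \<delta>))"
    proof (cases "I = {}")
      case True
      have "0 \<le> C * \<epsilon> powr (1/4 - \<delta>)" using C(1) by simp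
      then show ?thesis using rhs True by (simp add: set_lebesgue_integral_def)
    next
      case False
      obtain e1 e2 where ee: "0 \<le> e1" "e1 \<le> e2" "e2 \<le> pi/4" "I \<in> sets borel" "{e1<..<e2} \<subseteq> I" "I \<subseteq> {e1..e2}"
        using interval_eq_Icc_ae[of I 0 "pi/4"] I False by blast
      obtain T where T[measurable]: "T \<in> borel_measurable borel"
        and Teq: "\<And>\<omega>. \<omega> \<in> {0..pi/4} \<Longrightarrow> T \<omega> = free_path_length \<epsilon> \<omega> powr r"
        using free_path_power_measurable[OF \<epsilon>] by blast
      note ee(4)[measurable]
      have "(LINT \<omega>:I|lborel. free_path_length \<epsilon> \<omega> powr r) = (LINT \<omega>:I|lborel. T \<omega>)"
        unfolding set_lebesgue_integral_def
        by (intro Bochner_Integration.integral_cong refl) (use I Teq in \<open>auto simp: indicator_def\<close>)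
      also have "\<dots> = (LINT \<omega>:{e1..e2}|lborel. T \<omega>)"
        unfolding set_lebesgue_integral_def
      proof (rule integral_cong_AE)
        have "AE \<omega> in lborel. \<omega> \<noteq> e1" "AE \<omega> in lborel. \<omega> \<noteq> e2" by (rule AE_lborel_singleton)+
        then show "AE \<omega> in lborel. indicat_real I \<omega> *\<^sub>R T \<omega> = indicat_real {e1..e2} \<omega> *\<^sub>R T \<omega>"
        proof eventually_elim
          case (elim \<omega>)
          have "\<omega> \<in> {e1..e2} \<Longrightarrow> \<omega> \<in> {e1<..<e2}" using elim by simp
          then have "\<omega> \<in> I \<longleftrightarrow> \<omega> \<in> {e1..e2}" using ee(5,6) by blast
          then show ?case by (simp add: indicator_def)
        qed
      qed measurable
      also have "\<dots> = (LINT \<omega>:{e1..e2}|lborel. free_path_length \<epsilon> \<omega> powr r)"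
        unfolding set_lebesgue_integral_def
        by (intro Bochner_Integration.integral_cong refl) (use ee Teq in \<open>auto simp: indicator_def\<close>)
      finally have L: "(LINT \<omega>:I|lborel. free_path_length \<epsilon> \<omega> powr r) = (LINT \<omega>:{e1..e2}|lborel. free_path_length \<epsilon> \<omega> powr r)" .
      have m: "measure lborel I = e2 - e1" using measure_between_Icc_Ioo[OF ee(4,5,6)] ee(2) by simp
      show ?thesis unfolding L m using C(2)[OF \<epsilon> ee(1,2,3)] rhs by linarith
    qed
  qed simp
qed

end
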